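(* Let $X$ be a compact convex set such that for each $x\in\operatorname{ext}X$ the set $\{x\}$ is a split face of $X$ (in particular, this takes place if $X$ is a simplex). Let $H$ be an intermediate function space on $X$ containing all affine semicontinuous functions (i.e., $A_s(X)\subset H$). Then $\iota(x)\in\operatorname{ext}S(H)$ for any $x\in\operatorname{ext}X$. This applies (i.e. the inclusion $A_s(X)\subset H$ is satisfied), among others, in the following cases: (a) $A_b(X)\cap\mathrm{Bo}_1(X)\subset H$; (b) $X$ is metrizable and $A_1(X)\subset H$. If $H$ is moreover determined by extreme points, then $Z(H)=M(H)$.
   Context: A compact convex set is a compact convex subset of a (Hausdorff) locally convex real topological vector space; $\operatorname{ext}X$ is the set of its extreme points. $A_c(X)$ is the space of continuous affine real functions on $X$ and $A_b(X)$ the space of bounded affine real functions on $X$, with the supremum norm and pointwise order. An intermediate function space on $X$ is a (norm-)closed linear subspace $H\subset A_b(X)$ with $A_c(X)\subset H$. It is determined by extreme points if $\inf u(\operatorname{ext}X)\le u\le\sup u(\operatorname{ext}X)$ for every $u\in H$. $A_s(X)=A_l(X)-A_l(X)$, where $A_l(X)$ is the set of real-valued lower semicontinuous affine functions on $X$. $A_1(X)$ is the space of affine functions on $X$ that are pointwise limits of sequences of continuous functions (Baire-one). $\mathrm{Bo}_1(X)$ is the space of functions $f:X\to\mathbb R$ of the first Borel class, i.e. such that for each open $U\subset\mathbb R$ the set $f^{-1}(U)$ is a countable union of sets each of which is the intersection of a closed and an open set. A set $A\subset X$ is extremal if $y,z\in A$ whenever $y,z\in X$ and $\frac12(y+z)\in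 A$; a face is a convex extremal set. For a face $A$, the complementary set $A'$ is the union of all faces disjoint from $A$. A face $A$ is split if $A'$ is convex and for each $x\in X\setminus(A\cup A')$ there is a unique $\lambda\in(0,1)$ and a unique pair $a\in A$, $a'\in A'$ with $x=\lambda a+(1-\lambda)a'$. $X$ is a simplex if each $x\in X$ is the barycenter of a unique Radon probability measure on $X$ that is maximal in the dilation order ($\mu\prec\nu$ iff $\int f\,d\mu\le\int f\,d\nu$ for all convex continuous $f$). $S(H)=\{\varphi\in H^*:\|\varphi\|\le1,\ \varphi(1_X)=1\}$ with the weak$^*$ topology is the state space of $H$, and $\iota:X\to S(H)$ is $\iota(x)(a)=a(x)$, $a\in H$. $\mathfrak D(H)$ is the set of bounded linear operators $T:H\to H$ with $-\lambda I\le T\le\lambda I$ for some $\lambda\ge0$ ($T\ge0$ means $Ta\ge0$ for $a\ge0$). Center: $Z(H)=\{T(1_X):T\in\mathfrak D(H)\}$. Multipliers: $M(H)=\{u\in H:\forall a\in H\ \exists b\in H\colon b=u\cdot a\text{ on }\operatorname{ext}X\}$. *)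

theory Defs
  imports "HOL-Probability.Probability" "HOL-Library.Function_Algebras"
begin

section \<open>Locally convex spaces and spaces of functions\<close>

class locally_convex_space = real_vector + t2_space + topological_ab_group_add +
  assumes tendsto_scaleR_Pair:
      "LIM z (nhds c \<times>\<^sub>F nhds x). fst z *\<^sub>R snd z :> nhds (c *\<^sub>R x)"
    and open_contains_convex:
      "\<lbrakk>open U; x \<in> U\<rbrakk> \<Longrightarrow> \<exists>V. open V \<and> x \<in> V \<and> V \<subseteq> U \<and>
        (\<forall>y\<in>V. \<forall>z\<in>V. \<forall>t. 0 \<le> t \<and> t \<le> 1 \<longrightarrow> (1 - t) *\<^sub>R y + t *\<^sub>R z \<in> V)"

instance real_normed_vector \<subseteq> locally_convex_space
proof
  fix c :: real and x :: 'a
  show "LIM z (nhds c \<times>\<^sub>F nhds x). fst z *\<^sub>R snd z :> nhds (c *\<^sub>R x)"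
    by (intro tendsto_scaleR filterlim_fst filterlim_snd)
next
  fix U :: "'a set" and x :: 'a
  assume "open U" "x \<in> U"
  then obtain e where "e > 0" "ball x e \<subseteq> U"
    by (meson openE)
  moreover have "\<forall>y\<in>ball x e. \<forall>z\<in>ball x e. \<forall>t. 0 \<le> t \<and> t \<le> 1 \<longrightarrow>
      (1 - t) *\<^sub>R y + t *\<^sub>R z \<in> ball x e"
    using convex_ball[of x e] unfolding convex_alt by blast
  ultimately show "\<exists>V. open V \<and> x \<in> V \<and> V \<subseteq> U \<and>
      (\<forall>y\<in>V. \<forall>z\<in>V. \<forall>t. 0 \<le> t \<and> t \<le> 1 \<longrightarrow> (1 - t) *\<^sub>R y + t *\<^sub>R z \<in> V)"
    by (intro exI[of _ "ball x e"]) simp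
qed

text \<open>
  Pointwise vector space structure on functions. Together with the pointwise order and the
  product topology (the topology of pointwise convergence) from the library, it is used below
  both for real functions on a set and for functionals on such functions.
\<close>

instantiation "fun" :: (type, real_vector) real_vector
begin

definition scaleR_fun :: "real \<Rightarrow> ('a \<Rightarrow> 'b) \<Rightarrow> 'a \<Rightarrow> 'b"
  where "scaleR_fun c f = (\<lambda>x. c *\<^sub>R f x)"

instance
  by standard (auto simp: scaleR_fun_def fun_eq_iff algebra_simps)

end

lemma scaleR_fun_apply [simp]: "(c *\<^sub>R f) x = c *\<^sub>R f x"
  by (simp add: scaleR_fun_def)

section \<open>Affine functions on a convex set\<close>

text \<open>
  A real function on \<open>X\<close> is represented by its extension by zero outside \<open>X\<close>. In this way equality,
  order and linear operations of functions on \<open>X\<close> are those of the function type, and the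
  constant function one on \<open>X\<close> is \<^term>\<open>indicat_real X\<close>.
\<close>

definition functions_on :: "'a set \<Rightarrow> ('a \<Rightarrow> real) set"
  where "functions_on X = {f. \<forall>x. x \<notin> X \<longrightarrow> f x = 0}"

definition affine_on :: "'a::real_vector set \<Rightarrow> ('a \<Rightarrow> real) \<Rightarrow> bool"
  where "affine_on X f \<longleftrightarrow>
    (\<forall>x\<in>X. \<forall>y\<in>X. \<forall>t\<in>{0..1}. f ((1 - t) *\<^sub>R x + t *\<^sub>R y) = (1 - t) * f x + t * f y)"

definition A_c :: "'a::locally_convex_space set \<Rightarrow> ('a \<Rightarrow> real) set"
  where "A_c X = {f \<in> functions_on X. affine_on X f \<and> continuous_on X f}"

definition A_b :: "'a::real_vector set \<Rightarrow> ('a \<Rightarrow> real) set"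
  where "A_b X = {f \<in> functions_on X. affine_on X f \<and> bounded (f ` X)}"

definition lower_semicontinuous_on :: "'a::topological_space set \<Rightarrow> ('a \<Rightarrow> real) \<Rightarrow> bool"
  where "lower_semicontinuous_on X f \<longleftrightarrow> (\<forall>r. openin (top_of_set X) {x\<in>X. r < f x})"

definition A_l :: "'a::locally_convex_space set \<Rightarrow> ('a \<Rightarrow> real) set"
  where "A_l X = {f \<in> functions_on X. affine_on X f \<and> lower_semicontinuous_on X f}"

definition A_s :: "'a::locally_convex_space set \<Rightarrow> ('a \<Rightarrow> real) set"
  where "A_s X = {f - g |f g. f \<in> A_l X \<and> g \<in> A_l X}"

definition A_1 :: "'a::locally_convex_space set \<Rightarrow> ('a \<Rightarrow> real) set"
  where "A_1 X = {f \<in> functions_on X. affine_on X f \<and>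
    (\<exists>g :: nat \<Rightarrow> 'a \<Rightarrow> real. (\<forall>n. continuous_on X (g n)) \<and> (\<forall>x\<in>X. (\<lambda>n. g n x) \<longlonglongrightarrow> f x))}"

definition Bo_1 :: "'a::topological_space set \<Rightarrow> ('a \<Rightarrow> real) set"
  where "Bo_1 X = {f \<in> functions_on X. \<forall>U. open U \<longrightarrow>
    (\<exists>F G :: nat \<Rightarrow> 'a set. (\<forall>n. closedin (top_of_set X) (F n) \<and> openin (top_of_set X) (G n)) \<and>
       {x\<in>X. f x \<in> U} = (\<Union>n. F n \<inter> G n))}"

definition sup_norm :: "'a set \<Rightarrow> ('a \<Rightarrow> real) \<Rightarrow> real"
  where "sup_norm X f = (SUP x\<in>X. \<bar>f x\<bar>)"

definition ext :: "'a::real_vector set \<Rightarrow> 'a set"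
  where "ext X = {x. x extreme_point_of X}"

section \<open>Split faces and simplices\<close>

definition extremal :: "'a::real_vector set \<Rightarrow> 'a set \<Rightarrow> bool"
  where "extremal X A \<longleftrightarrow> A \<subseteq> X \<and>
    (\<forall>y\<in>X. \<forall>z\<in>X. (1/2) *\<^sub>R (y + z) \<in> A \<longrightarrow> y \<in> A \<and> z \<in> A)"

lemma extremal_endpoint:
  fixes X A :: "'a::real_vector set"
  assumes "convex X" "extremal X A" "a \<in> X" "b \<in> X" "0 < u" "u < 1"
    and "(1 - u) *\<^sub>R a + u *\<^sub>R b \<in> A"
  shows "b \<in> A"
proof -
  have comb: "(1 - t) *\<^sub>R a + t *\<^sub>R b \<in> X" if "0 \<le> t" "t \<le> 1" for t
    using assms(1,3,4) that unfolding convex_alt by blast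
  have ext: "y \<in> A \<and> z \<in> A" if "y \<in> X" "z \<in> X" "y + z = 2 *\<^sub>R x" "x \<in> A" for x y z
    using assms(2) that by (simp add: extremal_def)
  obtain n where "(1/2)^n < u"
    using real_arch_pow_inv[of u "1/2"] assms by auto
  then have "1 \<le> 2 ^ n * u"
    by (simp add: field_simps power_one_over)
  with assms(5-7) show ?thesis
  proof (induction n arbitrary: u)
    case 0
    then show ?case by simp
  next
    case (Suc n)
    let ?x = "(1 - u) *\<^sub>R a + u *\<^sub>R b"
    show ?case
    proof (cases "u < 1/2")
      case True
      let ?c = "(1 - 2*u) *\<^sub>R a + (2*u) *\<^sub>R b"
      have "a + ?c = 2 *\<^sub>R ?x"
        by (simp add: scaleR_add_right scaleR_diff_left scaleR_diff_right scaleR_2[of a])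
      moreover have "?c \<in> X"
        by (rule comb) (use True Suc.prems in auto)
      ultimately have "?c \<in> A"
        using ext[of a ?c ?x] assms(3) Suc.prems(3) by blast
      moreover have "1 \<le> 2 ^ n * (2 * u)"
        using Suc.prems(4) by (simp add: mult.assoc mult.left_commute)
      ultimately show ?thesis
        using Suc.IH[of "2*u"] Suc.prems(1) True by linarith
    next
      case False
      let ?c = "(1 - (2*u - 1)) *\<^sub>R a + (2*u - 1) *\<^sub>R b"
      have "?c + b = 2 *\<^sub>R ?x"
        by (simp add: scaleR_add_right scaleR_diff_left scaleR_diff_right scaleR_2[of a])
      moreover have "?c \<in> X"
        by (rule comb) (use False Suc.prems in auto)
      ultimately show ?thesis
        using ext[of ?c b ?x] assms(4) Suc.prems(3) by blast
    qed
  qed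
qed

text \<open>The library notion of a face agrees with that of a convex extremal set.\<close>

lemma face_of_iff_extremal:
  fixes X A :: "'a::real_vector set"
  assumes "convex X"
  shows "A face_of X \<longleftrightarrow> convex A \<and> extremal X A"
proof
  assume A: "A face_of X"
  have "y \<in> A \<and> z \<in> A" if "y \<in> X" "z \<in> X" "(1/2) *\<^sub>R (y + z) \<in> A" for y z
  proof (cases "y = z")
    case True
    then have "(1/2) *\<^sub>R (y + z) = y"
      by (simp flip: scaleR_2)
    with that True show ?thesis by simp
  next
    case False
    then have "midpoint y z \<in> open_segment y z"
      by simp
    then show ?thesis
      using A that by (auto simp: face_of_def midpoint_def)
  qed
  with A show "convex A \<and> extremal X A"
    unfolding face_of_def extremal_def by blast
next
  assume A: "convex A \<and> extremal X A"
  have "a \<in> A \<and> b \<in> A" if ab: "a \<in> X" "b \<in> X" "x \<in> A" "x \<in> open_segment a b" for a b x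
  proof -
    obtain u where u: "0 < u" "u < 1" "x = (1 - u) *\<^sub>R a + u *\<^sub>R b"
      using ab(4) by (auto simp: in_segment)
    have "b \<in> A"
      using extremal_endpoint[of X A a b u] assms A ab(1-3) u by blast
    moreover have "(1 - (1 - u)) *\<^sub>R b + (1 - u) *\<^sub>R a \<in> A"
      using ab(3) u(3) by (simp add: add.commute)
    then have "a \<in> A"
      using extremal_endpoint[of X A b a "1 - u"] assms A ab(1,2) u(1,2) by simp
    ultimately show ?thesis by blast
  qed
  with A show "A face_of X"
    unfolding face_of_def extremal_def by blast
qed

definition complementary_set :: "'a::real_vector set \<Rightarrow> 'a set \<Rightarrow> 'a set"
  where "complementary_set X A = \<Union>{F. F face_of X \<and> F \<inter> A = {}}"

definition split_face :: "'a::real_vector set \<Rightarrow> 'a set \<Rightarrow> bool"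
  where "split_face X A \<longleftrightarrow> A face_of X \<and> convex (complementary_set X A) \<and>
    (\<forall>x \<in> X - (A \<union> complementary_set X A).
       \<exists>!p. case p of (l, a, a') \<Rightarrow>
         l \<in> {0<..<1} \<and> a \<in> A \<and> a' \<in> complementary_set X A \<and> x = l *\<^sub>R a + (1 - l) *\<^sub>R a')"

definition radon_probabilities :: "'a::topological_space set \<Rightarrow> 'a measure set"
  where "radon_probabilities X = {\<mu>. prob_space \<mu> \<and> sets \<mu> = sets (restrict_space borel X) \<and>
    (\<forall>B\<in>sets \<mu>. emeasure \<mu> B = (SUP K\<in>{K. K \<subseteq> B \<and> compact K}. emeasure \<mu> K))}"

definition barycenter :: "'a::locally_convex_space set \<Rightarrow> 'a measure \<Rightarrow> 'a \<Rightarrow> bool"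
  where "barycenter X \<mu> x \<longleftrightarrow> x \<in> X \<and> (\<forall>f\<in>A_c X. (\<integral>y. f y \<partial>\<mu>) = f x)"

definition dilation_le :: "'a::locally_convex_space set \<Rightarrow> 'a measure \<Rightarrow> 'a measure \<Rightarrow> bool"
  where "dilation_le X \<mu> \<nu> \<longleftrightarrow>
    (\<forall>f. convex_on X f \<and> continuous_on X f \<longrightarrow> (\<integral>y. f y \<partial>\<mu>) \<le> (\<integral>y. f y \<partial>\<nu>))"

definition maximal_measure :: "'a::locally_convex_space set \<Rightarrow> 'a measure \<Rightarrow> bool"
  where "maximal_measure X \<mu> \<longleftrightarrow> \<mu> \<in> radon_probabilities X \<and>
    (\<forall>\<nu>\<in>radon_probabilities X. dilation_le X \<mu> \<nu> \<longrightarrow> \<nu> = \<mu>)"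

definition choquet_simplex :: "'a::locally_convex_space set \<Rightarrow> bool"
  where "choquet_simplex X \<longleftrightarrow> (\<forall>x\<in>X. \<exists>!\<mu>. maximal_measure X \<mu> \<and> barycenter X \<mu> x)"

section \<open>Intermediate function spaces\<close>

definition intermediate_function_space ::
    "'a::locally_convex_space set \<Rightarrow> ('a \<Rightarrow> real) set \<Rightarrow> bool"
  where "intermediate_function_space X H \<longleftrightarrow> subspace H \<and> A_c X \<subseteq> H \<and> H \<subseteq> A_b X \<and>
    (\<forall>f\<in>A_b X. (\<forall>e>0. \<exists>h\<in>H. sup_norm X (f - h) < e) \<longrightarrow> f \<in> H)"

definition determined_by_extreme_points ::
    "'a::real_vector set \<Rightarrow> ('a \<Rightarrow> real) set \<Rightarrow> bool"
  where "determined_by_extreme_points X H \<longleftrightarrow>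
    (\<forall>u\<in>H. \<forall>x\<in>X. (INF e\<in>ext X. u e) \<le> u x \<and> u x \<le> (SUP e\<in>ext X. u e))"

definition linear_on :: "'b::real_vector set \<Rightarrow> ('b \<Rightarrow> 'c::real_vector) \<Rightarrow> bool"
  where "linear_on H T \<longleftrightarrow>
    (\<forall>a\<in>H. \<forall>b\<in>H. T (a + b) = T a + T b) \<and> (\<forall>c. \<forall>a\<in>H. T (c *\<^sub>R a) = c *\<^sub>R T a)"

text \<open>Functionals on \<open>H\<close> are normalised to vanish off \<open>H\<close>, so that they are determined by their values on \<open>H\<close>.\<close>

definition dual :: "'a set \<Rightarrow> ('a \<Rightarrow> real) set \<Rightarrow> (('a \<Rightarrow> real) \<Rightarrow> real) set"
  where "dual X H = {\<phi>. linear_on H \<phi> \<and> (\<forall>a. a \<notin> H \<longrightarrow> \<phi> a = 0) \<and>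
    (\<exists>K. \<forall>a\<in>H. \<bar>\<phi> a\<bar> \<le> K * sup_norm X a)}"

definition dual_norm :: "'a set \<Rightarrow> ('a \<Rightarrow> real) set \<Rightarrow> (('a \<Rightarrow> real) \<Rightarrow> real) \<Rightarrow> real"
  where "dual_norm X H \<phi> = (SUP a\<in>{a\<in>H. sup_norm X a \<le> 1}. \<bar>\<phi> a\<bar>)"

text \<open>
  The weak* topology on the state space is the subspace topology inherited from the product
  topology of the function type.
\<close>

definition state_space :: "'a set \<Rightarrow> ('a \<Rightarrow> real) set \<Rightarrow> (('a \<Rightarrow> real) \<Rightarrow> real) set"
  where "state_space X H = {\<phi> \<in> dual X H. dual_norm X H \<phi> \<le> 1 \<and> \<phi> (indicat_real X) = 1}"

definition evaluation :: "('a \<Rightarrow> real) set \<Rightarrow> 'a \<Rightarrow> ('a \<Rightarrow> real) \<Rightarrow> real"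
  where "evaluation H x = (\<lambda>a. if a \<in> H then a x else 0)"

section \<open>Center and multipliers\<close>

definition positive_operator :: "('a \<Rightarrow> real) set \<Rightarrow> (('a \<Rightarrow> real) \<Rightarrow> 'a \<Rightarrow> real) \<Rightarrow> bool"
  where "positive_operator H T \<longleftrightarrow> (\<forall>a\<in>H. 0 \<le> a \<longrightarrow> 0 \<le> T a)"

text \<open>Operators on \<open>H\<close> are total functions whose values off \<open>H\<close> are irrelevant.\<close>

definition order_bounded_operators ::
    "'a set \<Rightarrow> ('a \<Rightarrow> real) set \<Rightarrow> (('a \<Rightarrow> real) \<Rightarrow> 'a \<Rightarrow> real) set"
  where "order_bounded_operators X H = {T. T ` H \<subseteq> H \<and> linear_on H T \<and>
    (\<exists>K. \<forall>a\<in>H. sup_norm X (T a) \<le> K * sup_norm X a) \<and>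
    (\<exists>l\<ge>0. positive_operator H (\<lambda>a. l *\<^sub>R a - T a) \<and> positive_operator H (\<lambda>a. T a - (- l) *\<^sub>R a))}"

definition center :: "'a set \<Rightarrow> ('a \<Rightarrow> real) set \<Rightarrow> ('a \<Rightarrow> real) set"
  where "center X H = {T (indicat_real X) |T. T \<in> order_bounded_operators X H}"

definition multipliers :: "'a::real_vector set \<Rightarrow> ('a \<Rightarrow> real) set \<Rightarrow> ('a \<Rightarrow> real) set"
  where "multipliers X H = {u\<in>H. \<forall>a\<in>H. \<exists>b\<in>H. \<forall>x\<in>ext X. b x = u x * a x}"

end

theory Submission
  imports Defs
begin

text \<open>
  Let \<open>{x}\<close> be a split face. Each \<open>y \<in> X\<close> has the form \<open>l(y) x + (1 - l(y)) d\<close>, where \<open>l\<close> is affine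
  because \<open>{x}'\<close> is convex, and upper semicontinuous because \<open>{l \<ge> r} = r x + (1 - r) X\<close>. Hence
  \<open>l \<in> A_s X \<subseteq> H\<close>. As \<open>\<bar>b - b(x) l\<bar> \<le> \<parallel>b\<parallel> (1 - l)\<close> for every \<open>b \<in> H\<close>, a positive functional that
  vanishes at \<open>1 - l\<close> is a multiple of the evaluation at \<open>x\<close>. This applies to both states in a convex
  decomposition of the evaluation, and to \<open>b \<mapsto> k b(x) - (T b)(x)\<close> for an order bounded operator \<open>T\<close>.

  If \<open>X\<close> is a simplex and \<open>m y\<close> is the maximal measure representing \<open>y\<close>, the function \<open>l\<close> is
  \<open>y \<mapsto> m y {x}\<close>. It is affine since convex combinations of maximal measures are maximal and the
  representing maximal measures are unique.
\<close>

section \<open>The Hahn--Banach theorem\<close>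

text \<open>Both roads to the function \<open>l\<close> end in the same data:
  \<open>0 \<le> l \<le> 1\<close>, \<open>l x = 1\<close> and, for every \<open>y\<close>, a
  decomposition of \<open>y\<close> with coefficient \<open>l y\<close> at \<open>x\<close>. For a
  simplex the value at \<open>x\<close> needs extremality: every measure representing an extreme
  point is concentrated there. Conversely such an affine \<open>l\<close> makes \<open>{x}\<close>
  split, because \<open>{l = 0}\<close> is then the complementary face. The Hahn-Banach theorem
  serves two purposes. It separates points from compact convex sets, which locates barycenters, and
  it cuts a measure into two parts that dilate prescribed measures, which makes mixtures of maximal
  measures maximal. The inclusion of the multipliers in the center rests on determination by extreme
  points: it makes the product of \<open>u\<close> and \<open>a\<close> on \<open>ext X\<close>
  extend to a unique member of \<open>H\<close>, and this extension depends on \<open>a\<close>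
  linearly and with the required bounds. In case (a) the obstacle is boundedness. Compactness bounds
  a lower semicontinuous function from below; the upper bound has to come from affinity, through an
  infinite convex combination.\<close>

lemma linear_onD:
  assumes "linear_on S f" and "subspace S"
  shows linear_on_add: "\<And>a b. \<lbrakk>a \<in> S; b \<in> S\<rbrakk> \<Longrightarrow> f (a + b) = f a + f b"
    and linear_on_scale: "\<And>a c. a \<in> S \<Longrightarrow> f (c *\<^sub>R a) = c *\<^sub>R f a"
    and linear_on_zero: "f 0 = 0"
    and linear_on_minus: "\<And>a. a \<in> S \<Longrightarrow> f (- a) = - f a"
    and linear_on_diff: "\<And>a b. \<lbrakk>a \<in> S; b \<in> S\<rbrakk> \<Longrightarrow> f (a - b) = f a - f b"
proof -
  show add: "f (a + b) = f a + f b" if "a \<in> S" "b \<in> S" for a b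
    using assms(1) that by (auto simp: linear_on_def)
  show scale: "f (c *\<^sub>R a) = c *\<^sub>R f a" if "a \<in> S" for a c
    using assms(1) that by (auto simp: linear_on_def)
  show "f 0 = 0"
    using scale[of 0 0] subspace_0[OF assms(2)] by simp
  show minus: "f (- a) = - f a" if "a \<in> S" for a
    using scale[of a "-1"] that by simp
  show "f (a - b) = f a - f b" if "a \<in> S" "b \<in> S" for a b
    using add[of a "- b"] minus[of b] that subspace_neg[OF assms(2), of b] by simp
qed

text \<open>Homogeneity is stated as an inequality, the form that is easiest to check for infima;
  equality follows by using it for \<open>inverse c\<close>.\<close>

definition sublinear_on :: "'b::real_vector set \<Rightarrow> ('b \<Rightarrow> real) \<Rightarrow> bool"
  where "sublinear_on S p \<longleftrightarrow>
    (\<forall>x\<in>S. \<forall>y\<in>S. p (x + y) \<le> p x + p y) \<and> (\<forall>x\<in>S. \<forall>c\<ge>0. p (c *\<^sub>R x) \<le> c * p x)"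

lemma sublinear_onD:
  assumes "sublinear_on S p" and "subspace S"
  shows sublinear_on_add: "\<And>x y. \<lbrakk>x \<in> S; y \<in> S\<rbrakk> \<Longrightarrow> p (x + y) \<le> p x + p y"
    and sublinear_on_scale_le: "\<And>x c. \<lbrakk>x \<in> S; 0 \<le> c\<rbrakk> \<Longrightarrow> p (c *\<^sub>R x) \<le> c * p x"
    and sublinear_on_zero: "p 0 = 0"
    and sublinear_on_scale: "\<And>x c. \<lbrakk>x \<in> S; 0 \<le> c\<rbrakk> \<Longrightarrow> p (c *\<^sub>R x) = c * p x"
    and sublinear_on_minus: "\<And>x. x \<in> S \<Longrightarrow> - p (- x) \<le> p x"
proof -
  show add: "p (x + y) \<le> p x + p y" if "x \<in> S" "y \<in> S" for x y
    using assms(1) that by (auto simp: sublinear_on_def)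
  show scale: "p (c *\<^sub>R x) \<le> c * p x" if "x \<in> S" "0 \<le> c" for x c
    using assms(1) that by (auto simp: sublinear_on_def)
  have 0: "0 \<in> S"
    using assms(2) by (rule subspace_0)
  show zero: "p 0 = 0"
    using scale[OF 0, of 0] add[OF 0 0] by simp
  show "p (c *\<^sub>R x) = c * p x" if x: "x \<in> S" and c: "0 \<le> c" for x c
  proof (cases "c = 0")
    case False
    have "p (inverse c *\<^sub>R (c *\<^sub>R x)) \<le> inverse c * p (c *\<^sub>R x)"
      by (rule scale) (use x c assms(2) in \<open>auto simp: subspace_scale\<close>)
    then have "c * p x \<le> p (c *\<^sub>R x)"
      using False c by (simp add: field_simps)
    then show ?thesis
      using scale[OF x c] by simp
  qed (simp add: zero)
  show "- p (- x) \<le> p x" if "x \<in> S" for x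
    using add[of x "- x"] that zero subspace_neg[OF assms(2), of x] by simp
qed

text \<open>Minimizing a jointly sublinear function over one variable preserves sublinearity.
  \<open>F_0\<close> is the consistency condition that keeps the infimum finite:
  \<open>0 \<le> F (x + - x) k \<le> F x k + F (- x) 0\<close>. In the applications \<open>k\<close>
  parametrizes constraints on the linear functionals that lie below \<open>p\<close>.\<close>

lemma cone_inf_sublinear:
  fixes F :: "'b::real_vector \<Rightarrow> 'c::real_vector \<Rightarrow> real"
  assumes S: "subspace S"
    and K0: "0 \<in> K" and K_add: "\<And>k l. \<lbrakk>k \<in> K; l \<in> K\<rbrakk> \<Longrightarrow> k + l \<in> K"
    and K_scale: "\<And>k c. \<lbrakk>k \<in> K; 0 \<le> c\<rbrakk> \<Longrightarrow> c *\<^sub>R k \<in> K"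
    and F_add: "\<And>x y k l. \<lbrakk>x \<in> S; y \<in> S; k \<in> K; l \<in> K\<rbrakk> \<Longrightarrow> F (x + y) (k + l) \<le> F x k + F y l"
    and F_scale: "\<And>x k c. \<lbrakk>x \<in> S; k \<in> K; 0 \<le> c\<rbrakk> \<Longrightarrow> F (c *\<^sub>R x) (c *\<^sub>R k) \<le> c * F x k"
    and F_0: "\<And>k. k \<in> K \<Longrightarrow> 0 \<le> F 0 k"
  defines "p \<equiv> \<lambda>x. INF k\<in>K. F x k"
  shows "sublinear_on S p" and "\<And>x k. \<lbrakk>x \<in> S; k \<in> K\<rbrakk> \<Longrightarrow> p x \<le> F x k"
proof -
  have bdd: "bdd_below (F x ` K)" if x: "x \<in> S" for x
  proof
    fix r assume "r \<in> F x ` K"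
    then obtain k where k: "k \<in> K" "r = F x k" by auto
    have "0 \<le> F (x + - x) (k + 0)"
      using F_0[OF k(1)] by simp
    also have "\<dots> \<le> F x k + F (- x) 0"
      by (rule F_add) (use x k K0 S in \<open>auto simp: subspace_neg\<close>)
    finally show "- F (- x) 0 \<le> r"
      using k by simp
  qed
  show le: "p x \<le> F x k" if "x \<in> S" "k \<in> K" for x k
    unfolding p_def using bdd that by (intro cINF_lower)
  show "sublinear_on S p"
    unfolding sublinear_on_def
  proof (intro conjI ballI allI impI)
    fix x y assume xy: "x \<in> S" "y \<in> S"
    have "p (x + y) - F x k \<le> F y l" if "k \<in> K" "l \<in> K" for k l
      using le[of "x + y" "k + l"] F_add[OF xy that] K_add[OF that] xy S
      by (simp add: subspace_add)
    then have "p (x + y) - F x k \<le> p y" if "k \<in> K" for k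
      unfolding p_def using K0 that by (intro cINF_greatest) auto
    then have "p (x + y) - p y \<le> F x k" if "k \<in> K" for k
      using that by (simp add: algebra_simps)
    then have "p (x + y) - p y \<le> p x"
      using K0 by (subst (3) p_def, intro cINF_greatest) auto
    then show "p (x + y) \<le> p x + p y" by simp
  next
    fix x and c :: real assume x: "x \<in> S" and c: "0 \<le> c"
    have le': "p (c *\<^sub>R x) \<le> c * F x k" if "k \<in> K" for k
      using le[of "c *\<^sub>R x" "c *\<^sub>R k"] F_scale[OF x that c] K_scale[OF that c] x S
      by (simp add: subspace_scale)
    show "p (c *\<^sub>R x) \<le> c * p x"
    proof (cases "c = 0")
      case True
      then show ?thesis using le'[OF K0] by simp
    next
      case False
      have "p (c *\<^sub>R x) / c \<le> p x"
        using K0 le' False c by (subst (2) p_def, intro cINF_greatest) (auto simp: field_simps)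
      then show ?thesis using False c by (simp add: field_simps)
    qed
  qed
qed

text \<open>A linear \<open>f \<le> q\<close> with \<open>f v = q v\<close> satisfies
  \<open>f x = f (x + t v) - t f v \<le> ?F x t\<close> for all \<open>t \<ge> 0\<close>;
  \<open>q'\<close> is the best of these bounds. The choices \<open>t = 0\<close> and
  \<open>t = 1\<close> give the two estimates.\<close>

lemma sublinear_on_tighten:
  assumes S: "subspace S" and q: "sublinear_on S q" and v: "v \<in> S"
  obtains q' where "sublinear_on S q'" "\<And>x. x \<in> S \<Longrightarrow> q' x \<le> q x"
    "\<And>x. x \<in> S \<Longrightarrow> q' x \<le> q (x + v) - q v"
proof
  let ?F = "\<lambda>x t. q (x + t *\<^sub>R v) - t * q v"
  let ?q' = "\<lambda>x. INF t\<in>{0..}. ?F x t"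
  note qD = sublinear_onD[OF q S]
  have mem: "x + t *\<^sub>R v \<in> S" if "x \<in> S" for x t
    using that v S by (simp add: subspace_add subspace_scale)
  have add: "?F (x + y) (k + l) \<le> ?F x k + ?F y l" if "x \<in> S" "y \<in> S" for x y k l
    using qD(1)[OF mem[OF that(1), of k] mem[OF that(2), of l]] by (simp add: algebra_simps)
  have scale: "?F (c *\<^sub>R x) (c *\<^sub>R k) \<le> c * ?F x k" if "x \<in> S" "0 \<le> c" for x k c
    using qD(2)[OF mem[OF that(1), of k] that(2)] by (simp add: algebra_simps)
  have nonneg: "0 \<le> ?F 0 t" if "0 \<le> t" for t
    using qD(4)[OF v that] by simp
  note * = cone_inf_sublinear[of S "{0..}" ?F, OF S]
  show "sublinear_on S ?q'"
    by (rule *(1)) (use add scale nonneg in auto)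
  have le: "?q' x \<le> ?F x t" if "x \<in> S" "0 \<le> t" for x t
    by (rule *(2)) (use add scale nonneg that in auto)
  show "?q' x \<le> q x" if "x \<in> S" for x
    using le[OF that, of 0] by simp
  show "?q' x \<le> q (x + v) - q v" if "x \<in> S" for x
    using le[OF that, of 1] by simp
qed

text \<open>A minimal sublinear functional below \<open>p\<close> is linear: tightening it at
  \<open>v\<close> cannot lower it, and this turns subadditivity into additivity.\<close>

lemma hahn_banach_sublinear:
  assumes S: "subspace S" and p: "sublinear_on S p"
  obtains f where "linear_on S f" "\<And>x. x \<in> S \<Longrightarrow> f x \<le> p x"
proof -
  \<comment> \<open>Members vanish off \<open>S\<close>, so that minimality in the pointwise order
    of total functions yields equality of functions. \<open>?P\<close> reverses the order because
    Zorn's lemma is applied downwards.\<close>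
  define A where "A = {q. sublinear_on S q \<and> (\<forall>x\<in>S. q x \<le> p x) \<and> (\<forall>x. x \<notin> S \<longrightarrow> q x = 0)}"
  let ?P = "\<lambda>q q' :: 'a \<Rightarrow> real. q' \<le> q"
  define p0 where "p0 = (\<lambda>x. if x \<in> S then p x else 0)"
  have ex: "sublinear_on S (\<lambda>x. if x \<in> S then q x else 0)" if "sublinear_on S q" for q
    using that S unfolding sublinear_on_def by (auto simp: subspace_add subspace_scale)
  have "\<exists>m\<in>A. \<forall>a\<in>A. ?P m a \<longrightarrow> a = m"
  proof (rule predicate_Zorn)
    show "partial_order_on A (relation_of ?P A)"
      by (auto simp: partial_order_on_def preorder_on_def refl_on_def trans_def antisym_def
          relation_of_def)
  next
    fix C assume "C \<in> Chains (relation_of ?P A)"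
    then have C: "q \<in> A \<and> q' \<in> A \<and> (q \<le> q' \<or> q' \<le> q)" if "q \<in> C" "q' \<in> C" for q q'
      using that unfolding Chains_def relation_of_def by blast
    show "\<exists>u\<in>A. \<forall>a\<in>C. ?P a u"
    proof (cases "C = {}")
      case True
      have "p0 \<in> A"
        using ex[OF p] by (auto simp: A_def p0_def)
      with True show ?thesis by auto
    next
      case False
      define u where "u = (\<lambda>x. INF q\<in>C. q x)"
      have bdd: "bdd_below ((\<lambda>q. q x) ` C)" for x
      proof (cases "x \<in> S")
        case True
        have "- p (- x) \<le> q x" if "q \<in> C" for q
        proof -
          have "q \<in> A" using C that by blast
          then have "- q (- x) \<le> q x" "q (- x) \<le> p (- x)"
            using True sublinear_on_minus[OF _ S] S by (auto simp: A_def subspace_neg)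
          then show ?thesis by simp
        qed
        then show ?thesis by (intro bdd_belowI2)
      next
        case False
        then have "0 \<le> q x" if "q \<in> C" for q
          using C[OF that that] by (auto simp: A_def)
        then show ?thesis by (intro bdd_belowI2)
      qed
      have le: "u x \<le> q x" if "q \<in> C" for q x
        unfolding u_def using bdd that by (intro cINF_lower)
      have great: "r \<le> u x" if "\<And>q. q \<in> C \<Longrightarrow> r \<le> q x" for r x
        unfolding u_def using False that by (intro cINF_greatest)
      have "sublinear_on S u"
        unfolding sublinear_on_def
      proof (intro conjI ballI allI impI)
        fix x y assume xy: "x \<in> S" "y \<in> S"
        have "u (x + y) \<le> q x + q' y" if q: "q \<in> C" "q' \<in> C" for q q'
        proof -
          \<comment> \<open>By totality of the chain one member lies below both \<open>q\<close> and
            \<open>q'\<close>, and its subadditivity carries over to the infimum.\<close>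
          obtain r where r: "r \<in> C" "r \<le> q" "r \<le> q'"
            using C[OF q] q by (metis order_refl)
          then have "r (x + y) \<le> r x + r y"
            using C[of r r] xy by (auto simp: A_def sublinear_on_def)
          then show ?thesis
            using le[OF r(1), of "x + y"] le_funD[OF r(2), of x] le_funD[OF r(3), of y] by linarith
        qed
        then have "u (x + y) - q' y \<le> u x" if "q' \<in> C" for q'
          using that by (intro great) (simp add: algebra_simps)
        then have "u (x + y) - u x \<le> u y"
          by (intro great) (simp add: algebra_simps)
        then show "u (x + y) \<le> u x + u y" by simp
      next
        fix x and c :: real assume x: "x \<in> S" "0 \<le> c"
        have *: "u (c *\<^sub>R x) \<le> c * q x" if "q \<in> C" for q
          using le[OF that, of "c *\<^sub>R x"] C[OF that that] x
          by (force simp: A_def sublinear_on_def)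
        show "u (c *\<^sub>R x) \<le> c * u x"
        proof (cases "c = 0")
          case True
          then show ?thesis using * False by auto
        next
          case False
          have "u (c *\<^sub>R x) / c \<le> u x"
            by (intro great) (use * False x in \<open>auto simp: field_simps\<close>)
          then show ?thesis using False x by (simp add: field_simps)
        qed
      qed
      moreover have "u x \<le> p x" if "x \<in> S" for x
        using False C le that unfolding A_def by (fastforce intro: order_trans)
      moreover have "u x = 0" if x: "x \<notin> S" for x
      proof -
        have "q x = 0" if "q \<in> C" for q
          using C[OF that that] x by (auto simp: A_def)
        then have "(\<lambda>q. q x) ` C = {0}"
          using False by force
        then show ?thesis by (simp add: u_def)
      qed
      ultimately have "u \<in> A" by (simp add: A_def)
      then show ?thesis using le by (auto simp: le_fun_def)
    qed
  qed
  then obtain m where m: "m \<in> A" and min: "\<And>q. \<lbrakk>q \<in> A; q \<le> m\<rbrakk> \<Longrightarrow> q = m" by blast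
  have sub: "sublinear_on S m" and mp: "\<And>x. x \<in> S \<Longrightarrow> m x \<le> p x"
    and off: "\<And>x. x \<notin> S \<Longrightarrow> m x = 0"
    using m by (auto simp: A_def)
  note mD = sublinear_onD[OF sub S]
  \<comment> \<open>The functional obtained by tightening \<open>m\<close> at \<open>v\<close>,
    extended by zero, belongs to \<open>A\<close> and lies below \<open>m\<close>, hence equals
    \<open>m\<close>; its second estimate is then superadditivity.\<close>
  have super: "m x + m v \<le> m (x + v)" if x: "x \<in> S" and v: "v \<in> S" for x v
  proof -
    obtain q where q: "sublinear_on S q" "\<And>x. x \<in> S \<Longrightarrow> q x \<le> m x"
      "\<And>x. x \<in> S \<Longrightarrow> q x \<le> m (x + v) - m v"
      by (rule sublinear_on_tighten[OF S sub v]) blast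
    have "(\<lambda>x. if x \<in> S then q x else 0) \<in> A"
      using ex[OF q(1)] q(2) mp by (fastforce simp: A_def)
    then have "(\<lambda>x. if x \<in> S then q x else 0) = m"
      using q(2) off by (intro min) (auto simp: le_fun_def)
    then have "q x = m x"
      using x by (auto dest: fun_cong[of _ _ x])
    then show ?thesis using q(3)[OF x] by simp
  qed
  have add: "m (x + v) = m x + m v" if "x \<in> S" "v \<in> S" for x v
    using super[OF that] mD(1)[OF that] by simp
  have minus: "m (- x) = - m x" if "x \<in> S" for x
    using add[of x "- x"] that mD(3) subspace_neg[OF S, of x] by simp
  have "m (c *\<^sub>R x) = c *\<^sub>R m x" if "x \<in> S" for x c
  proof (cases "0 \<le> c")
    case True
    then show ?thesis using mD(4)[OF that] by simp
  next
    case False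
    then have "m ((- c) *\<^sub>R x) = - c * m x"
      using mD(4)[OF that, of "- c"] by simp
    moreover have "m ((- c) *\<^sub>R x) = - m (c *\<^sub>R x)"
      using minus[of "c *\<^sub>R x"] that S by (simp add: subspace_scale)
    ultimately show ?thesis by simp
  qed
  then have "linear_on S m"
    using add by (auto simp: linear_on_def)
  then show thesis
    using that mp by blast
qed

text \<open>After tightening at \<open>v\<close> one has
  \<open>q (- v) \<le> p 0 - p v = - p v\<close>, so every linear functional below \<open>q\<close>
  attains \<open>p\<close> at \<open>v\<close>.\<close>

lemma hahn_banach_support:
  assumes S: "subspace S" and p: "sublinear_on S p" and v: "v \<in> S"
  obtains f where "linear_on S f" "\<And>x. x \<in> S \<Longrightarrow> f x \<le> p x" "f v = p v"
proof -
  obtain q where q: "sublinear_on S q" "\<And>x. x \<in> S \<Longrightarrow> q x \<le> p x"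
    "\<And>x. x \<in> S \<Longrightarrow> q x \<le> p (x + v) - p v"
    by (rule sublinear_on_tighten[OF S p v]) blast
  obtain f where f: "linear_on S f" "\<And>x. x \<in> S \<Longrightarrow> f x \<le> q x"
    using hahn_banach_sublinear[OF S q(1)] by blast
  have "f (- v) \<le> - p v"
    using f(2)[of "- v"] q(3)[of "- v"] v subspace_neg[OF S, of v] sublinear_onD(3)[OF p S]
    by simp
  then have "p v \<le> f v"
    using linear_onD(4)[OF f(1) S v] by simp
  then show thesis
    using that[of f] f q(2) v by (meson order_antisym order_trans)
qed

section \<open>Separation in locally convex spaces\<close>

lemma isCont_scaleR_locally_convex:
  "isCont (\<lambda>x::'a::locally_convex_space. c *\<^sub>R x) x"
proof -
  have "((\<lambda>y. (c, y)) \<longlongrightarrow> (c, x)) (at x)"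
    by (intro tendsto_intros)
  then have "filterlim (\<lambda>y. (c, y)) (nhds c \<times>\<^sub>F nhds x) (at x)"
    by (simp add: nhds_prod)
  from filterlim_compose[OF tendsto_scaleR_Pair this] show ?thesis
    by (simp add: isCont_def)
qed

lemma isCont_scaleR_left_locally_convex:
  "isCont (\<lambda>c. c *\<^sub>R (x::'a::locally_convex_space)) c"
proof -
  have "((\<lambda>d. (d, x)) \<longlongrightarrow> (c, x)) (at c)"
    by (intro tendsto_intros)
  then have "filterlim (\<lambda>d. (d, x)) (nhds c \<times>\<^sub>F nhds x) (at c)"
    by (simp add: nhds_prod)
  from filterlim_compose[OF tendsto_scaleR_Pair this] show ?thesis
    by (simp add: isCont_def)
qed

lemma continuous_on_scaleR_locally_convex [continuous_intros]:
  fixes f :: "'b::topological_space \<Rightarrow> 'a::locally_convex_space"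
  assumes "continuous_on S f"
  shows "continuous_on S (\<lambda>x. c *\<^sub>R f x)"
proof -
  have "continuous_on UNIV (\<lambda>x::'a. c *\<^sub>R x)"
    by (simp add: continuous_on_eq_continuous_at isCont_scaleR_locally_convex)
  from continuous_on_compose2[OF this assms] show ?thesis by simp
qed

lemma open_translation_locally_convex:
  fixes U :: "'a::locally_convex_space set"
  assumes "open U"
  shows "open ((\<lambda>x. a + x) ` U)"
proof -
  have "(\<lambda>x. a + x) ` U = (\<lambda>x. x - a) -` U"
    by (force simp: image_iff)
  moreover have "open ((\<lambda>x. x - a) -` U)"
    using assms by (intro open_vimage continuous_intros)
  ultimately show ?thesis by simp
qed

lemma open_convex_nhd_0:
  fixes U :: "'a::locally_convex_space set"
  assumes "open U" "0 \<in> U"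
  obtains V where "open V" "convex V" "0 \<in> V" "V \<subseteq> U"
  using open_contains_convex[OF assms] unfolding convex_alt by auto

lemma open_absorbing:
  fixes W :: "'a::locally_convex_space set"
  assumes "open W" "0 \<in> W"
  obtains s where "0 < s" "s *\<^sub>R x \<in> W"
proof -
  have "((\<lambda>c. c *\<^sub>R x) \<longlongrightarrow> 0) (at 0)"
    using isCont_scaleR_left_locally_convex[where x=x and c=0] by (simp add: isCont_def)
  then have "eventually (\<lambda>c. c *\<^sub>R x \<in> W) (at_right 0)"
    using assms by (auto simp: eventually_at_split dest: topological_tendstoD)
  then obtain b where "b > 0" "\<And>c. \<lbrakk>0 < c; c < b\<rbrakk> \<Longrightarrow> c *\<^sub>R x \<in> W"
    by (auto simp: eventually_at_right_field)
  from this(1) this(2)[of "b/2"] show thesis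
    using that[of "b/2"] by auto
qed

text \<open>\<open>p\<close> is the gauge of \<open>W\<close>, the infimum of all
  \<open>t > 0\<close> with \<open>x\<close> in \<open>t W\<close>. Openness gives the strict
  inequality on \<open>W\<close>, since a point of \<open>W\<close> stays in \<open>W\<close> when
  stretched slightly; convexity and \<open>0 \<in> W\<close> give the converse.\<close>

lemma minkowski_functional:
  fixes W :: "'a::locally_convex_space set"
  assumes W: "open W" "convex W" "0 \<in> W"
  obtains p where "sublinear_on UNIV p" "\<And>x. x \<in> W \<Longrightarrow> p x < 1" "\<And>x. p x < 1 \<Longrightarrow> x \<in> W"
proof -
  define G where "G = (\<lambda>x. {t. 0 < t \<and> x \<in> (\<lambda>w. t *\<^sub>R w) ` W})"
  define p where "p = (\<lambda>x. Inf (G x))"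
  have ne: "G x \<noteq> {}" for x
  proof -
    obtain s where s: "0 < s" "s *\<^sub>R x \<in> W"
      using open_absorbing[OF W(1,3)] .
    then have "inverse s \<in> G x"
      by (auto simp: G_def intro!: image_eqI[of _ _ "s *\<^sub>R x"])
    then show ?thesis by auto
  qed
  have bdd: "bdd_below (G x)" for x
    by (rule bdd_belowI[of _ 0]) (auto simp: G_def)
  have le: "p x \<le> t" if "t \<in> G x" for x t
    unfolding p_def using bdd that by (intro cInf_lower)
  have near: "\<exists>t\<in>G x. t < r" if "p x < r" for x r
    using that unfolding p_def by (simp add: cInf_less_iff[OF ne bdd])
  have comb: "u *\<^sub>R x + v *\<^sub>R y \<in> W" if "x \<in> W" "y \<in> W" "0 \<le> u" "0 \<le> v" "u + v = 1" for x y u v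
    using convexD[OF W(2)] that by blast
  have "p (x + y) \<le> p x + p y" for x y
  proof (rule field_le_epsilon)
    fix e :: real assume e: "0 < e"
    obtain s t where st: "s \<in> G x" "s < p x + e/2" "t \<in> G y" "t < p y + e/2"
      using near[of x "p x + e/2"] near[of y "p y + e/2"] e by auto
    then obtain a b where ab: "a \<in> W" "x = s *\<^sub>R a" "b \<in> W" "y = t *\<^sub>R b" "0 < s" "0 < t"
      by (auto simp: G_def)
    \<comment> \<open>The weights are those for which \<open>(s + t) ?w = x + y\<close>, so that
      \<open>s + t\<close> is admissible for \<open>x + y\<close>.\<close>
    let ?w = "(s / (s + t)) *\<^sub>R a + (t / (s + t)) *\<^sub>R b"
    have "?w \<in> W"
      by (rule comb) (use ab in \<open>auto simp: add_divide_distrib[symmetric]\<close>)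
    moreover have "x + y = (s + t) *\<^sub>R ?w"
      using ab by (simp add: scaleR_add_right)
    ultimately have "x + y \<in> (\<lambda>w. (s + t) *\<^sub>R w) ` W"
      by (rule image_eqI[rotated])
    then have "s + t \<in> G (x + y)"
      using ab(5,6) unfolding G_def by (intro CollectI conjI add_pos_pos)
    from le[OF this] show "p (x + y) \<le> p x + p y + e"
      using st(2,4) by linarith
  qed
  moreover have "p (c *\<^sub>R x) \<le> c * p x" if c: "0 \<le> c" for c x
  proof (cases "c = 0")
    case True
    have "p 0 \<le> e" if "0 < e" for e
      by (rule le) (use that W(3) in \<open>auto simp: G_def intro!: image_eqI[of _ _ 0]\<close>)
    then have "p 0 \<le> 0"
      by (rule field_le_epsilon) simp
    with True show ?thesis by simp
  next
    case False
    have "p (c *\<^sub>R x) / c \<le> t" if "t \<in> G x" for t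
    proof -
      have "c * t \<in> G (c *\<^sub>R x)"
        using that False c by (auto simp: G_def)
      then show ?thesis
        using le[of "c * t"] False c by (simp add: field_simps)
    qed
    then have "p (c *\<^sub>R x) / c \<le> p x"
      by (subst (2) p_def, intro cInf_greatest ne)
    then show ?thesis using False c by (simp add: field_simps)
  qed
  ultimately have "sublinear_on UNIV p"
    by (auto simp: sublinear_on_def)
  moreover have "p x < 1" if x: "x \<in> W" for x
  proof -
    have "((\<lambda>c. c *\<^sub>R x) \<longlongrightarrow> x) (at 1)"
      using isCont_scaleR_left_locally_convex[where x=x and c=1] by (simp add: isCont_def)
    then have "eventually (\<lambda>c. c *\<^sub>R x \<in> W) (at_right 1)"
      using x W by (auto simp: eventually_at_split dest: topological_tendstoD)
    then obtain b where b: "b > 1" "\<And>c. \<lbrakk>1 < c; c < b\<rbrakk> \<Longrightarrow> c *\<^sub>R x \<in> W"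
      by (auto simp: eventually_at_right_field)
    define c where "c = (1 + b) / 2"
    have c: "1 < c" "c *\<^sub>R x \<in> W"
      using b b(2)[of c] by (auto simp: c_def)
    then have "inverse c \<in> G x"
      by (auto simp: G_def intro!: image_eqI[of _ _ "c *\<^sub>R x"])
    moreover have "inverse c < 1"
      using c(1) by (simp add: inverse_less_1_iff)
    ultimately show ?thesis
      using le[of "inverse c" x] by linarith
  qed
  moreover have "x \<in> W" if px: "p x < 1" for x
  proof -
    obtain t where t: "t \<in> G x" "t < 1"
      using near[OF px] by auto
    then obtain w where "w \<in> W" "x = t *\<^sub>R w" "0 < t" by (auto simp: G_def)
    then show ?thesis
      using comb[of w 0 t "1 - t"] W(3) t by simp
  qed
  ultimately show thesis
    using that by blast
qed

text \<open>A one-sided bound suffices: restricting \<open>y - x\<close> to both \<open>e W\<close>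
  and \<open>- e W\<close> controls both signs of \<open>f y - f x\<close>.\<close>

lemma isCont_linear_bounded_above:
  fixes f :: "'a::locally_convex_space \<Rightarrow> real"
  assumes f: "linear_on UNIV f" and W: "open W" "0 \<in> W" "\<And>x. x \<in> W \<Longrightarrow> f x < 1"
  shows "isCont f x"
proof -
  note fD = linear_onD[OF f subspace_UNIV]
  have "(f \<longlongrightarrow> f x) (nhds x)"
    unfolding tendsto_iff
  proof (intro allI impI)
    fix e :: real assume e: "0 < e"
    define U where "U = (\<lambda>y. inverse e *\<^sub>R (y - x)) -` W \<inter> (\<lambda>y. (- inverse e) *\<^sub>R (y - x)) -` W"
    have "open U"
      unfolding U_def by (intro open_Int open_vimage W continuous_intros)
    moreover have "x \<in> U"
      using W by (simp add: U_def)
    moreover have "dist (f y) (f x) < e" if "y \<in> U" for y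
    proof -
      have "f (inverse e *\<^sub>R (y - x)) < 1" "f ((- inverse e) *\<^sub>R (y - x)) < 1"
        using that W(3) by (auto simp: U_def)
      then have "inverse e * (f y - f x) < 1" "- inverse e * (f y - f x) < 1"
        by (simp_all only: fD(2) fD(5) UNIV_I real_scaleR_def)
      then have "f y - f x < e" "- (f y - f x) < e"
        using e by (simp_all add: field_simps)
      then show ?thesis by (simp add: dist_real_def)
    qed
    ultimately show "\<forall>\<^sub>F y in nhds x. dist (f y) (f x) < e"
      unfolding eventually_nhds by blast
  qed
  then show ?thesis
    by (simp add: isCont_def tendsto_at_iff_tendsto_nhds)
qed

text \<open>The gauge of an open convex set around \<open>C - c\<close> is at least 1 at
  \<open>y - c\<close>. The linear functional supporting it there takes a value at least 1 at
  \<open>y - c\<close> and values below 1 on \<open>C - c\<close>.\<close>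

lemma separation_compact_convex:
  fixes C :: "'a::locally_convex_space set"
  assumes C: "compact C" "convex C" and y: "y \<notin> C"
  obtains f :: "'a \<Rightarrow> real" where "linear_on UNIV f" "continuous_on UNIV f" "\<And>z. z \<in> C \<Longrightarrow> f z < f y"
proof (cases "C = {}")
  case True
  show thesis
    by (rule that[of "\<lambda>_. 0"]) (use True in \<open>auto simp: linear_on_def\<close>)
next
  case False
  then obtain c where c: "c \<in> C" by auto
  have "open ((\<lambda>u. y - u) -` (- C))"
    using C by (intro open_vimage continuous_intros) (simp add: compact_imp_closed)
  then obtain V where V: "open V" "convex V" "0 \<in> V" "V \<subseteq> (\<lambda>u. y - u) -` (- C)"
    by (rule open_convex_nhd_0) (use y in auto)
  \<comment> \<open>\<open>V\<close> was chosen with \<open>y - V\<close> disjoint from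
    \<open>C\<close>, hence \<open>W = (C - c) + V\<close> misses \<open>y - c\<close>. The shift by
    a point \<open>c\<close> of \<open>C\<close> brings 0 into \<open>W\<close>, as the gauge
    requires.\<close>
  define W where "W = (\<Union>z\<in>C. \<Union>v\<in>V. {(z - c) + v})"
  have W_eq: "W = (\<Union>z\<in>C. (\<lambda>v. (z - c) + v) ` V)"
    by (auto simp: W_def)
  have W_open: "open W"
    unfolding W_eq by (intro open_UN ballI open_translation_locally_convex V)
  have W_convex: "convex W"
  proof -
    have "W = (\<Union>z\<in>(\<lambda>z. z - c) ` C. \<Union>v\<in>V. {z + v})"
      by (auto simp: W_def)
    moreover have "convex ((\<lambda>z. z - c) ` C)"
      using C(2) convex_translation_subtract_eq by blast
    ultimately show ?thesis
      using convex_sums[of "(\<lambda>z. z - c) ` C" V] V by simp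
  qed
  have CW: "z - c \<in> W" if "z \<in> C" for z
    unfolding W_def using that V(3) by (intro UN_I[of z] UN_I[of 0]) simp_all
  have W0: "0 \<in> W"
    using CW[OF c] by simp
  have yW: "y - c \<notin> W"
  proof
    assume "y - c \<in> W"
    then obtain z v where zv: "z \<in> C" "v \<in> V" "y - c = (z - c) + v" by (auto simp: W_def)
    then have "z = y - v" by (simp add: algebra_simps)
    then show False using V(4) zv by auto
  qed
  obtain p where p: "sublinear_on UNIV p" "\<And>x. x \<in> W \<Longrightarrow> p x < 1"
    "\<And>x. p x < 1 \<Longrightarrow> x \<in> W"
    using minkowski_functional[OF W_open W_convex W0] by blast
  obtain f where f: "linear_on UNIV f" "\<And>x. f x \<le> p x" "f (y - c) = p (y - c)"
    using hahn_banach_support[OF subspace_UNIV p(1), of "y - c"] by auto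
  note fD = linear_onD[OF f(1) subspace_UNIV]
  have lt1: "f x < 1" if "x \<in> W" for x
    using f(2)[of x] p(2)[OF that] by simp
  show thesis
  proof (rule that[OF f(1)])
    show "continuous_on UNIV f"
      using isCont_linear_bounded_above[OF f(1) W_open W0 lt1]
      by (simp add: continuous_on_eq_continuous_at)
    show "f z < f y" if "z \<in> C" for z
      using lt1[OF CW[OF that]] f(3) p(3)[of "y - c"] yW fD(5) by fastforce
  qed
qed

section \<open>Positive functionals on bounded measurable functions\<close>

definition bounded_measurable :: "'a measure \<Rightarrow> ('a \<Rightarrow> real) set"
  where "bounded_measurable M = {f \<in> borel_measurable M. \<exists>B. \<forall>x\<in>space M. \<bar>f x\<bar> \<le> B}"

definition positive_functional :: "'a measure \<Rightarrow> (('a \<Rightarrow> real) \<Rightarrow> real) \<Rightarrow> bool"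
  where "positive_functional M \<phi> \<longleftrightarrow> linear_on (bounded_measurable M) \<phi> \<and>
    (\<forall>f\<in>bounded_measurable M. (\<forall>x\<in>space M. 0 \<le> f x) \<longrightarrow> 0 \<le> \<phi> f)"

lemma bounded_measurableI:
  assumes "f \<in> borel_measurable M" "\<And>x. x \<in> space M \<Longrightarrow> \<bar>f x\<bar> \<le> B"
  shows "f \<in> bounded_measurable M"
  using assms by (auto simp: bounded_measurable_def)

lemma subspace_bounded_measurable: "subspace (bounded_measurable M)"
  unfolding subspace_def
proof (intro conjI ballI allI)
  show "0 \<in> bounded_measurable M"
    by (rule bounded_measurableI[where B=0]) (simp_all add: func_zero)
next
  fix f g assume "f \<in> bounded_measurable M" "g \<in> bounded_measurable M"
  then obtain B C where fg: "f \<in> borel_measurable M" "g \<in> borel_measurable M"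
    "\<And>x. x \<in> space M \<Longrightarrow> \<bar>f x\<bar> \<le> B" "\<And>x. x \<in> space M \<Longrightarrow> \<bar>g x\<bar> \<le> C"
    by (auto simp: bounded_measurable_def)
  have "\<bar>f x + g x\<bar> \<le> B + C" if "x \<in> space M" for x
    using fg(3)[OF that] fg(4)[OF that] by simp
  then show "f + g \<in> bounded_measurable M"
    using fg(1,2) by (intro bounded_measurableI[where B="B + C"]) (simp_all add: func_plus)
next
  fix c :: real and f assume "f \<in> bounded_measurable M"
  then obtain B where f: "f \<in> borel_measurable M" "\<And>x. x \<in> space M \<Longrightarrow> \<bar>f x\<bar> \<le> B"
    by (auto simp: bounded_measurable_def)
  have "\<bar>c * f x\<bar> \<le> \<bar>c\<bar> * B" if "x \<in> space M" for x
    using f(2)[OF that] by (simp add: abs_mult mult_left_mono)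
  then show "c *\<^sub>R f \<in> bounded_measurable M"
    using f(1) by (intro bounded_measurableI[where B="\<bar>c\<bar> * B"]) (simp_all add: scaleR_fun_def)
qed

lemma indicator_bounded_measurable:
  "A \<in> sets M \<Longrightarrow> indicat_real A \<in> bounded_measurable M"
  by (rule bounded_measurableI[where B=1]) (auto simp: indicator_def)

lemma positive_functional_mono:
  assumes \<phi>: "positive_functional M \<phi>" and "f \<in> bounded_measurable M" "g \<in> bounded_measurable M"
    and "\<And>x. x \<in> space M \<Longrightarrow> f x \<le> g x"
  shows "\<phi> f \<le> \<phi> g"
proof -
  have "0 \<le> \<phi> (g - f)"
    using assms subspace_diff[OF subspace_bounded_measurable assms(3,2)] by (simp add: positive_functional_def)
  also have "\<phi> (g - f) = \<phi> g - \<phi> f"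
    using \<phi> linear_on_diff[OF _ subspace_bounded_measurable assms(3,2), of \<phi>]
    by (simp add: positive_functional_def)
  finally show ?thesis by simp
qed

lemma linear_on_sum:
  assumes "linear_on S f" "subspace S" "\<And>i. i \<in> I \<Longrightarrow> g i \<in> S"
  shows "f (\<Sum>i\<in>I. g i) = (\<Sum>i\<in>I. f (g i))"
proof -
  have "(\<Sum>i\<in>I. g i) \<in> S \<and> f (\<Sum>i\<in>I. g i) = (\<Sum>i\<in>I. f (g i))"
    using assms(3)
  proof (induction I rule: infinite_finite_induct)
    case (insert i I)
    then show ?case
      using linear_on_add[OF assms(1,2)] by (simp add: subspace_add[OF assms(2)])
  qed (use assms in \<open>auto simp: linear_on_zero subspace_0\<close>)
  then show ?thesis by simp
qed

text \<open>Rounding \<open>r f\<close> down to integers gives a finite step function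
  \<open>h\<close> with \<open>h \<le> f \<le> h + 1/r\<close> on the space. Both functionals agree
  on \<open>h\<close> and on constants, so by monotonicity \<open>\<phi> f\<close> and
  \<open>\<psi> f\<close> lie in one interval of length \<open>c / r\<close>.\<close>

lemma positive_functional_eqI:
  assumes \<phi>: "positive_functional M \<phi>" and \<psi>: "positive_functional M \<psi>"
    and eq: "\<And>A. A \<in> sets M \<Longrightarrow> \<phi> (indicat_real A) = \<psi> (indicat_real A)"
    and f: "f \<in> bounded_measurable M"
  shows "\<phi> f = \<psi> f"
proof -
  let ?S = "bounded_measurable M"
  note S = subspace_bounded_measurable[of M]
  have lin: "linear_on ?S \<phi>" "linear_on ?S \<psi>"
    using \<phi> \<psi> by (auto simp: positive_functional_def)
  obtain B where fm: "f \<in> borel_measurable M" and B: "\<And>x. x \<in> space M \<Longrightarrow> \<bar>f x\<bar> \<le> B"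
    using f by (auto simp: bounded_measurable_def)
  define c where "c = \<phi> (indicat_real (space M))"
  have approx: "\<bar>\<phi> f - \<psi> f\<bar> \<le> c * inverse (real (Suc n))" for n
  proof -
    define r where "r = real (Suc n)"
    have r: "0 < r" by (simp add: r_def)
    define A where "A = (\<lambda>k. {x \<in> space M. \<lfloor>r * f x\<rfloor> = k})"
    define I where "I = {- \<lceil>r * B\<rceil> - 1 .. \<lceil>r * B\<rceil> + 1}"
    define h where "h = (\<Sum>k\<in>I. (real_of_int k / r) *\<^sub>R indicat_real (A k))"
    have A: "A k \<in> sets M" for k
      using fm unfolding A_def by measurable
    have h_in: "h \<in> ?S"
      unfolding h_def by (intro subspace_sum S subspace_scale indicator_bounded_measurable A)
    have h_app: "h x = (\<Sum>k\<in>I. (real_of_int k / r) * indicat_real (A k) x)" for x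
      unfolding h_def by (induction I rule: infinite_finite_induct) auto
    have h_eq: "h x = \<lfloor>r * f x\<rfloor> / r" if x: "x \<in> space M" for x
    proof -
      have "r * f x \<le> r * B" "- (r * B) \<le> r * f x"
        using mult_left_mono[of "f x" B r] mult_left_mono[of "- B" "f x" r] B[OF x] r
        by (simp_all add: abs_le_iff)
      then have "\<lfloor>r * f x\<rfloor> \<in> I"
        unfolding I_def by (simp, linarith)
      moreover have "h x = (\<Sum>k\<in>I. if k = \<lfloor>r * f x\<rfloor> then real_of_int k / r else 0)"
        unfolding h_app using x by (intro sum.cong) (auto simp: A_def indicator_def)
      ultimately show ?thesis
        by (simp add: I_def)
    qed
    let ?g = "h + inverse r *\<^sub>R indicat_real (space M)"
    have g_in: "?g \<in> ?S"
      by (intro subspace_add subspace_scale S h_in indicator_bounded_measurable) simp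
    have le: "h x \<le> f x" "f x \<le> ?g x" if "x \<in> space M" for x
    proof -
      have "\<lfloor>r * f x\<rfloor> \<le> r * f x" "r * f x \<le> \<lfloor>r * f x\<rfloor> + 1"
        by linarith+
      then show "h x \<le> f x" "f x \<le> ?g x"
        using that r by (auto simp: h_eq field_simps)
    qed
    have "\<phi> h = \<psi> h"
      unfolding h_def
      using linear_on_sum[OF lin(1) S, of I "\<lambda>k. (real_of_int k / r) *\<^sub>R indicat_real (A k)"]
        linear_on_sum[OF lin(2) S, of I "\<lambda>k. (real_of_int k / r) *\<^sub>R indicat_real (A k)"]
      by (simp add: linear_on_scale[OF lin(1) S] linear_on_scale[OF lin(2) S] A eq
          indicator_bounded_measurable subspace_scale[OF S])
    moreover have "\<phi> ?g = \<phi> h + inverse r * c" "\<psi> ?g = \<psi> h + inverse r * c"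
      using linear_on_add[OF lin(1) S] linear_on_add[OF lin(2) S] h_in
      by (simp_all add: linear_on_scale[OF lin(1) S] linear_on_scale[OF lin(2) S] c_def eq
          indicator_bounded_measurable subspace_scale[OF S])
    moreover have "\<phi> h \<le> \<phi> f" "\<phi> f \<le> \<phi> ?g" "\<psi> h \<le> \<psi> f" "\<psi> f \<le> \<psi> ?g"
      by (intro positive_functional_mono[OF \<phi>] positive_functional_mono[OF \<psi>] f h_in g_in le; assumption)+
    ultimately show ?thesis
      unfolding r_def by (simp add: mult.commute)
  qed
  have "(\<lambda>n. c * inverse (real (Suc n))) \<longlonglongrightarrow> c * 0"
    by (intro tendsto_intros LIMSEQ_inverse_real_of_nat)
  then have "\<bar>\<phi> f - \<psi> f\<bar> \<le> c * 0"
    by (rule LIMSEQ_le_const) (use approx in auto)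
  then show ?thesis by simp
qed

lemma (in finite_measure) integrable_bounded_measurable:
  "f \<in> bounded_measurable M \<Longrightarrow> integrable M f"
  by (auto simp: bounded_measurable_def intro!: integrable_const_bound AE_I2)

lemma bounded_measurable_cong_sets:
  assumes "sets M = sets N"
  shows "bounded_measurable M = bounded_measurable N"
  using sets_eq_imp_space_eq[OF assms]
  by (simp add: bounded_measurable_def measurable_cong_sets[OF assms refl])

lemma positive_functional_integral:
  assumes "finite_measure N" "sets N = sets M"
  shows "positive_functional M (\<lambda>f. \<integral>x. f x \<partial>N)"
proof -
  interpret finite_measure N by fact
  show ?thesis
    unfolding positive_functional_def linear_on_def bounded_measurable_cong_sets[OF assms(2), symmetric]
      sets_eq_imp_space_eq[OF assms(2), symmetric]
    using integrable_bounded_measurable by (auto simp: func_plus scaleR_fun_def intro!: integral_nonneg_AE AE_I2)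
qed

text \<open>The measure of \<open>A\<close> is \<open>\<phi> (indicat_real A)\<close>. Continuity
  along sequences decreasing to the empty set upgrades finite to countable additivity, and
  \<open>positive_functional_eqI\<close> extends the identity from indicators to all bounded
  measurable functions.\<close>

lemma positive_functional_representation:
  assumes \<phi>: "positive_functional M \<phi>"
    and cont: "\<And>A. \<lbrakk>range A \<subseteq> sets M; decseq A; (\<Inter>i. A i) = {}\<rbrakk>
      \<Longrightarrow> (\<lambda>i. \<phi> (indicat_real (A i))) \<longlonglongrightarrow> 0"
  obtains N where "finite_measure N" "sets N = sets M"
    "\<And>f. f \<in> bounded_measurable M \<Longrightarrow> (\<integral>x. f x \<partial>N) = \<phi> f"
proof -
  note S = subspace_bounded_measurable[of M]
  have lin: "linear_on (bounded_measurable M) \<phi>"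
    using \<phi> by (simp add: positive_functional_def)
  have nonneg: "0 \<le> \<phi> (indicat_real A)" if "A \<in> sets M" for A
    using \<phi> indicator_bounded_measurable[OF that] by (simp add: positive_functional_def)
  have empty: "\<phi> (indicat_real {}) = 0"
    using linear_on_zero[OF lin S] by (simp add: func_zero indicator_def[abs_def])
  let ?m = "\<lambda>A. ennreal (\<phi> (indicat_real A))"
  have pos: "positive (sets M) ?m"
    by (simp add: positive_def empty)
  have add: "additive (sets M) ?m"
    unfolding additive_def
  proof (intro ballI impI)
    fix A B assume AB: "A \<in> sets M" "B \<in> sets M" "A \<inter> B = {}"
    then have "indicat_real (A \<union> B) = indicat_real A + indicat_real B"
      by (auto simp: fun_eq_iff indicator_def)
    then show "?m (A \<union> B) = ?m A + ?m B"
      using AB linear_on_add[OF lin S] nonneg by (simp add: indicator_bounded_measurable ennreal_plus)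
  qed
  have ca: "countably_additive (sets M) ?m"
  proof (rule sets.empty_continuous_imp_countably_additive[OF pos add])
    fix A :: "nat \<Rightarrow> 'a set" assume "range A \<subseteq> sets M" "decseq A" "(\<Inter>i. A i) = {}"
    from cont[OF this] show "(\<lambda>i. ?m (A i)) \<longlonglongrightarrow> 0"
      using tendsto_ennrealI by fastforce
  qed simp
  define N where "N = measure_of (space M) (sets M) ?m"
  have sets_N: "sets N = sets M"
    by (simp add: N_def sets.sets_measure_of_eq)
  have em: "emeasure N A = ?m A" if "A \<in> sets M" for A
    unfolding N_def by (rule emeasure_measure_of_sigma[OF sets.sigma_algebra_axioms pos ca that])
  have fin: "finite_measure N"
  proof
    show "emeasure N (space N) \<noteq> \<infinity>"
      using sets_eq_imp_space_eq[OF sets_N] by (simp add: em)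
  qed
  have "(\<integral>x. f x \<partial>N) = \<phi> f" if "f \<in> bounded_measurable M" for f
  proof (rule positive_functional_eqI[OF positive_functional_integral[OF fin sets_N] \<phi> _ that])
    fix A assume A: "A \<in> sets M"
    then show "(\<integral>x. indicat_real A x \<partial>N) = \<phi> (indicat_real A)"
      using nonneg[OF A] sets_N em[OF A] by (simp add: measure_def Int_absorb2 sets.sets_into_space)
  qed
  with fin sets_N show thesis
    using that by blast
qed

lemma measure_eqI_integral:
  assumes fin: "finite_measure M" "finite_measure N" and sets: "sets M = sets N"
    and eq: "\<And>f. f \<in> bounded_measurable M \<Longrightarrow> (\<integral>x. f x \<partial>M) = (\<integral>x. f x \<partial>N)"
  shows "M = N"
proof (rule measure_eqI[OF sets])
  fix A assume A: "A \<in> sets M"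
  then have "measure M A = measure N A"
    using eq[OF indicator_bounded_measurable[OF A]] sets sets_eq_imp_space_eq[OF sets]
    by (simp add: Int_absorb2 sets.sets_into_space)
  then show "emeasure M A = emeasure N A"
    using fin by (simp add: finite_measure.emeasure_eq_measure)
qed

text \<open>Domination by a finite measure forces the values on indicators of sets decreasing to the
  empty set to tend to 0, which is the continuity that
  \<open>positive_functional_representation\<close> asks for.\<close>

lemma dominated_functional_representation:
  assumes N: "finite_measure N"
    and \<phi>: "positive_functional N \<phi>"
    and le: "\<And>A. A \<in> sets N \<Longrightarrow> \<phi> (indicat_real A) \<le> c * measure N A"
  obtains M where "finite_measure M" "sets M = sets N"
    "\<And>f. f \<in> bounded_measurable N \<Longrightarrow> (\<integral>x. f x \<partial>M) = \<phi> f"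
proof (rule positive_functional_representation[OF \<phi>])
  fix A :: "nat \<Rightarrow> _" assume A: "range A \<subseteq> sets N" "decseq A" "(\<Inter>i. A i) = {}"
  have "(\<lambda>i. measure N (A i)) \<longlonglongrightarrow> measure N (\<Inter>i. A i)"
    using finite_measure.finite_Lim_measure_decseq[OF N A(1,2)] .
  then have "(\<lambda>i. c * measure N (A i)) \<longlonglongrightarrow> c * 0"
    using A(3) by (intro tendsto_intros) simp
  then have lim: "(\<lambda>i. c * measure N (A i)) \<longlonglongrightarrow> 0" by simp
  show "(\<lambda>i. \<phi> (indicat_real (A i))) \<longlonglongrightarrow> 0"
  proof (rule tendsto_sandwich[OF _ _ tendsto_const lim])
    show "\<forall>\<^sub>F i in sequentially. 0 \<le> \<phi> (indicat_real (A i))"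
      using \<phi> A(1) by (auto simp: positive_functional_def indicator_bounded_measurable)
    show "\<forall>\<^sub>F i in sequentially. \<phi> (indicat_real (A i)) \<le> c * measure N (A i)"
      using le A(1) by auto
  qed
qed (use that in blast)

text \<open>The mixture is represented as a functional, so that the formulas for integrals and for
  sets come from one construction.\<close>

lemma convex_combination_measure:
  assumes M: "prob_space M" and N: "prob_space N" and sets: "sets M = sets N" and t: "0 \<le> t" "t \<le> 1"
  obtains P where "prob_space P" "sets P = sets N"
    "\<And>f. f \<in> bounded_measurable N \<Longrightarrow> (\<integral>x. f x \<partial>P) = (1 - t) * (\<integral>x. f x \<partial>M) + t * (\<integral>x. f x \<partial>N)"
    "\<And>A. A \<in> sets N \<Longrightarrow> measure P A = (1 - t) * measure M A + t * measure N A"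
proof -
  interpret M: prob_space M by fact
  interpret N: prob_space N by fact
  let ?\<phi> = "\<lambda>f. (1 - t) * (\<integral>x. f x \<partial>M) + t * (\<integral>x. f x \<partial>N)"
  have pos: "positive_functional N ?\<phi>"
    using positive_functional_integral[OF M.finite_measure_axioms sets]
      positive_functional_integral[OF N.finite_measure_axioms refl] t
    by (auto simp: positive_functional_def linear_on_def distrib_left mult.left_commute)
  have ind: "?\<phi> (indicat_real A) = (1 - t) * measure M A + t * measure N A" if "A \<in> sets N" for A
    using that sets sets_eq_imp_space_eq[OF sets] by (simp add: Int_absorb2 sets.sets_into_space)
  obtain P where P: "finite_measure P" "sets P = sets N"
    "\<And>f. f \<in> bounded_measurable N \<Longrightarrow> (\<integral>x. f x \<partial>P) = ?\<phi> f"
  proof (rule positive_functional_representation[OF pos])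
    fix A :: "nat \<Rightarrow> _" assume A: "range A \<subseteq> sets N" "decseq A" "(\<Inter>i. A i) = {}"
    have "(\<lambda>i. (1 - t) * measure M (A i) + t * measure N (A i))
        \<longlonglongrightarrow> (1 - t) * measure M (\<Inter>i. A i) + t * measure N (\<Inter>i. A i)"
      using A sets by (intro tendsto_intros M.finite_Lim_measure_decseq N.finite_Lim_measure_decseq) auto
    moreover have "?\<phi> (indicat_real (A i)) = (1 - t) * measure M (A i) + t * measure N (A i)" for i
      using A(1) by (intro ind) auto
    ultimately show "(\<lambda>i. ?\<phi> (indicat_real (A i))) \<longlonglongrightarrow> 0"
      using A(3) by simp
  qed blast
  have meas: "measure P A = (1 - t) * measure M A + t * measure N A" if A: "A \<in> sets N" for A
    using P(3)[OF indicator_bounded_measurable[OF A]] ind[OF A] P(2) A sets_eq_imp_space_eq[OF P(2)]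
    by (simp add: Int_absorb2 sets.sets_into_space)
  have "measure P (space P) = 1"
    using meas[of "space N"] sets_eq_imp_space_eq[OF P(2)] sets_eq_imp_space_eq[OF sets]
      M.prob_space N.prob_space by simp
  then have "prob_space P"
    using finite_measure.emeasure_eq_measure[OF P(1)] by (intro prob_spaceI) simp
  then show thesis
    using that P meas by blast
qed

section \<open>Radon probability measures and barycenters\<close>

lemma radon_probabilitiesD:
  assumes "\<mu> \<in> radon_probabilities X"
  shows "prob_space \<mu>" "sets \<mu> = sets (restrict_space borel X)" "space \<mu> = X"
    "bounded_measurable \<mu> = bounded_measurable (restrict_space borel X)"
proof -
  show *: "prob_space \<mu>" "sets \<mu> = sets (restrict_space borel X)"
    using assms by (auto simp: radon_probabilities_def)
  show "space \<mu> = X"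
    using sets_eq_imp_space_eq[OF *(2)] by (simp add: space_restrict_space)
  show "bounded_measurable \<mu> = bounded_measurable (restrict_space borel X)"
    by (rule bounded_measurable_cong_sets[OF *(2)])
qed

lemma compact_in_sets_restrict_borel:
  fixes X :: "'a::t2_space set"
  assumes "compact K" "K \<subseteq> X"
  shows "K \<in> sets (restrict_space borel X)"
  using assms by (auto simp: sets_restrict_space image_iff intro!: bexI[of _ K] borel_closed compact_imp_closed)

lemma radon_inner_regular:
  fixes X :: "'a::t2_space set"
  assumes \<mu>: "\<mu> \<in> radon_probabilities X" and B: "B \<in> sets \<mu>" and e: "0 < e"
  obtains K where "K \<subseteq> B" "compact K" "measure \<mu> B < measure \<mu> K + e"
proof -
  interpret prob_space \<mu> using radon_probabilitiesD(1)[OF \<mu>] .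
  show thesis
  \<comment> \<open>\<open>ennreal\<close> truncates negative numbers to 0, so the comparison with
    \<open>measure \<mu> B - e\<close> is made only when this is nonnegative; otherwise the empty
    compact set suffices.\<close>
  proof (cases "measure \<mu> B < e")
    case True
    then show ?thesis using that[of "{}"] by simp
  next
    case False
    have "ennreal (measure \<mu> B - e) < emeasure \<mu> B"
      using e False by (auto simp: emeasure_eq_measure intro!: ennreal_lessI)
    also have "emeasure \<mu> B = (SUP K\<in>{K. K \<subseteq> B \<and> compact K}. emeasure \<mu> K)"
      using \<mu> B by (auto simp: radon_probabilities_def)
    finally obtain K where K: "K \<subseteq> B" "compact K" "ennreal (measure \<mu> B - e) < emeasure \<mu> K"
      by (auto simp: less_SUP_iff)
    then show ?thesis
      using False by (intro that[of K]) (auto simp: emeasure_eq_measure ennreal_less_iff)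
  qed
qed

lemma radon_probabilitiesI:
  fixes X :: "'a::t2_space set"
  assumes \<mu>: "prob_space \<mu>" "sets \<mu> = sets (restrict_space borel X)"
    and reg: "\<And>B e. \<lbrakk>B \<in> sets \<mu>; 0 < e\<rbrakk> \<Longrightarrow> \<exists>K\<subseteq>B. compact K \<and> measure \<mu> B < measure \<mu> K + e"
  shows "\<mu> \<in> radon_probabilities X"
proof -
  interpret prob_space \<mu> by fact
  have "emeasure \<mu> B = (SUP K\<in>{K. K \<subseteq> B \<and> compact K}. emeasure \<mu> K)" if B: "B \<in> sets \<mu>" for B
  proof (rule antisym)
    show "(SUP K\<in>{K. K \<subseteq> B \<and> compact K}. emeasure \<mu> K) \<le> emeasure \<mu> B"
      using B by (auto intro!: SUP_least emeasure_mono)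
    show "emeasure \<mu> B \<le> (SUP K\<in>{K. K \<subseteq> B \<and> compact K}. emeasure \<mu> K)"
    proof (rule ennreal_le_epsilon)
      fix e :: real assume "0 < e"
      then obtain K where K: "K \<subseteq> B" "compact K" "measure \<mu> B < measure \<mu> K + e"
        using reg[OF B] by blast
      then have "emeasure \<mu> B \<le> emeasure \<mu> K + ennreal e"
        using \<open>0 < e\<close> by (simp add: emeasure_eq_measure flip: ennreal_plus)
      also have "\<dots> \<le> (SUP K\<in>{K. K \<subseteq> B \<and> compact K}. emeasure \<mu> K) + ennreal e"
        using K by (intro add_right_mono SUP_upper) auto
      finally show "emeasure \<mu> B \<le> (SUP K\<in>{K. K \<subseteq> B \<and> compact K}. emeasure \<mu> K) + ennreal e" .
    qed
  qed
  with \<mu> show ?thesis by (auto simp: radon_probabilities_def)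
qed

text \<open>Inner regularity passes through domination: a compact subset of \<open>B\<close> that
  misses less than \<open>e / c\<close> of the mass of \<open>\<nu>\<close> misses less than
  \<open>e\<close> of the mass of \<open>\<mu>\<close>.\<close>

lemma radon_dominated:
  fixes X :: "'a::t2_space set"
  assumes \<nu>: "\<nu> \<in> radon_probabilities X" and \<mu>: "prob_space \<mu>" "sets \<mu> = sets \<nu>" and c: "0 < c"
    and le: "\<And>B. B \<in> sets \<nu> \<Longrightarrow> measure \<mu> B \<le> c * measure \<nu> B"
  shows "\<mu> \<in> radon_probabilities X"
proof (rule radon_probabilitiesI)
  interpret \<nu>: prob_space \<nu> using radon_probabilitiesD(1)[OF \<nu>] .
  interpret \<mu>: prob_space \<mu> by fact
  fix B and e :: real assume B: "B \<in> sets \<mu>" and e: "0 < e"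
  obtain K where K: "K \<subseteq> B" "compact K" "measure \<nu> B < measure \<nu> K + e / c"
    by (rule radon_inner_regular[OF \<nu>, of B "e / c"]) (use B e c \<mu> in auto)
  have "B \<subseteq> X"
    using sets.sets_into_space[OF B] sets_eq_imp_space_eq[OF \<mu>(2)] radon_probabilitiesD(3)[OF \<nu>] by simp
  then have KM: "K \<in> sets \<nu>"
    using compact_in_sets_restrict_borel[OF K(2), of X] K(1) radon_probabilitiesD(2)[OF \<nu>] by auto
  have "measure \<mu> B - measure \<mu> K = measure \<mu> (B - K)"
    using B K(1) KM \<mu>(2) by (simp add: \<mu>.finite_measure_Diff)
  also have "\<dots> \<le> c * measure \<nu> (B - K)"
    using B KM \<mu>(2) by (intro le) auto
  also have "measure \<nu> (B - K) = measure \<nu> B - measure \<nu> K"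
    using B K(1) KM \<mu>(2) by (simp add: \<nu>.finite_measure_Diff)
  also have "c * (measure \<nu> B - measure \<nu> K) < e"
    using K(3) c by (simp add: field_simps)
  finally show "\<exists>K\<subseteq>B. compact K \<and> measure \<mu> B < measure \<mu> K + e"
    using K by (intro exI[of _ K]) auto
qed (use \<mu> radon_probabilitiesD[OF \<nu>] in auto)

lemma radon_convex_combination:
  fixes X :: "'a::t2_space set"
  assumes \<mu>: "\<mu> \<in> radon_probabilities X" and \<nu>: "\<nu> \<in> radon_probabilities X" and t: "0 \<le> t" "t \<le> 1"
  obtains \<rho> where "\<rho> \<in> radon_probabilities X"
    "\<And>f. f \<in> bounded_measurable (restrict_space borel X)
      \<Longrightarrow> (\<integral>x. f x \<partial>\<rho>) = (1 - t) * (\<integral>x. f x \<partial>\<mu>) + t * (\<integral>x. f x \<partial>\<nu>)"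
    "\<And>A. A \<in> sets (restrict_space borel X)
      \<Longrightarrow> measure \<rho> A = (1 - t) * measure \<mu> A + t * measure \<nu> A"
proof -
  note \<mu>D = radon_probabilitiesD[OF \<mu>] and \<nu>D = radon_probabilitiesD[OF \<nu>]
  interpret \<mu>: prob_space \<mu> by fact
  interpret \<nu>: prob_space \<nu> by fact
  obtain \<rho> where \<rho>: "prob_space \<rho>" "sets \<rho> = sets (restrict_space borel X)"
    "\<And>f. f \<in> bounded_measurable (restrict_space borel X)
      \<Longrightarrow> (\<integral>x. f x \<partial>\<rho>) = (1 - t) * (\<integral>x. f x \<partial>\<mu>) + t * (\<integral>x. f x \<partial>\<nu>)"
    "\<And>A. A \<in> sets (restrict_space borel X)
      \<Longrightarrow> measure \<rho> A = (1 - t) * measure \<mu> A + t * measure \<nu> A"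
    by (rule convex_combination_measure[OF \<mu>D(1) \<nu>D(1) _ t]) (use \<mu>D \<nu>D in auto)
  interpret \<rho>: prob_space \<rho> by fact
  have "\<rho> \<in> radon_probabilities X"
  proof (rule radon_probabilitiesI[OF \<rho>(1,2)])
    fix B and e :: real assume B: "B \<in> sets \<rho>" and e: "0 < e"
    have B': "B \<in> sets \<mu>" "B \<in> sets \<nu>" "B \<in> sets (restrict_space borel X)"
      using B \<rho>(2) \<mu>D(2) \<nu>D(2) by auto
    obtain K where K: "K \<subseteq> B" "compact K" "measure \<mu> B < measure \<mu> K + e"
      by (rule radon_inner_regular[OF \<mu> B'(1) e])
    obtain L where L: "L \<subseteq> B" "compact L" "measure \<nu> B < measure \<nu> L + e"
      by (rule radon_inner_regular[OF \<nu> B'(2) e])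
    \<comment> \<open>The union approximates \<open>B\<close> for both measures at once, hence for
      the mixture.\<close>
    have KL: "K \<union> L \<subseteq> B" "compact (K \<union> L)"
      using K L by (auto intro: compact_Un)
    have "B \<subseteq> X"
      using sets.sets_into_space[OF B'(1)] \<mu>D(3) by simp
    then have KLs: "K \<union> L \<in> sets (restrict_space borel X)"
      using KL by (intro compact_in_sets_restrict_borel) auto
    have "measure \<mu> K \<le> measure \<mu> (K \<union> L)" "measure \<nu> L \<le> measure \<nu> (K \<union> L)"
      using KLs \<mu>D(2) \<nu>D(2) by (auto intro!: \<mu>.finite_measure_mono \<nu>.finite_measure_mono)
    then have 1: "measure \<mu> B - measure \<mu> (K \<union> L) - e < 0" "measure \<nu> B - measure \<nu> (K \<union> L) - e < 0"
      using K L by auto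
    have "(1 - t) * (measure \<mu> B - measure \<mu> (K \<union> L) - e) + t * (measure \<nu> B - measure \<nu> (K \<union> L) - e) < 0"
    \<comment> \<open>Strictness comes from the second summand, which vanishes for
      \<open>t = 0\<close>.\<close>
    proof (cases "t = 0")
      case False
      then show ?thesis
        using 1 t by (intro add_nonpos_neg mult_nonneg_nonpos mult_pos_neg) auto
    qed (use 1 in simp)
    then have "measure \<rho> B < measure \<rho> (K \<union> L) + e"
      by (simp add: \<rho>(4)[OF B'(3)] \<rho>(4)[OF KLs] algebra_simps)
    with KL show "\<exists>K\<subseteq>B. compact K \<and> measure \<rho> B < measure \<rho> K + e" by blast
  qed
  with \<rho> show thesis using that by blast
qed

lemma continuous_on_bounded_measurable:
  fixes X :: "'a::topological_space set"
  assumes "compact X" "continuous_on X f"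
  shows "f \<in> bounded_measurable (restrict_space borel X)"
proof -
  have "bounded (f ` X)"
    using assms by (intro compact_imp_bounded compact_continuous_image)
  then obtain B where "\<And>x. x \<in> X \<Longrightarrow> \<bar>f x\<bar> \<le> B"
    by (auto simp: bounded_iff)
  then show ?thesis
    using assms(2) by (intro bounded_measurableI[where B=B] borel_measurable_continuous_on_restrict)
      (auto simp: space_restrict_space)
qed

lemma affine_onD:
  assumes "affine_on X f" "x \<in> X" "y \<in> X" "0 \<le> s" "s \<le> 1"
  shows "f (s *\<^sub>R x + (1 - s) *\<^sub>R y) = s * f x + (1 - s) * f y"
  using assms(1)[unfolded affine_on_def, rule_format, OF assms(3,2), of s] assms(4,5)
  by (simp add: add.commute)

lemma linear_restriction_A_c:
  fixes f :: "'a::locally_convex_space \<Rightarrow> real"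
  assumes f: "linear_on UNIV f" "continuous_on UNIV f" and X: "convex X"
  shows "(\<lambda>x. if x \<in> X then f x else 0) \<in> A_c X"
proof -
  have "(1 - t) *\<^sub>R x + t *\<^sub>R y \<in> X" if "x \<in> X" "y \<in> X" "0 \<le> t" "t \<le> 1" for x y t
    using X that by (simp add: convex_alt)
  then have "affine_on X (\<lambda>x. if x \<in> X then f x else 0)"
    using f(1) by (simp add: affine_on_def linear_on_def)
  moreover have "continuous_on X (\<lambda>x. if x \<in> X then f x else 0)"
    using continuous_on_subset[OF f(2) subset_UNIV, of X] by (simp cong: continuous_on_cong)
  ultimately show ?thesis
    by (simp add: A_c_def functions_on_def)
qed

lemma barycenter_linear:
  fixes f :: "'a::locally_convex_space \<Rightarrow> real"
  assumes f: "linear_on UNIV f" "continuous_on UNIV f" and X: "convex X"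
    and \<mu>: "\<mu> \<in> radon_probabilities X" "barycenter X \<mu> x"
  shows "(\<integral>y. f y \<partial>\<mu>) = f x"
proof -
  let ?g = "\<lambda>x. if x \<in> X then f x else 0"
  have "(\<integral>y. f y \<partial>\<mu>) = (\<integral>y. ?g y \<partial>\<mu>)"
    by (rule Bochner_Integration.integral_cong) (simp_all add: radon_probabilitiesD(3)[OF \<mu>(1)])
  also have "\<dots> = ?g x"
    using linear_restriction_A_c[OF f X] \<mu>(2) unfolding barycenter_def by blast
  finally show ?thesis
    using \<mu>(2) by (simp add: barycenter_def)
qed

text \<open>
  Were the barycenter not in \<open>s C + (1 - s) X\<close>, a separating functional would have too large an
  integral. This replaces the existence of barycenters of the two conditional measures.
\<close>

lemma barycenter_decomposition:
  fixes X :: "'a::locally_convex_space set"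
  assumes X: "compact X" "convex X" and \<mu>: "\<mu> \<in> radon_probabilities X" "barycenter X \<mu> x"
    and C: "compact C" "convex C" "C \<subseteq> X" "C \<noteq> {}"
  obtains c d where "c \<in> C" "d \<in> X" "x = measure \<mu> C *\<^sub>R c + (1 - measure \<mu> C) *\<^sub>R d"
proof -
  interpret prob_space \<mu> using radon_probabilitiesD(1)[OF \<mu>(1)] .
  define s where "s = measure \<mu> C"
  have s: "0 \<le> s" "s \<le> 1" by (simp_all add: s_def)
  define D where "D = (\<lambda>p. s *\<^sub>R fst p + (1 - s) *\<^sub>R snd p) ` (C \<times> X)"
  have D_iff: "z \<in> D \<longleftrightarrow> (\<exists>c\<in>C. \<exists>d\<in>X. z = s *\<^sub>R c + (1 - s) *\<^sub>R d)" for z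
    by (force simp: D_def)
  have "compact D"
    unfolding D_def by (intro compact_continuous_image continuous_intros compact_Times C X)
  moreover have "convex D"
  proof -
    have "D = (\<Union>u\<in>(*\<^sub>R) s ` C. \<Union>v\<in>(*\<^sub>R) (1 - s) ` X. {u + v})"
      by (auto simp: D_iff; blast)
    then show ?thesis
      using convex_sums[OF convex_scaling[OF C(2), of s] convex_scaling[OF X(2), of "1 - s"]] by simp
  qed
  moreover have "x \<in> D"
  proof (rule ccontr)
    assume "x \<notin> D"
    then obtain f :: "'a \<Rightarrow> real" where f: "linear_on UNIV f" "continuous_on UNIV f"
      and less: "\<And>z. z \<in> D \<Longrightarrow> f z < f x"
      using separation_compact_convex[OF calculation] by blast
    have cont: "continuous_on X f" "continuous_on C f"
      using f(2) continuous_on_subset by blast+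
    have "X \<noteq> {}" using C by auto
    then obtain d where d: "d \<in> X" "\<And>y. y \<in> X \<Longrightarrow> f y \<le> f d"
      using continuous_attains_sup[OF X(1) _ cont(1)] by blast
    obtain c where c: "c \<in> C" "\<And>y. y \<in> C \<Longrightarrow> f y \<le> f c"
      using continuous_attains_sup[OF C(1,4) cont(2)] by blast
    have Cs: "C \<in> sets \<mu>"
      using compact_in_sets_restrict_borel[OF C(1,3)] radon_probabilitiesD(2)[OF \<mu>(1)] by simp
    \<comment> \<open>Bounding \<open>f\<close> by its maximum over \<open>C\<close> on
      \<open>C\<close> and by its maximum over \<open>X\<close> elsewhere makes the integral at most
      the value of \<open>f\<close> at a point of \<open>D\<close>, which is less than
      \<open>f x\<close>.\<close>
    have "(\<integral>y. f y \<partial>\<mu>) \<le> (\<integral>y. f d + (f c - f d) * indicat_real C y \<partial>\<mu>)"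
    proof (rule integral_mono)
      show "integrable \<mu> f"
        using continuous_on_bounded_measurable[OF X(1) cont(1)] radon_probabilitiesD(4)[OF \<mu>(1)]
        by (intro integrable_bounded_measurable) simp
      show "integrable \<mu> (\<lambda>y. f d + (f c - f d) * indicat_real C y)"
        using Cs by (simp add: emeasure_eq_measure)
      show "f y \<le> f d + (f c - f d) * indicat_real C y" if "y \<in> space \<mu>" for y
        using that c d radon_probabilitiesD(3)[OF \<mu>(1)] by (auto simp: indicator_def)
    qed
    also have "\<dots> = f d + (f c - f d) * s"
      using Cs by (simp add: s_def prob_space emeasure_eq_measure Int_absorb2 sets.sets_into_space)
    also have "\<dots> = s * f c + (1 - s) * f d"
      by (simp add: algebra_simps)
    also have "\<dots> = f (s *\<^sub>R c + (1 - s) *\<^sub>R d)"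
      using f(1) by (simp add: linear_on_def)
    also have "\<dots> < f x"
      using c d by (intro less) (auto simp: D_iff)
    finally show False
      using barycenter_linear[OF f X(2) \<mu>] by simp
  qed
  ultimately show thesis
    using that unfolding D_iff s_def by blast
qed

lemma extreme_pointD:
  assumes x: "x \<in> ext X" and ab: "a \<in> X" "b \<in> X" "0 < s" "s < 1"
    and eq: "x = s *\<^sub>R a + (1 - s) *\<^sub>R b"
  shows "a = x" "b = x"
proof -
  have "a = b"
  proof (rule ccontr)
    assume "a \<noteq> b"
    then have "x \<in> open_segment b a"
      using ab eq by (auto simp: in_segment intro!: exI[of _ s])
    then show False
      using x ab by (auto simp: ext_def extreme_point_of_def)
  qed
  then show "a = x" "b = x"
    using eq by (simp_all flip: scaleR_add_left)
qed

text \<open>A point \<open>y\<close> other than \<open>x\<close> is cut off from \<open>x\<close> by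
  a closed half-space, and the slice \<open>C\<close> of \<open>X\<close> is null: otherwise
  \<open>barycenter_decomposition\<close> makes \<open>x\<close> a convex combination involving a
  point of \<open>C\<close>, which extremality excludes. Finitely many slices cover a given compact
  subset of \<open>X - {x}\<close>, and inner regularity then shows that \<open>X - {x}\<close> is
  null.\<close>

lemma measure_extreme_point:
  fixes X :: "'a::locally_convex_space set"
  assumes X: "compact X" "convex X" and x: "x \<in> ext X"
    and \<mu>: "\<mu> \<in> radon_probabilities X" "barycenter X \<mu> x"
  shows "measure \<mu> {x} = 1"
proof -
  interpret prob_space \<mu> using radon_probabilitiesD(1)[OF \<mu>(1)] .
  note \<mu>D = radon_probabilitiesD[OF \<mu>(1)]
  have xX: "x \<in> X"
    using x by (auto simp: ext_def extreme_point_of_def)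
  have closed_X: "closed X"
    using X(1) by (rule compact_imp_closed)
  have null: "\<exists>U. open U \<and> y \<in> U \<and> U \<inter> X \<in> sets \<mu> \<and> measure \<mu> (U \<inter> X) = 0"
    if y: "y \<in> X" "y \<noteq> x" for y
  proof -
    obtain f :: "'a \<Rightarrow> real" where f: "linear_on UNIV f" "continuous_on UNIV f" "f x < f y"
      using separation_compact_convex[of "{x}" y] y by auto
    define r where "r = (f x + f y) / 2"
    define C where "C = {z \<in> X. r \<le> f z}"
    have r: "f x < r" "r < f y" using f(3) by (simp_all add: r_def field_simps)
    have "C = X \<inter> f -` {r..}" by (auto simp: C_def)
    then have "compact C"
      using X(1) closed_vimage[OF closed_atLeast f(2), of r] by (simp add: compact_Int_closed)
    moreover have "convex C"
      unfolding convex_alt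
    proof (intro ballI allI impI)
      fix a b and u :: real assume ab: "a \<in> C" "b \<in> C" "0 \<le> u \<and> u \<le> 1"
      have "(1 - u) * r + u * r \<le> (1 - u) * f a + u * f b"
        using ab by (intro add_mono mult_left_mono) (auto simp: C_def)
      moreover have "(1 - u) * r + u * r = r"
        by (simp add: algebra_simps)
      moreover have "(1 - u) *\<^sub>R a + u *\<^sub>R b \<in> X"
        using ab X(2) by (auto simp: C_def convex_alt)
      ultimately show "(1 - u) *\<^sub>R a + u *\<^sub>R b \<in> C"
        using f(1) by (simp add: C_def linear_on_def)
    qed
    moreover have "C \<subseteq> X" "C \<noteq> {}"
      using y r by (auto simp: C_def)
    ultimately obtain c d where cd: "c \<in> C" "d \<in> X"
      "x = measure \<mu> C *\<^sub>R c + (1 - measure \<mu> C) *\<^sub>R d"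
      using barycenter_decomposition[OF X \<mu>] by metis
    have "x \<notin> C" using r by (simp add: C_def)
    have zero: "measure \<mu> C = 0"
    proof (rule ccontr)
      assume "measure \<mu> C \<noteq> 0"
      then consider "measure \<mu> C = 1" | "0 < measure \<mu> C" "measure \<mu> C < 1"
        using prob_le_1[of C] measure_nonneg[of \<mu> C] by linarith
      then have "c = x"
      proof cases
        case 1
        then show ?thesis using cd(3) by simp
      next
        case 2
        then show ?thesis
          using extreme_pointD(1)[OF x _ cd(2) _ _ cd(3)] cd(1) \<open>C \<subseteq> X\<close> by auto
      qed
      then show False using cd(1) \<open>x \<notin> C\<close> by simp
    qed
    \<comment> \<open>The open half-space is what a covering needs; its part in \<open>X\<close> is
      null because it lies in \<open>C\<close>.\<close>
    let ?U = "f -` {r<..}"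
    have "open ?U"
      using f(2) by (intro open_vimage) auto
    then have "X \<inter> ?U \<in> (\<inter>) X ` sets borel"
      by (intro imageI borel_open)
    then have US: "?U \<inter> X \<in> sets \<mu>"
      by (simp add: \<mu>D(2) sets_restrict_space Int_commute)
    have "C \<in> sets \<mu>"
      using compact_in_sets_restrict_borel[OF \<open>compact C\<close> \<open>C \<subseteq> X\<close>] \<mu>D(2) by simp
    then have "measure \<mu> (?U \<inter> X) \<le> measure \<mu> C"
      by (intro finite_measure_mono) (auto simp: C_def)
    then have "measure \<mu> (?U \<inter> X) = 0"
      using zero by (simp add: antisym)
    with \<open>open ?U\<close> US r show ?thesis
      by (intro exI[of _ ?U]) auto
  qed
  then obtain U where U: "\<And>y. y \<in> X - {x} \<Longrightarrow>
      open (U y) \<and> y \<in> U y \<and> U y \<inter> X \<in> sets \<mu> \<and> measure \<mu> (U y \<inter> X) = 0"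
    by (metis DiffE insertI1)
  have compact_null: "measure \<mu> K = 0" if K: "compact K" "K \<subseteq> X - {x}" for K
  proof -
    have ops: "open (U y)" if "y \<in> K" for y
      using U K(2) that by blast
    have cov: "K \<subseteq> (\<Union>y\<in>K. U y)"
      using U K(2) by blast
    obtain D where D: "D \<subseteq> K" "finite D" "K \<subseteq> (\<Union>y\<in>D. U y)"
      by (rule compactE_image[OF K(1), of K U]) (use ops cov in blast)+
    have UX: "U y \<inter> X \<in> sets \<mu>" "measure \<mu> (U y \<inter> X) = 0" if "y \<in> D" for y
      using U[of y] D(1) K(2) that by auto
    then have "(\<Union>y\<in>D. U y \<inter> X) \<in> sets \<mu>"
      using D(2) by (intro sets.finite_UN)
    then have "measure \<mu> K \<le> measure \<mu> (\<Union>y\<in>D. U y \<inter> X)"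
      using D K(2) by (intro finite_measure_mono) auto
    also have "\<dots> \<le> (\<Sum>y\<in>D. measure \<mu> (U y \<inter> X))"
      using D(2) UX by (intro finite_measure_subadditive_finite) auto
    also have "\<dots> = 0"
      using UX(2) by simp
    finally show ?thesis
      by (simp add: antisym)
  qed
  have xs: "{x} \<in> sets \<mu>"
    using compact_in_sets_restrict_borel[of "{x}" X] xX \<mu>D(2) by simp
  have "measure \<mu> (X - {x}) \<le> 0"
  proof (rule field_le_epsilon)
    fix e :: real assume e: "0 < e"
    have "X - {x} \<in> sets \<mu>"
      using xs \<mu>D(3) by (metis sets.compl_sets)
    from radon_inner_regular[OF \<mu>(1) this e] obtain K where
      "K \<subseteq> X - {x}" "compact K" "measure \<mu> (X - {x}) < measure \<mu> K + e" .
    then show "measure \<mu> (X - {x}) \<le> 0 + e"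
      using compact_null by simp
  qed
  then show ?thesis
    using prob_compl[OF xs] \<mu>D(3) by (intro antisym) simp_all
qed

section \<open>Convex combinations of maximal measures\<close>

definition convex_continuous :: "'a::locally_convex_space set \<Rightarrow> ('a \<Rightarrow> real) set"
  where "convex_continuous X = {f. convex_on X f \<and> continuous_on X f}"

lemma convex_continuous_const: "convex X \<Longrightarrow> (\<lambda>_. c) \<in> convex_continuous X"
  by (simp add: convex_continuous_def convex_on_def flip: distrib_right)

lemma convex_continuous_add:
  "\<lbrakk>f \<in> convex_continuous X; g \<in> convex_continuous X\<rbrakk> \<Longrightarrow> f + g \<in> convex_continuous X"
  by (simp add: convex_continuous_def func_plus convex_on_add continuous_on_add)

lemma convex_continuous_scale:
  "\<lbrakk>f \<in> convex_continuous X; 0 \<le> c\<rbrakk> \<Longrightarrow> c *\<^sub>R f \<in> convex_continuous X"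
  by (simp add: convex_continuous_def scaleR_fun_def convex_on_cmul continuous_on_mult_left)

lemma convex_continuous_max:
  assumes "f \<in> convex_continuous X" "g \<in> convex_continuous X"
  shows "(\<lambda>x. max (f x) (g x)) \<in> convex_continuous X"
proof -
  have "max (f (u *\<^sub>R x + v *\<^sub>R y)) (g (u *\<^sub>R x + v *\<^sub>R y))
      \<le> u * max (f x) (g x) + v * max (f y) (g y)"
    if "x \<in> X" "y \<in> X" "0 \<le> u" "0 \<le> v" "u + v = 1" for x y u v
  proof -
    have "f (u *\<^sub>R x + v *\<^sub>R y) \<le> u * f x + v * f y" "g (u *\<^sub>R x + v *\<^sub>R y) \<le> u * g x + v * g y"
      using assms that unfolding convex_continuous_def convex_on_def by blast+
    moreover have "u * f x + v * f y \<le> u * max (f x) (g x) + v * max (f y) (g y)"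
      "u * g x + v * g y \<le> u * max (f x) (g x) + v * max (f y) (g y)"
      using that by (intro add_mono mult_left_mono; simp)+
    ultimately show ?thesis by linarith
  qed
  then have "convex_on X (\<lambda>x. max (f x) (g x))"
    using assms by (auto simp: convex_continuous_def convex_on_def)
  then show ?thesis
    using assms by (simp add: convex_continuous_def continuous_on_max)
qed

text \<open>Domination by \<open>c \<nu>\<close> turns \<open>\<psi>\<close> into a Radon measure,
  and \<open>dil\<close> says that this measure dilates \<open>\<mu>\<close>. Maximality leaves no
  choice but \<open>\<mu>\<close> itself.\<close>

lemma maximal_measure_dominated:
  fixes X :: "'a::locally_convex_space set"
  defines "R \<equiv> restrict_space borel X"
  assumes X: "compact X" "convex X" and \<mu>: "maximal_measure X \<mu>" and \<nu>: "\<nu> \<in> radon_probabilities X"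
    and \<psi>: "positive_functional R \<psi>" and c: "0 < c"
    and dom: "\<And>A. A \<in> sets R \<Longrightarrow> \<psi> (indicat_real A) \<le> c * measure \<nu> A"
    and dil: "\<And>f. f \<in> convex_continuous X \<Longrightarrow> (\<integral>x. f x \<partial>\<mu>) \<le> \<psi> f"
    and f: "f \<in> bounded_measurable R"
  shows "\<psi> f = (\<integral>x. f x \<partial>\<mu>)"
proof -
  note \<nu>D = radon_probabilitiesD[OF \<nu>, folded R_def]
  have \<mu>R: "\<mu> \<in> radon_probabilities X"
    using \<mu> by (simp add: maximal_measure_def)
  interpret \<nu>: prob_space \<nu> by (rule \<nu>D)
  interpret \<mu>: prob_space \<mu> by (rule radon_probabilitiesD[OF \<mu>R])
  have cc: "f \<in> bounded_measurable R" if "f \<in> convex_continuous X" for f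
    using that X(1) continuous_on_bounded_measurable unfolding R_def convex_continuous_def by blast
  have \<psi>': "positive_functional \<nu> \<psi>"
    using \<psi> \<nu>D(4) sets_eq_imp_space_eq[OF \<nu>D(2)] by (simp add: positive_functional_def)
  obtain N where N: "finite_measure N" "sets N = sets \<nu>"
    "\<And>f. f \<in> bounded_measurable \<nu> \<Longrightarrow> (\<integral>x. f x \<partial>N) = \<psi> f"
    by (rule dominated_functional_representation[OF \<nu>.finite_measure_axioms \<psi>', of c])
      (use dom \<nu>D(2) in auto)
  interpret N: finite_measure N by fact
  have N_int: "(\<integral>x. f x \<partial>N) = \<psi> f" if "f \<in> bounded_measurable R" for f
    using N(3) that \<nu>D(4) by simp
  have lower: "(\<integral>x. f x \<partial>\<mu>) \<le> (\<integral>x. f x \<partial>N)" if "f \<in> convex_continuous X" for f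
    using dil[OF that] N_int[OF cc[OF that]] by simp
  \<comment> \<open>The constants 1 and -1 are both convex, so the total mass is bounded by 1 from
    both sides.\<close>
  have "1 \<le> measure N (space N)" "- 1 \<le> - measure N (space N)"
    using lower[OF convex_continuous_const[OF X(2), of 1]]
      lower[OF convex_continuous_const[OF X(2), of "-1"]] by (simp_all add: \<mu>.prob_space)
  then have "prob_space N"
    by (intro prob_spaceI) (simp add: N.emeasure_eq_measure)
  have "N \<in> radon_probabilities X"
  proof (rule radon_dominated[OF \<nu> \<open>prob_space N\<close> N(2) c])
    fix B assume B: "B \<in> sets \<nu>"
    then have "measure N B = \<psi> (indicat_real B)"
      using N(3)[OF indicator_bounded_measurable[OF B]] N(2)
      by (simp add: Int_absorb2 sets.sets_into_space)
    then show "measure N B \<le> c * measure \<nu> B"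
      using dom B \<nu>D(2) by simp
  qed
  moreover have "dilation_le X \<mu> N"
    using lower by (simp add: dilation_le_def convex_continuous_def)
  ultimately have "N = \<mu>"
    using \<mu> by (simp add: maximal_measure_def)
  then show ?thesis
    using N_int[OF f] by simp
qed

text \<open>
  A dilation of the mixture splits into dilations of its two parts. The splitting functional comes
  from the Hahn--Banach theorem on all bounded Borel functions instead of only the continuous ones;
  being dominated by a measure it is itself a measure, so no Riesz representation is needed.
\<close>

lemma maximal_measure_convex_combination:
  fixes X :: "'a::locally_convex_space set"
  assumes X: "compact X" "convex X" and max: "maximal_measure X \<mu>\<^sub>1" "maximal_measure X \<mu>\<^sub>2"
    and t: "0 < t" "t < 1" and \<rho>: "\<rho> \<in> radon_probabilities X"
    and mix: "\<And>f. f \<in> bounded_measurable (restrict_space borel X)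
      \<Longrightarrow> (\<integral>x. f x \<partial>\<rho>) = (1 - t) * (\<integral>x. f x \<partial>\<mu>\<^sub>1) + t * (\<integral>x. f x \<partial>\<mu>\<^sub>2)"
  shows "maximal_measure X \<rho>"
  unfolding maximal_measure_def
proof (intro conjI ballI impI \<rho>)
  fix \<nu> assume \<nu>: "\<nu> \<in> radon_probabilities X" and dil: "dilation_le X \<rho> \<nu>"
  define E where "E = bounded_measurable (restrict_space borel X)"
  define CC where "CC = convex_continuous X"
  \<comment> \<open>The aim is a linear \<open>\<phi>\<close> with
    \<open>0 \<le> \<phi> \<le> \<nu>\<close> such that \<open>\<phi>\<close> dominates
    \<open>(1 - t) \<mu>\<^sub>1\<close> and \<open>\<nu> - \<phi>\<close> dominates
    \<open>t \<mu>\<^sub>2\<close> on convex continuous functions. All this is contained in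
    \<open>\<phi> g \<le> F g k\<close>: \<open>k = 0\<close> gives
    \<open>\<phi> g \<le> pp g\<close>, hence the order bounds; \<open>g = - f\<close> with
    \<open>k = (f, 0)\<close> gives the condition for \<open>\<mu>\<^sub>1\<close>;
    \<open>g = f\<close> with \<open>k = (0, f)\<close> gives the one for
    \<open>\<mu>\<^sub>2\<close>.\<close>
  define pp where "pp = (\<lambda>g :: 'a \<Rightarrow> real. \<integral>x. max 0 (g x) \<partial>\<nu>)"
  define L where "L = (\<lambda>k :: ('a \<Rightarrow> real) \<times> ('a \<Rightarrow> real). (\<integral>x. snd k x \<partial>\<nu>) - (1 - t) * (\<integral>x. fst k x \<partial>\<mu>\<^sub>1) - t * (\<integral>x. snd k x \<partial>\<mu>\<^sub>2))"
  define F where "F = (\<lambda>g k. pp (g + fst k - snd k) + L k)"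
  define p where "p = (\<lambda>g. INF k\<in>CC \<times> CC. F g k)"
  have \<mu>12: "\<mu>\<^sub>1 \<in> radon_probabilities X" "\<mu>\<^sub>2 \<in> radon_probabilities X"
    using max by (auto simp: maximal_measure_def)
  note \<nu>D = radon_probabilitiesD[OF \<nu>]
  interpret \<nu>: prob_space \<nu> by (rule \<nu>D)
  interpret \<mu>1: prob_space \<mu>\<^sub>1 by (rule radon_probabilitiesD[OF \<mu>12(1)])
  interpret \<mu>2: prob_space \<mu>\<^sub>2 by (rule radon_probabilitiesD[OF \<mu>12(2)])
  interpret \<rho>: prob_space \<rho> by (rule radon_probabilitiesD[OF \<rho>])
  have S: "subspace E"
    unfolding E_def by (rule subspace_bounded_measurable)
  have pf: "positive_functional (restrict_space borel X) (\<lambda>f. \<integral>x. f x \<partial>\<nu>)"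
    "positive_functional (restrict_space borel X) (\<lambda>f. \<integral>x. f x \<partial>\<mu>\<^sub>1)"
    "positive_functional (restrict_space borel X) (\<lambda>f. \<integral>x. f x \<partial>\<mu>\<^sub>2)"
    using positive_functional_integral[OF \<nu>.finite_measure_axioms \<nu>D(2)]
      positive_functional_integral[OF \<mu>1.finite_measure_axioms radon_probabilitiesD(2)[OF \<mu>12(1)]]
      positive_functional_integral[OF \<mu>2.finite_measure_axioms radon_probabilitiesD(2)[OF \<mu>12(2)]]
    by simp_all
  have lin: "linear_on E (\<lambda>f. \<integral>x. f x \<partial>\<nu>)" "linear_on E (\<lambda>f. \<integral>x. f x \<partial>\<mu>\<^sub>1)"
    "linear_on E (\<lambda>f. \<integral>x. f x \<partial>\<mu>\<^sub>2)"
    using pf by (simp_all add: positive_functional_def E_def)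
  have int: "integrable \<nu> f" "integrable \<mu>\<^sub>1 f" "integrable \<mu>\<^sub>2 f" if "f \<in> E" for f
    using that \<nu>.integrable_bounded_measurable \<mu>1.integrable_bounded_measurable
      \<mu>2.integrable_bounded_measurable radon_probabilitiesD(4)[OF \<mu>12(1)]
      radon_probabilitiesD(4)[OF \<mu>12(2)] \<nu>D(4) by (auto simp: E_def)
  have CC_E: "f \<in> E" if "f \<in> CC" for f
    using that X(1) continuous_on_bounded_measurable unfolding CC_def E_def convex_continuous_def by blast
  have CC_0: "0 \<in> CC"
    using convex_continuous_const[OF X(2), of 0] by (simp add: CC_def func_zero)
  have pos_E: "(\<lambda>x. max 0 (g x)) \<in> E" if g: "g \<in> E" for g
  proof -
    obtain B where "g \<in> borel_measurable (restrict_space borel X)"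
      and B: "\<And>x. x \<in> space (restrict_space borel X) \<Longrightarrow> \<bar>g x\<bar> \<le> B"
      using g by (auto simp: E_def bounded_measurable_def)
    moreover have "\<bar>max 0 (g x)\<bar> \<le> B" if "x \<in> space (restrict_space borel X)" for x
      using B[OF that] by auto
    ultimately show ?thesis
      unfolding E_def by (intro bounded_measurableI[where B=B]) auto
  qed
  have pp_le: "pp f \<le> (\<integral>x. g x \<partial>\<nu>)" if "f \<in> E" "g \<in> E" "\<And>x. x \<in> X \<Longrightarrow> max 0 (f x) \<le> g x" for f g
    unfolding pp_def using that \<nu>D(3) by (intro integral_mono int pos_E) auto
  have pp_nonpos: "pp f \<le> 0" if "f \<in> E" "\<And>x. x \<in> X \<Longrightarrow> f x \<le> 0" for f
    using pp_le[of f 0] that subspace_0[OF S] by (simp add: func_zero)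
  have pp_0: "pp 0 = 0"
    by (simp add: pp_def func_zero)
  have pp_add: "pp (f + g) \<le> pp f + pp g" if "f \<in> E" "g \<in> E" for f g
  proof -
    let ?h = "(\<lambda>x. max 0 (f x)) + (\<lambda>x. max 0 (g x))"
    have "pp (f + g) \<le> (\<integral>x. ?h x \<partial>\<nu>)"
      using that by (intro pp_le subspace_add[OF S] pos_E) auto
    then show ?thesis
      using int(1)[OF pos_E[OF that(1)]] int(1)[OF pos_E[OF that(2)]] by (simp add: pp_def)
  qed
  have pp_scale: "pp (c *\<^sub>R f) = c * pp f" if "0 \<le> c" for c f
  proof -
    have "max 0 (c * f x) = c * max 0 (f x)" for x
      using that by (simp add: max_mult_distrib_left)
    then show ?thesis by (simp add: pp_def)
  qed
  have L_add: "L (k + l) = L k + L l" if "k \<in> CC \<times> CC" "l \<in> CC \<times> CC" for k l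
  proof -
    have "fst k \<in> E" "snd k \<in> E" "fst l \<in> E" "snd l \<in> E"
      using that CC_E by auto
    then show ?thesis
      unfolding L_def fst_add snd_add
      by (simp only: linear_on_add[OF lin(1) S] linear_on_add[OF lin(2) S] linear_on_add[OF lin(3) S])
        (simp add: algebra_simps)
  qed
  have L_scale: "L (c *\<^sub>R k) = c * L k" if "k \<in> CC \<times> CC" for c k
  proof -
    have "fst k \<in> E" "snd k \<in> E"
      using that CC_E by auto
    then show ?thesis
      unfolding L_def fst_scaleR snd_scaleR
      by (simp only: linear_on_scale[OF lin(1) S] linear_on_scale[OF lin(2) S] linear_on_scale[OF lin(3) S])
        (simp add: algebra_simps)
  qed
  have mem: "g + fst k - snd k \<in> E" if "g \<in> E" "k \<in> CC \<times> CC" for g k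
    using that CC_E by (auto intro!: subspace_add[OF S] subspace_diff[OF S])
  have F_add: "F (g + h) (k + l) \<le> F g k + F h l"
    if "g \<in> E" "h \<in> E" "k \<in> CC \<times> CC" "l \<in> CC \<times> CC" for g h k l
  proof -
    have eq: "(g + h) + fst (k + l) - snd (k + l) = (g + fst k - snd k) + (h + fst l - snd l)"
      by simp
    show ?thesis
      using pp_add[OF mem[OF that(1,3)] mem[OF that(2,4)]] L_add[OF that(3,4)]
      unfolding F_def eq by linarith
  qed
  have F_scale: "F (c *\<^sub>R g) (c *\<^sub>R k) \<le> c * F g k" if "g \<in> E" "k \<in> CC \<times> CC" "0 \<le> c" for g k c
  proof -
    have "c *\<^sub>R g + fst (c *\<^sub>R k) - snd (c *\<^sub>R k) = c *\<^sub>R (g + fst k - snd k)"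
      by (simp add: scaleR_add_right scaleR_diff_right)
    then show ?thesis
      using pp_scale[OF that(3), of "g + fst k - snd k"] L_scale[OF that(2), of c]
      unfolding F_def by (simp only: distrib_left)
  qed
  \<comment> \<open>Consistency of the constraints is where \<open>\<rho> \<prec> \<nu>\<close>
    enters: the maximum of two convex functions is convex, so its integral grows from
    \<open>\<rho>\<close> to \<open>\<nu>\<close>, and \<open>max f g = max 0 (f - g) + g\<close>
    turns this into the claim.\<close>
  have F_0: "0 \<le> F 0 k" if kCC: "k \<in> CC \<times> CC" for k
  proof -
    obtain f g where k: "k = (f, g)" "f \<in> CC" "g \<in> CC" using kCC by auto
    let ?m = "\<lambda>x. max (f x) (g x)"
    have m: "?m \<in> CC"
      using k convex_continuous_max unfolding CC_def by blast
    note mE = CC_E[OF m] and fE = CC_E[OF k(2)] and gE = CC_E[OF k(3)]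
    have "(1 - t) * (\<integral>x. f x \<partial>\<mu>\<^sub>1) + t * (\<integral>x. g x \<partial>\<mu>\<^sub>2)
        \<le> (1 - t) * (\<integral>x. ?m x \<partial>\<mu>\<^sub>1) + t * (\<integral>x. ?m x \<partial>\<mu>\<^sub>2)"
      using t by (intro add_mono mult_left_mono integral_mono int mE fE gE) auto
    also have "\<dots> = (\<integral>x. ?m x \<partial>\<rho>)"
      using mix[of ?m] mE by (simp add: E_def)
    also have "\<dots> \<le> (\<integral>x. ?m x \<partial>\<nu>)"
      using dil m by (simp add: dilation_le_def CC_def convex_continuous_def)
    also have "\<dots> = (\<integral>x. max 0 ((f - g) x) + g x \<partial>\<nu>)"
      by (rule Bochner_Integration.integral_cong) auto
    also have "\<dots> = pp (f - g) + (\<integral>x. g x \<partial>\<nu>)"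
      unfolding pp_def using int(1)[OF pos_E[OF subspace_diff[OF S fE gE]]] int(1)[OF gE]
      by (rule Bochner_Integration.integral_add)
    finally show ?thesis
      by (simp add: F_def L_def k)
  qed
  have K: "0 \<in> CC \<times> CC" "\<And>k l. \<lbrakk>k \<in> CC \<times> CC; l \<in> CC \<times> CC\<rbrakk> \<Longrightarrow> k + l \<in> CC \<times> CC"
    "\<And>k c. \<lbrakk>k \<in> CC \<times> CC; 0 \<le> c\<rbrakk> \<Longrightarrow> c *\<^sub>R k \<in> CC \<times> CC"
    using CC_0 convex_continuous_add convex_continuous_scale
    by (auto simp: CC_def zero_prod_def mem_Times_iff)
  have *: "sublinear_on E p"
    unfolding p_def by (rule cone_inf_sublinear(1)[OF S]; (rule K F_add F_scale F_0; assumption)?)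
  have p_le: "p g \<le> F g k" if "g \<in> E" "k \<in> CC \<times> CC" for g k
    unfolding p_def
    by (rule cone_inf_sublinear(2)[OF S _ _ _ _ _ _ that]; (rule K F_add F_scale F_0; assumption)?)
  obtain \<phi> where \<phi>: "linear_on E \<phi>" "\<And>g. g \<in> E \<Longrightarrow> \<phi> g \<le> p g"
    using hahn_banach_sublinear[OF S *] by blast
  have le: "\<phi> g \<le> F g k" if "g \<in> E" "k \<in> CC \<times> CC" for g k
    using \<phi>(2)[OF that(1)] p_le[OF that] by simp
  have up: "\<phi> g \<le> pp g" if "g \<in> E" for g
    using le[OF that K(1)] by (simp add: F_def L_def func_zero)
  have neg_le: "\<phi> (- g) = - \<phi> g" if "g \<in> E" for g
    using linear_on_minus[OF \<phi>(1) S that] .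
  have nonneg: "0 \<le> \<phi> g" if "g \<in> E" "\<And>x. x \<in> X \<Longrightarrow> 0 \<le> g x" for g
    using up[of "- g"] pp_nonpos[of "- g"] neg_le[OF that(1)] that subspace_neg[OF S] by fastforce
  have nonneg': "\<phi> g \<le> (\<integral>x. g x \<partial>\<nu>)" if "g \<in> E" "\<And>x. x \<in> X \<Longrightarrow> 0 \<le> g x" for g
    using up[OF that(1)] pp_le[OF that(1) that(1)] that(2) by fastforce
  have low1: "(1 - t) * (\<integral>x. f x \<partial>\<mu>\<^sub>1) \<le> \<phi> f" if "f \<in> CC" for f
    using le[of "- f" "(f, 0)"] neg_le[OF CC_E[OF that]] that CC_0 subspace_neg[OF S CC_E[OF that]] pp_0
    by (simp add: F_def L_def func_zero)
  have low2: "t * (\<integral>x. f x \<partial>\<mu>\<^sub>2) \<le> (\<integral>x. f x \<partial>\<nu>) - \<phi> f" if "f \<in> CC" for f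
    using le[of f "(0, f)"] that CC_0 CC_E[OF that] pp_0
    by (simp add: F_def L_def func_zero)
  have ind: "indicat_real A \<in> E" "\<phi> (indicat_real A) \<le> measure \<nu> A" "0 \<le> \<phi> (indicat_real A)"
    "(\<integral>x. indicat_real A x \<partial>\<nu>) = measure \<nu> A" if A: "A \<in> sets (restrict_space borel X)" for A
  proof -
    show 1: "indicat_real A \<in> E"
      unfolding E_def by (rule indicator_bounded_measurable[OF A])
    show 2: "(\<integral>x. indicat_real A x \<partial>\<nu>) = measure \<nu> A"
      using A \<nu>D(2) by (simp add: Int_absorb2 sets.sets_into_space)
    show "\<phi> (indicat_real A) \<le> measure \<nu> A"
      using nonneg'[OF 1] 2 by simp
    show "0 \<le> \<phi> (indicat_real A)"
      using nonneg[OF 1] by simp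
  qed
  have space_R: "space (restrict_space borel X) = X"
    by (simp add: space_restrict_space)
  \<comment> \<open>Normalized, \<open>\<phi>\<close> and \<open>\<nu> - \<phi>\<close> dilate
    \<open>\<mu>\<^sub>1\<close> and \<open>\<mu>\<^sub>2\<close> and are dominated by multiples of
    \<open>\<nu>\<close>. Maximality identifies them, and adding the two parts gives
    \<open>\<nu> = \<rho>\<close>.\<close>
  have eq1: "\<phi> f / (1 - t) = (\<integral>x. f x \<partial>\<mu>\<^sub>1)" if f: "f \<in> E" for f
  proof (rule maximal_measure_dominated[where \<psi>="\<lambda>f. \<phi> f / (1 - t)" and c="1 / (1 - t)", OF X max(1) \<nu>])
    show "positive_functional (restrict_space borel X) (\<lambda>f. \<phi> f / (1 - t))"
      using \<phi>(1) nonneg t unfolding positive_functional_def space_R E_def[symmetric]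
      by (auto simp: linear_on_def add_divide_distrib)
    show "(\<integral>x. f x \<partial>\<mu>\<^sub>1) \<le> \<phi> f / (1 - t)" if "f \<in> convex_continuous X" for f
      using low1[of f] that t by (simp add: CC_def field_simps)
    show "\<phi> (indicat_real A) / (1 - t) \<le> 1 / (1 - t) * measure \<nu> A"
      if "A \<in> sets (restrict_space borel X)" for A
      using ind(2)[OF that] t by (simp add: divide_right_mono)
  qed (use f t in \<open>auto simp: E_def\<close>)
  have eq2: "((\<integral>x. f x \<partial>\<nu>) - \<phi> f) / t = (\<integral>x. f x \<partial>\<mu>\<^sub>2)" if f: "f \<in> E" for f
  proof (rule maximal_measure_dominated[where \<psi>="\<lambda>f. ((\<integral>x. f x \<partial>\<nu>) - \<phi> f) / t" and c="1 / t", OF X max(2) \<nu>])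
    show "positive_functional (restrict_space borel X) (\<lambda>f. ((\<integral>x. f x \<partial>\<nu>) - \<phi> f) / t)"
      unfolding positive_functional_def space_R E_def[symmetric]
    proof (intro conjI ballI impI)
      show "linear_on E (\<lambda>f. ((\<integral>x. f x \<partial>\<nu>) - \<phi> f) / t)"
        unfolding linear_on_def
        by (auto simp: linear_on_add[OF lin(1) S] linear_on_add[OF \<phi>(1) S] linear_on_scale[OF lin(1) S]
            linear_on_scale[OF \<phi>(1) S] diff_divide_distrib add_divide_distrib algebra_simps simp del: plus_fun_apply scaleR_fun_apply)
      show "0 \<le> ((\<integral>x. f x \<partial>\<nu>) - \<phi> f) / t" if "f \<in> E" "\<forall>x\<in>X. 0 \<le> f x" for f
        using nonneg'[of f] that t by simp
    qed
    show "(\<integral>x. f x \<partial>\<mu>\<^sub>2) \<le> ((\<integral>x. f x \<partial>\<nu>) - \<phi> f) / t" if "f \<in> convex_continuous X" for f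
      using low2[of f] that t by (simp add: CC_def field_simps)
    show "((\<integral>x. indicat_real A x \<partial>\<nu>) - \<phi> (indicat_real A)) / t \<le> 1 / t * measure \<nu> A"
      if "A \<in> sets (restrict_space borel X)" for A
      using ind(3,4)[OF that] t by (simp add: divide_right_mono)
  qed (use f t in \<open>auto simp: E_def\<close>)
  show "\<nu> = \<rho>"
  proof (rule measure_eqI_integral)
    show "(\<integral>x. f x \<partial>\<nu>) = (\<integral>x. f x \<partial>\<rho>)" if "f \<in> bounded_measurable \<nu>" for f
    proof -
      have f: "f \<in> E" using that \<nu>D(4) by (simp add: E_def)
      then have "(\<integral>x. f x \<partial>\<rho>) = (1 - t) * (\<phi> f / (1 - t)) + t * (((\<integral>x. f x \<partial>\<nu>) - \<phi> f) / t)"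
        using mix[of f] eq1 eq2 by (simp add: E_def)
      then show ?thesis using t by simp
    qed
  qed (use \<nu>D(2) radon_probabilitiesD(2)[OF \<rho>] in \<open>auto intro: \<nu>.finite_measure_axioms \<rho>.finite_measure_axioms\<close>)
qed

section \<open>Extreme points of simplices\<close>

text \<open>The complementary set is \<open>{l = 0}\<close>. This is a face because \<open>l\<close>
  is affine and nonnegative; conversely, if \<open>0 < l y < 1\<close> then \<open>y\<close> lies
  strictly between \<open>x\<close> and some \<open>d\<close>, so a face containing \<open>y\<close>
  contains \<open>x\<close>. Applying \<open>l\<close> to a decomposition of \<open>y\<close>
  recovers its coefficient, whence uniqueness.\<close>

lemma split_face_if_affine:
  fixes X :: "'a::real_vector set"
  assumes X: "convex X" and x: "x \<in> ext X" and l: "affine_on X l" "\<And>y. y \<in> X \<Longrightarrow> 0 \<le> l y \<and> l y \<le> 1"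
    and lx: "l x = 1" and dec: "\<And>y. y \<in> X \<Longrightarrow> \<exists>d\<in>X. y = l y *\<^sub>R x + (1 - l y) *\<^sub>R d"
  shows "split_face X {x}"
proof -
  have xX: "x \<in> X" and xe: "x extreme_point_of X"
    using x by (auto simp: ext_def extreme_point_of_def)
  define G where "G = {y \<in> X. l y = 0}"
  have aff: "l (s *\<^sub>R a + (1 - s) *\<^sub>R b) = s * l a + (1 - s) * l b"
    if "a \<in> X" "b \<in> X" "0 \<le> s" "s \<le> 1" for a b s
    by (rule affine_onD[OF l(1) that])
  have aff': "l ((1 - s) *\<^sub>R a + s *\<^sub>R b) = (1 - s) * l a + s * l b"
    if "a \<in> X" "b \<in> X" "0 \<le> s" "s \<le> 1" for a b s
    using aff[of a b "1 - s"] that by simp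
  have convex_G: "convex G"
    unfolding convex_alt using X aff' by (auto simp: G_def convex_alt)
  have "G face_of X"
    unfolding face_of_def
  proof (intro conjI ballI impI)
    fix a b w assume ab: "a \<in> X" "b \<in> X" "w \<in> G" "w \<in> open_segment a b"
    then obtain u where u: "0 < u" "u < 1" "w = (1 - u) *\<^sub>R a + u *\<^sub>R b"
      by (auto simp: in_segment)
    then have "(1 - u) * l a + u * l b = 0"
      using aff'[of a b u] ab by (simp add: G_def)
    moreover have "0 \<le> (1 - u) * l a" "0 \<le> u * l b"
      using l(2) ab u by auto
    ultimately have "(1 - u) * l a = 0" "u * l b = 0"
      by linarith+
    then show "a \<in> G" "b \<in> G"
      using u ab by (auto simp: G_def)
  qed (use convex_G in \<open>auto simp: G_def\<close>)
  have l1: "y = x" if "y \<in> X" "l y = 1" for y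
    using dec[OF that(1)] that(2) by auto
  have compl: "complementary_set X {x} = G"
  proof
    show "G \<subseteq> complementary_set X {x}"
      using \<open>G face_of X\<close> lx by (auto simp: complementary_set_def G_def)
    show "complementary_set X {x} \<subseteq> G"
    proof
      fix y assume "y \<in> complementary_set X {x}"
      then obtain F where F: "F face_of X" "x \<notin> F" "y \<in> F"
        by (auto simp: complementary_set_def)
      then have yX: "y \<in> X" using face_of_imp_subset by blast
      obtain d where d: "d \<in> X" "y = l y *\<^sub>R x + (1 - l y) *\<^sub>R d"
        using dec[OF yX] by blast
      have "l y = 0"
      proof (rule ccontr)
        assume "l y \<noteq> 0"
        then have ly: "0 < l y" "l y < 1"
          using l(2)[OF yX] l1[OF yX] F by fastforce+
        have "d \<noteq> x"
        proof
          assume "d = x"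
          then have "y = x" using d(2) by (simp flip: scaleR_add_left)
          then show False using F by simp
        qed
        then have "y \<in> open_segment d x"
          using ly trans[OF d(2) add.commute] unfolding in_segment by blast
        then show False
          using F d(1) xX by (auto simp: face_of_def)
      qed
      then show "y \<in> G" using yX by (simp add: G_def)
    qed
  qed
  have "\<exists>!p. case p of (s, a, a') \<Rightarrow> s \<in> {0<..<1} \<and> a \<in> {x} \<and> a' \<in> G \<and> y = s *\<^sub>R a + (1 - s) *\<^sub>R a'"
    if y: "y \<in> X - ({x} \<union> G)" for y
  proof -
    have yX: "y \<in> X" using y by simp
    then obtain d where d: "d \<in> X" "y = l y *\<^sub>R x + (1 - l y) *\<^sub>R d"
      using dec by blast
    have ly: "0 < l y" "l y < 1"
      using l(2)[OF yX] l1[OF yX] y by (fastforce simp: G_def)+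
    have "l y = l y * l x + (1 - l y) * l d"
      using aff[OF xX d(1), of "l y"] d(2) ly by simp
    then have "d \<in> G"
      using ly lx d(1) by (simp add: G_def)
    show ?thesis
    proof (rule ex1I[of _ "(l y, x, d)"])
      show "case (l y, x, d) of (s, a, a') \<Rightarrow> s \<in> {0<..<1} \<and> a \<in> {x} \<and> a' \<in> G \<and> y = s *\<^sub>R a + (1 - s) *\<^sub>R a'"
        using ly d \<open>d \<in> G\<close> by simp
    next
      fix p assume p: "case p of (s, a, a') \<Rightarrow> s \<in> {0<..<1} \<and> a \<in> {x} \<and> a' \<in> G \<and> y = s *\<^sub>R a + (1 - s) *\<^sub>R a'"
      obtain s a d' where p_eq: "p = (s, a, d')" by (cases p)
      have s: "0 < s" "s < 1" "a = x" "d' \<in> G" "y = s *\<^sub>R x + (1 - s) *\<^sub>R d'"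
        using p p_eq by auto
      have "l y = s"
        using aff[OF xX, of d' s] s lx by (simp add: G_def)
      moreover from this have "(1 - s) *\<^sub>R d' = (1 - s) *\<^sub>R d"
        using d(2) s(5) by simp
      then have "d' = d" using s by simp
      ultimately show "p = (l y, x, d)"
        using p_eq s by simp
    qed
  qed
  then show ?thesis
    using xe convex_G by (simp add: split_face_def compl face_of_singleton)
qed

lemma split_face_simplex:
  fixes X :: "'a::locally_convex_space set"
  assumes X: "compact X" "convex X" and simplex: "choquet_simplex X" and x: "x \<in> ext X"
  shows "split_face X {x}"
proof -
  have xX: "x \<in> X"
    using x by (auto simp: ext_def extreme_point_of_def)
  obtain m where m: "\<And>y. y \<in> X \<Longrightarrow> maximal_measure X (m y)" "\<And>y. y \<in> X \<Longrightarrow> barycenter X (m y) y"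
    and uniq: "\<And>y \<mu>. \<lbrakk>y \<in> X; maximal_measure X \<mu>; barycenter X \<mu> y\<rbrakk> \<Longrightarrow> \<mu> = m y"
    using simplex unfolding choquet_simplex_def by metis
  have rad: "m y \<in> radon_probabilities X" if "y \<in> X" for y
    using m(1)[OF that] by (simp add: maximal_measure_def)
  have xs: "{x} \<in> sets (restrict_space borel X)"
    using xX by (intro compact_in_sets_restrict_borel) auto
  define l where "l = (\<lambda>y. measure (m y) {x})"
  show ?thesis
  proof (rule split_face_if_affine[OF X(2) x])
    show "l x = 1"
      unfolding l_def by (rule measure_extreme_point[OF X x rad[OF xX] m(2)[OF xX]])
    show "0 \<le> l y \<and> l y \<le> 1" if "y \<in> X" for y
      using prob_space.prob_le_1[OF radon_probabilitiesD(1)[OF rad[OF that]]] by (simp add: l_def)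
    \<comment> \<open>With \<open>C = {x}\<close> the mass of the atom becomes the coefficient of
      \<open>x\<close>.\<close>
    show "\<exists>d\<in>X. y = l y *\<^sub>R x + (1 - l y) *\<^sub>R d" if "y \<in> X" for y
      using barycenter_decomposition[OF X rad[OF that] m(2)[OF that], of "{x}"] xX
      by (auto simp: l_def)
    show "affine_on X l"
      unfolding affine_on_def
    proof (intro ballI)
      fix y z and t :: real assume yz: "y \<in> X" "z \<in> X" and t: "t \<in> {0..1}"
      show "l ((1 - t) *\<^sub>R y + t *\<^sub>R z) = (1 - t) * l y + t * l z"
      \<comment> \<open>The mixture of maximal measures is treated for \<open>0 < t < 1\<close>; at
        the endpoints there is nothing to mix.\<close>
      proof (cases "t = 0 \<or> t = 1")
        case False
        then have t: "0 < t" "t < 1" using t by auto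
        let ?w = "(1 - t) *\<^sub>R y + t *\<^sub>R z"
        have w: "?w \<in> X"
          using X(2) yz t by (simp add: convex_alt)
        obtain \<rho> where \<rho>: "\<rho> \<in> radon_probabilities X"
          "\<And>f. f \<in> bounded_measurable (restrict_space borel X)
            \<Longrightarrow> (\<integral>x. f x \<partial>\<rho>) = (1 - t) * (\<integral>x. f x \<partial>(m y)) + t * (\<integral>x. f x \<partial>(m z))"
          "\<And>A. A \<in> sets (restrict_space borel X)
            \<Longrightarrow> measure \<rho> A = (1 - t) * measure (m y) A + t * measure (m z) A"
          using radon_convex_combination[OF rad[OF yz(1)] rad[OF yz(2)], of t] t by auto
        have "maximal_measure X \<rho>"
          by (rule maximal_measure_convex_combination[OF X m(1)[OF yz(1)] m(1)[OF yz(2)] t \<rho>(1,2)])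
        moreover have "barycenter X \<rho> ?w"
          unfolding barycenter_def
        proof (intro conjI w ballI)
          fix f assume f: "f \<in> A_c X"
          then have "f \<in> bounded_measurable (restrict_space borel X)"
            using X(1) by (intro continuous_on_bounded_measurable) (auto simp: A_c_def)
          then have "(\<integral>x. f x \<partial>\<rho>) = (1 - t) * f y + t * f z"
            using \<rho>(2) m(2)[OF yz(1)] m(2)[OF yz(2)] f by (simp add: barycenter_def)
          then show "(\<integral>x. f x \<partial>\<rho>) = f ?w"
            using f yz t by (simp add: A_c_def affine_on_def)
        qed
        ultimately have "\<rho> = m ?w"
          by (rule uniq[OF w])
        then show ?thesis
          using \<rho>(3)[OF xs] by (simp add: l_def)
      qed auto
    qed
  qed
qed

section \<open>Semicontinuous affine functions\<close>

lemma affine_on_add: "\<lbrakk>affine_on X f; affine_on X g\<rbrakk> \<Longrightarrow> affine_on X (f + g)"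
  by (simp add: affine_on_def distrib_left)

lemma affine_on_scale: "affine_on X f \<Longrightarrow> affine_on X (c *\<^sub>R f)"
  by (simp add: affine_on_def distrib_left mult.left_commute)

lemma affine_on_diff: "\<lbrakk>affine_on X f; affine_on X g\<rbrakk> \<Longrightarrow> affine_on X (f - g)"
  using affine_on_add[of X f "(- 1) *\<^sub>R g"] affine_on_scale[of X g "- 1"] by simp

lemma subspace_A_b: "subspace (A_b X)"
  unfolding subspace_def
proof (intro conjI ballI allI)
  show "0 \<in> A_b X"
    by (auto simp: A_b_def functions_on_def affine_on_def image_constant_conv)
next
  fix f g assume "f \<in> A_b X" "g \<in> A_b X"
  then show "f + g \<in> A_b X"
    using bounded_plus_comp[of f X g]
    by (simp add: A_b_def functions_on_def affine_on_add)
next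
  fix c :: real and f assume "f \<in> A_b X"
  then show "c *\<^sub>R f \<in> A_b X"
    using bounded_scaleR_comp[of f X c]
    by (simp add: A_b_def functions_on_def affine_on_scale)
qed

section \<open>Boundedness, Borel class and Baire class of semicontinuous affine functions\<close>

lemma A_l_bounded_below:
  assumes X: "compact X" and f: "f \<in> A_l X"
  obtains B where "\<And>x. x \<in> X \<Longrightarrow> B \<le> f x"
proof -
  have "\<exists>T. open T \<and> {x \<in> X. r < f x} = X \<inter> T" for r
    using f by (auto simp: A_l_def lower_semicontinuous_on_def openin_open)
  then obtain T where T: "\<And>r. open (T r)" "\<And>r. {x \<in> X. r < f x} = X \<inter> T r"
    by metis
  have cov: "X \<subseteq> (\<Union>n\<in>UNIV. T (- real n))"
  proof
    fix x assume x: "x \<in> X"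
    obtain n where "- f x < real n"
      using reals_Archimedean2 by blast
    then have "x \<in> {x \<in> X. - real n < f x}"
      using x by simp
    then show "x \<in> (\<Union>n\<in>UNIV. T (- real n))"
      unfolding T(2) by blast
  qed
  obtain D where D: "finite D" "X \<subseteq> (\<Union>n\<in>D. T (- real n))"
    by (rule compactE_image[OF X, of "UNIV :: nat set" "\<lambda>n. T (- real n)"]) (use T(1) cov in auto)
  have "- real (Max D) \<le> f x" if x: "x \<in> X" for x
  proof -
    obtain n where n: "n \<in> D" "x \<in> X \<inter> T (- real n)"
      using D(2) x by blast
    then have "- real n < f x"
      unfolding T(2)[symmetric] by simp
    then show ?thesis
      using Max_ge[OF D(1) n(1)] by linarith
  qed
  then show thesis by (rule that)
qed

text \<open>
  If \<open>f\<close> took values \<open>f (x\<^sub>i) \<ge> 2 ^ (i + 1)\<close>, then \<open>f\<close> would be infinite at \<open>\<Sum>i. 2 ^ -(i + 1) x\<^sub>i\<close>.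
\<close>

lemma A_l_bounded_above:
  fixes X :: "'a::locally_convex_space set"
  assumes X: "compact X" "convex X" and f: "f \<in> A_l X"
  obtains B where "\<And>x. x \<in> X \<Longrightarrow> f x \<le> B"
proof (rule ccontr)
  assume "\<not> thesis"
  then have "\<exists>x\<in>X. 2 ^ Suc i < f x" for i :: nat
    using that by (meson not_le)
  then obtain y where y: "\<And>i. y i \<in> X" "\<And>i. 2 ^ Suc i < f (y i)"
    by metis
  obtain b where b: "\<And>x. x \<in> X \<Longrightarrow> b \<le> f x"
    using A_l_bounded_below[OF X(1) f] by blast
  have aff: "affine_on X f" using f by (simp add: A_l_def)
  \<comment> \<open>The series is not summed: \<open>K n\<close> consists of its \<open>n\<close>-th
    partial sum plus all conceivable tails, and any point common to these nested compact sets takes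
    the place of the sum.\<close>
  define s where "s = (\<lambda>n. \<Sum>i<n. (1 / 2 ^ Suc i) *\<^sub>R y i)"
  define K where "K = (\<lambda>n. (\<lambda>z. s n + (1 / 2 ^ n) *\<^sub>R z) ` X)"
  have mid: "(1/2) *\<^sub>R a + (1/2) *\<^sub>R c \<in> X" if "a \<in> X" "c \<in> X" for a c
    using convexD[OF X(2) that, of "1/2" "1/2"] by simp
  have step: "s (Suc n) + (1 / 2 ^ Suc n) *\<^sub>R z = s n + (1 / 2 ^ n) *\<^sub>R ((1/2) *\<^sub>R y n + (1/2) *\<^sub>R z)" for n z
    by (simp add: s_def scaleR_add_right mult.commute)
  \<comment> \<open>The weight \<open>1 / 2 ^ Suc i\<close> of \<open>y i\<close> and the bound
    \<open>2 ^ Suc i < f (y i)\<close> match, so each term contributes at least 1.\<close>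
  have in_X: "s n + (1 / 2 ^ n) *\<^sub>R z \<in> X \<and> real n + f z / 2 ^ n \<le> f (s n + (1 / 2 ^ n) *\<^sub>R z)"
    if "z \<in> X" for n z
    using that
  proof (induction n arbitrary: z)
    case 0
    then show ?case by (simp add: s_def)
  next
    case (Suc n)
    let ?w = "(1/2) *\<^sub>R y n + (1/2) *\<^sub>R z"
    have w: "?w \<in> X"
      using mid y(1) Suc.prems by blast
    have "f ?w = f (y n) / 2 + f z / 2"
      using affine_onD[OF aff y(1) Suc.prems, of "1/2"] by simp
    moreover have "f (y n) / 2 / 2 ^ n \<ge> 1"
      using y(2)[of n] by (simp add: field_simps)
    ultimately have "1 + f z / 2 ^ Suc n \<le> f ?w / 2 ^ n"
      by (simp add: add_divide_distrib)
    then show ?case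
      unfolding step using Suc.IH[OF w] by auto
  qed
  have "K (Suc n) \<subseteq> K n" for n
    unfolding K_def step using mid y(1) by auto
  then have anti: "K m \<subseteq> K n" if "n \<le> m" for n m
    using lift_Suc_antimono_le[of K, OF _ that] by blast
  have clo: "closed (K n)" for n
    unfolding K_def by (intro compact_imp_closed compact_continuous_image continuous_intros X)
  have "X \<inter> (\<Inter>n\<in>UNIV. K n) \<noteq> {}"
  proof (rule compact_imp_fip_image[OF X(1) clo])
    fix I :: "nat set" assume "finite I"
    \<comment> \<open>Inserting 0 gives the maximum a meaning for empty \<open>I\<close>.\<close>
    then have "K (Max (insert 0 I)) \<subseteq> (\<Inter>n\<in>I. K n)"
      by (intro INT_greatest anti) simp
    moreover have "s (Max (insert 0 I)) + (1 / 2 ^ Max (insert 0 I)) *\<^sub>R y 0 \<in> X \<inter> K (Max (insert 0 I))"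
      using in_X[OF y(1)[of 0]] y(1) by (auto simp: K_def)
    ultimately show "X \<inter> (\<Inter>n\<in>I. K n) \<noteq> {}" by blast
  qed
  then obtain x where x: "\<And>n. x \<in> K n" by blast
  \<comment> \<open>The tail contributes \<open>f z / 2 ^ n\<close>, and the lower bound
    \<open>b\<close> of \<open>f\<close> keeps it above \<open>- \<bar>b\<bar>\<close> for every
    \<open>n\<close>.\<close>
  have "real n - \<bar>b\<bar> \<le> f x" for n
  proof -
    obtain z where z: "z \<in> X" "x = s n + (1 / 2 ^ n) *\<^sub>R z"
      using x[of n] by (auto simp: K_def)
    have "- \<bar>b\<bar> \<le> - \<bar>b\<bar> / 2 ^ n"
      using divide_left_mono[of 1 "2 ^ n" "\<bar>b\<bar>"] by simp
    also have "\<dots> \<le> f z / 2 ^ n"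
      using b[OF z(1)] by (intro divide_right_mono) auto
    finally show ?thesis
      using in_X[OF z(1), of n] z(2) by simp
  qed
  moreover obtain n where "f x + \<bar>b\<bar> < real n"
    using reals_Archimedean2 by blast
  ultimately show False
    by (metis add.commute diff_le_eq not_le)
qed

lemma A_l_subset_A_b:
  fixes X :: "'a::locally_convex_space set"
  assumes "compact X" "convex X"
  shows "A_l X \<subseteq> A_b X"
proof
  fix f assume f: "f \<in> A_l X"
  obtain b c where "\<And>x. x \<in> X \<Longrightarrow> b \<le> f x" "\<And>x. x \<in> X \<Longrightarrow> f x \<le> c"
    using A_l_bounded_below[OF assms(1) f] A_l_bounded_above[OF assms f] by metis
  then have "f ` X \<subseteq> {b..c}" by auto
  then have "bounded (f ` X)"
    using bounded_subset bounded_closed_interval by blast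
  then show "f \<in> A_b X"
    using f by (simp add: A_b_def A_l_def)
qed

lemma A_s_subset_A_b:
  fixes X :: "'a::locally_convex_space set"
  assumes "compact X" "convex X"
  shows "A_s X \<subseteq> A_b X"
  using A_l_subset_A_b[OF assms] subspace_diff[OF subspace_A_b] by (fastforce simp: A_s_def)

text \<open>The set of pairs with difference in \<open>U\<close> is a countable union of rational
  boxes. They are taken half-open because \<open>{p < f}\<close> is open while
  \<open>{f \<le> p'}\<close> is closed, so that the preimage of each box under
  \<open>(f, g)\<close> is the intersection of a closed and an open set.\<close>

lemma A_s_subset_Bo_1: "A_s X \<subseteq> Bo_1 X"
proof
  fix h assume "h \<in> A_s X"
  then obtain f g where fg: "f \<in> A_l X" "g \<in> A_l X" "h = f - g"
    by (auto simp: A_s_def)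
  have op: "openin (top_of_set X) {x \<in> X. r < u x}" if "u \<in> A_l X" for u r
    using that by (simp add: A_l_def lower_semicontinuous_on_def)
  have cl: "closedin (top_of_set X) {x \<in> X. u x \<le> r}" if "u \<in> A_l X" for u r
  proof -
    have "{x \<in> X. u x \<le> r} = X - {x \<in> X. r < u x}" by auto
    then show ?thesis
      using closedin_diff[OF closedin_topspace op[OF that, of r]] by simp
  qed
  have "\<exists>F G :: nat \<Rightarrow> 'a set. (\<forall>n. closedin (top_of_set X) (F n) \<and> openin (top_of_set X) (G n)) \<and>
      {x\<in>X. h x \<in> U} = (\<Union>n. F n \<inter> G n)" if U: "open U" for U
  proof -
    define box where "box = (\<lambda>(p, p', q, q'). \<forall>v w. of_rat p < v \<and> v \<le> of_rat p' \<and> of_rat q < w \<and> w \<le> of_rat q'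
      \<longrightarrow> v - w \<in> (U :: real set))"
    define F where "F = (\<lambda>(p, p', q :: rat, q'). if box (p, p', q, q')
      then {x \<in> X. f x \<le> of_rat p'} \<inter> {x \<in> X. g x \<le> of_rat q'} else {})"
    define G where "G = (\<lambda>(p, p' :: rat, q, q' :: rat). {x \<in> X. of_rat p < f x} \<inter> {x \<in> X. of_rat q < g x})"
    have "closedin (top_of_set X) (F r)" "openin (top_of_set X) (G r)" for r
      using fg by (cases r; auto simp: F_def G_def intro!: closedin_Int openin_Int op cl)+
    moreover have "{x\<in>X. h x \<in> U} = (\<Union>n. F (from_nat n) \<inter> G (from_nat n))"
    proof
      show "(\<Union>n. F (from_nat n) \<inter> G (from_nat n)) \<subseteq> {x\<in>X. h x \<in> U}"
      proof
        fix x assume "x \<in> (\<Union>n. F (from_nat n) \<inter> G (from_nat n))"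
        then obtain r where r: "x \<in> F r" "x \<in> G r" by blast
        obtain p p' q q' where "r = (p, p', q, q')" by (cases r)
        then show "x \<in> {x\<in>X. h x \<in> U}"
          using r fg(3) by (auto simp: F_def G_def box_def split: if_splits)
      qed
      show "{x\<in>X. h x \<in> U} \<subseteq> (\<Union>n. F (from_nat n) \<inter> G (from_nat n))"
      proof
        fix x assume "x \<in> {x\<in>X. h x \<in> U}"
        then have x: "x \<in> X" "f x - g x \<in> U" using fg(3) by auto
        obtain e where e: "0 < e" "\<And>v. \<bar>v - (f x - g x)\<bar> < e \<Longrightarrow> v \<in> U"
          using U x(2) unfolding open_dist dist_real_def by metis
        \<comment> \<open>Each coordinate of the box deviates by less than \<open>e/2\<close>, hence
          the difference by less than \<open>e\<close>.\<close>
        obtain p p' q q' where r: "f x - e/2 < of_rat p" "of_rat p < f x" "f x < of_rat p'" "of_rat p' < f x + e/2"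
          "g x - e/2 < of_rat q" "of_rat q < g x" "g x < of_rat q'" "of_rat q' < g x + e/2"
          using of_rat_dense[of "f x - e/2" "f x"] of_rat_dense[of "f x" "f x + e/2"]
            of_rat_dense[of "g x - e/2" "g x"] of_rat_dense[of "g x" "g x + e/2"] e(1) by auto
        have "box (p, p', q, q')"
          unfolding box_def using r by (auto intro!: e(2) simp: abs_less_iff)
        then have "x \<in> F (p, p', q, q') \<inter> G (p, p', q, q')"
          using r x by (auto simp: F_def G_def)
        then show "x \<in> (\<Union>n. F (from_nat n) \<inter> G (from_nat n))"
          by (intro UN_I[of "to_nat (p, p', q, q')"]) auto
      qed
    qed
    ultimately show ?thesis
      by (intro exI[of _ "\<lambda>n. F (from_nat n)"] exI[of _ "\<lambda>n. G (from_nat n)"]) simp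
  qed
  moreover have "h \<in> functions_on X"
    using fg by (auto simp: A_l_def functions_on_def)
  ultimately show "h \<in> Bo_1 X"
    by (simp add: Bo_1_def)
qed

text \<open>The approximations are the infimal convolutions of \<open>f\<close> with \<open>n d\<close>, where \<open>d\<close> is a metric.\<close>

lemma A_l_limit_of_continuous:
  fixes X :: "'a::locally_convex_space set"
  assumes X: "compact X" and met: "metrizable_space (top_of_set X)" and f: "f \<in> A_l X"
  obtains g :: "nat \<Rightarrow> 'a \<Rightarrow> real"
  where "\<And>n. continuous_on X (g n)" "\<And>x. x \<in> X \<Longrightarrow> (\<lambda>n. g n x) \<longlonglongrightarrow> f x"
proof -
  obtain M d where M: "Metric_space M d" and top: "top_of_set X = Metric_space.mtopology M d"
    using met unfolding metrizable_space_def by blast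
  interpret Metric_space M d by fact
  have MX: "M = X"
    using arg_cong[OF top, of topspace] by simp
  obtain b where b: "\<And>x. x \<in> X \<Longrightarrow> b \<le> f x"
    using A_l_bounded_below[OF X f] by blast
  define g where "g = (\<lambda>(n::nat) x. INF y\<in>X. f y + n * d x y)"
  have bdd: "bdd_below ((\<lambda>y. f y + n * d x y) ` X)" for n :: nat and x
    by (rule bdd_belowI2[of _ b]) (use b in \<open>simp add: add_increasing2\<close>)
  have le: "g n x \<le> f y + n * d x y" if "y \<in> X" for n x y
    unfolding g_def using bdd that by (rule cINF_lower)
  have great: "r \<le> g n x" if "x \<in> X" "\<And>y. y \<in> X \<Longrightarrow> r \<le> f y + n * d x y" for r n x
    unfolding g_def using that by (intro cINF_greatest) auto
  \<comment> \<open>Continuity of \<open>g n\<close> comes from this: it is Lipschitz with constant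
    \<open>n\<close> for the metric \<open>d\<close>.\<close>
  have lip: "g n x \<le> g n z + n * d x z" if "x \<in> X" "z \<in> X" for n x z
  proof -
    have "g n x - n * d x z \<le> g n z"
    proof (rule great[OF that(2)])
      fix y assume y: "y \<in> X"
      have "real n * d x y \<le> real n * (d x z + d z y)"
        using triangle[of x z y] that y MX by (intro mult_left_mono) auto
      then show "g n x - n * d x z \<le> f y + n * d z y"
        using le[OF y, of n x] by (simp add: algebra_simps)
    qed
    then show ?thesis by simp
  qed
  show thesis
  proof (rule that[of g])
    show "continuous_on X (g n)" for n
      unfolding continuous_on_topological
    proof (intro ballI allI impI)
      fix x B assume x: "x \<in> X" and B: "open B" "g n x \<in> B"
      obtain e where e: "0 < e" "\<And>v. \<bar>v - g n x\<bar> < e \<Longrightarrow> v \<in> B"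
        using B unfolding open_dist dist_real_def by metis
      \<comment> \<open>The added 1 keeps the radius defined for \<open>n = 0\<close>.\<close>
      define r where "r = e / (real n + 1)"
      have r: "0 < r" using e(1) by (simp add: r_def)
      have "openin (top_of_set X) (mball x r)"
        unfolding top by blast
      then obtain T where T: "open T" "mball x r = X \<inter> T"
        by (auto simp: openin_open)
      have "g n z \<in> B" if z: "z \<in> X" "z \<in> T" for z
      proof -
        have "z \<in> mball x r" using T z by blast
        then have "d x z < r" by simp
        then have "(real n + 1) * d x z < e"
          by (simp add: r_def field_simps)
        moreover have "0 \<le> d x z" by simp
        moreover have "(real n + 1) * d x z = n * d x z + d x z"
          by (simp add: algebra_simps)
        ultimately have "n * d x z < e"
          by linarith
        then show ?thesis
          using lip[OF x z(1), of n] lip[OF z(1) x, of n] commute[of z x] by (intro e(2)) (simp add: abs_less_iff)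
      qed
      moreover have "x \<in> T"
        using x r MX T(2) centre_in_mball_iff[of x r] by blast
      ultimately show "\<exists>A. open A \<and> x \<in> A \<and> (\<forall>y\<in>X. y \<in> A \<longrightarrow> g n y \<in> B)"
        using T(1) by blast
    qed
    show "(\<lambda>n. g n x) \<longlonglongrightarrow> f x" if x: "x \<in> X" for x
      unfolding LIMSEQ_def dist_real_def
    proof (intro allI impI)
      fix e :: real assume e: "0 < e"
      have "openin mtopology {y \<in> X. f x - e/2 < f y}"
        using f unfolding top[symmetric] by (simp add: A_l_def lower_semicontinuous_on_def)
      then obtain r where r: "0 < r" "mball x r \<subseteq> {y \<in> X. f x - e/2 < f y}"
        using x e unfolding openin_mtopology by force
      \<comment> \<open>At distance at least \<open>r\<close> the penalty \<open>n d\<close> exceeds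
        \<open>f x - b\<close>, which outweighs the lowest possible value of \<open>f\<close>;
        closer to \<open>x\<close>, lower semicontinuity already bounds \<open>f\<close> from
        below.\<close>
      obtain N :: nat where N: "(f x - b) / r < N"
        using reals_Archimedean2 by blast
      have "\<bar>g n x - f x\<bar> < e" if n: "N \<le> n" for n
      proof -
        have "f x - e/2 \<le> g n x"
        proof (rule great[OF x])
          fix y assume y: "y \<in> X"
          show "f x - e/2 \<le> f y + n * d x y"
          proof (cases "d x y < r")
            case True
            then have "y \<in> mball x r"
              unfolding in_mball using x y MX by simp
            then have "f x - e/2 < f y"
              using r(2) by blast
            moreover have "0 \<le> n * d x y" by simp
            ultimately show ?thesis by linarith
          next
            case False
            have "(f x - b) / r < n"
              using N n by simp
            then have "f x - b < n * r"
              using r(1) by (simp add: field_simps)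
            also have "n * r \<le> n * d x y"
              using False by (intro mult_left_mono) auto
            finally show ?thesis
              using b[OF y] e by linarith
          qed
        qed
        moreover have "g n x \<le> f x"
          using le[OF x, of n x] x MX by simp
        ultimately show ?thesis using e by (simp add: abs_less_iff)
      qed
      then show "\<exists>N. \<forall>n\<ge>N. \<bar>g n x - f x\<bar> < e" by blast
    qed
  qed
qed

lemma A_s_subset_A_1:
  fixes X :: "'a::locally_convex_space set"
  assumes X: "compact X" and met: "metrizable_space (top_of_set X)"
  shows "A_s X \<subseteq> A_1 X"
proof
  fix h assume "h \<in> A_s X"
  then obtain f g where fg: "f \<in> A_l X" "g \<in> A_l X" "h = f - g"
    by (auto simp: A_s_def)
  obtain u where u: "\<And>n. continuous_on X (u n)" "\<And>x. x \<in> X \<Longrightarrow> (\<lambda>n::nat. u n x) \<longlonglongrightarrow> f x"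
    using A_l_limit_of_continuous[OF X met fg(1)] by blast
  obtain v where v: "\<And>n. continuous_on X (v n)" "\<And>x. x \<in> X \<Longrightarrow> (\<lambda>n::nat. v n x) \<longlonglongrightarrow> g x"
    using A_l_limit_of_continuous[OF X met fg(2)] by blast
  have "\<forall>n. continuous_on X (\<lambda>x. u n x - v n x)" "\<forall>x\<in>X. (\<lambda>n. u n x - v n x) \<longlonglongrightarrow> h x"
    using u v fg(3) by (auto intro!: continuous_on_diff tendsto_diff)
  then have "\<exists>g. (\<forall>n. continuous_on X (g n)) \<and> (\<forall>x\<in>X. (\<lambda>n::nat. g n x) \<longlonglongrightarrow> h x)"
    by (intro exI[of _ "\<lambda>n x. u n x - v n x"]) blast
  moreover have "h \<in> functions_on X" "affine_on X h"
    using fg by (auto simp: A_l_def functions_on_def affine_on_diff)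
  ultimately show "h \<in> A_1 X"
    by (simp add: A_1_def)
qed

section \<open>The affine function of a split extreme point\<close>

lemma affine_on_cong:
  assumes "convex X" "\<And>x. x \<in> X \<Longrightarrow> f x = g x"
  shows "affine_on X f \<longleftrightarrow> affine_on X g"
  using assms by (simp add: affine_on_def convex_alt)

text \<open>This is the converse of \<open>split_face_if_affine\<close>. Mixing the decompositions
  of \<open>y\<close> and \<open>z\<close> gives a decomposition of their mixture, because the
  complementary set is convex; uniqueness of the coefficient then says that \<open>l\<close> is
  affine.\<close>

lemma split_face_affine_function:
  fixes X :: "'a::locally_convex_space set"
  assumes X: "convex X" and x: "x \<in> ext X" and split: "split_face X {x}"
  obtains l where "affine_on X l" "\<And>y. y \<in> X \<Longrightarrow> 0 \<le> l y \<and> l y \<le> 1" "l x = 1"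
    "\<And>y. y \<in> X \<Longrightarrow> \<exists>d\<in>X. y = l y *\<^sub>R x + (1 - l y) *\<^sub>R d"
proof -
  define G where "G = complementary_set X {x}"
  have xX: "x \<in> X"
    using x by (auto simp: ext_def extreme_point_of_def)
  have xG: "x \<notin> G"
    by (auto simp: G_def complementary_set_def)
  have GX: "G \<subseteq> X"
    using face_of_imp_subset by (auto simp: G_def complementary_set_def)
  have G_convex: "convex G"
    using split by (simp add: split_face_def G_def)
  \<comment> \<open>This conclusion contradicts \<open>xG\<close>, so a point strictly between
    \<open>x\<close> and a point of \<open>G\<close> is never in \<open>G\<close>: a face containing
    it would contain \<open>x\<close>. On \<open>G\<close> itself this forces the coefficient
    0.\<close>
  have face: "x \<in> G" if sd: "s *\<^sub>R x + (1 - s) *\<^sub>R d \<in> G" "d \<in> G" "0 < s" "s < 1" for s d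
  proof -
    let ?w = "s *\<^sub>R x + (1 - s) *\<^sub>R d"
    obtain F where F: "F face_of X" "F \<inter> {x} = {}" "?w \<in> F"
      using sd(1) by (auto simp: G_def complementary_set_def)
    have "?w \<in> open_segment d x"
      unfolding in_segment using that xG add.commute[of "s *\<^sub>R x"] by blast
    then have "x \<in> F"
      using F(1,3) that(2) GX xX unfolding face_of_def by blast
    with F(2) show ?thesis by blast
  qed
  have ex: "\<exists>s a. 0 < s \<and> s < 1 \<and> a \<in> G \<and> y = s *\<^sub>R x + (1 - s) *\<^sub>R a"
    and un: "\<And>s a s' a'. \<lbrakk>0 < s; s < 1; a \<in> G; y = s *\<^sub>R x + (1 - s) *\<^sub>R a;
      0 < s'; s' < 1; a' \<in> G; y = s' *\<^sub>R x + (1 - s') *\<^sub>R a'\<rbrakk> \<Longrightarrow> s = s'"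
    if y: "y \<in> X" "y \<noteq> x" "y \<notin> G" for y
  proof -
    let ?Q = "\<lambda>p. case p of (s, a, a') \<Rightarrow>
      s \<in> {0<..<1} \<and> a \<in> {x} \<and> a' \<in> G \<and> y = s *\<^sub>R a + (1 - s) *\<^sub>R a'"
    have Q: "\<exists>!p. ?Q p"
      using split y by (simp add: split_face_def flip: G_def)
    then obtain p where "?Q p" by blast
    then show "\<exists>s a. 0 < s \<and> s < 1 \<and> a \<in> G \<and> y = s *\<^sub>R x + (1 - s) *\<^sub>R a"
      by (cases p) auto
    fix s a s' a'
    assume "0 < s" "s < 1" "a \<in> G" "y = s *\<^sub>R x + (1 - s) *\<^sub>R a"
      "0 < s'" "s' < 1" "a' \<in> G" "y = s' *\<^sub>R x + (1 - s') *\<^sub>R a'"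
    then have "?Q (s, x, a)" "?Q (s', x, a')" by auto
    then have "(s, x, a) = (s', x, a')"
      using Q by blast
    then show "s = s'" by simp
  qed
  show thesis
  proof (cases "G = {}")
    case True
    then have "X = {x}"
      using ex xX by blast
    then show ?thesis
      by (intro that[of "\<lambda>_. 1"]) (auto simp: affine_on_def)
  next
    case False
    then obtain g where g: "g \<in> G" by blast
    \<comment> \<open>Admitting the coefficients 0 and 1 lets \<open>x\<close> and the points of
      \<open>G\<close> be treated like all others; the coefficient stays unique, though at
      \<open>x\<close> the point \<open>d\<close> is arbitrary.\<close>
    define P where "P = (\<lambda>y s d. 0 \<le> s \<and> s \<le> 1 \<and> d \<in> G \<and> y = s *\<^sub>R x + (1 - s) *\<^sub>R d)"
    have P_ex: "\<exists>s d. P y s d" if y: "y \<in> X" for y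
    proof -
      consider "y = x" | "y \<in> G" | "y \<noteq> x" "y \<notin> G" by blast
      then show ?thesis
      proof cases
        case 1
        then have "P y 1 g" using g by (simp add: P_def)
        then show ?thesis by blast
      next
        case 2
        then have "P y 0 y" by (simp add: P_def)
        then show ?thesis by blast
      next
        case 3
        then obtain s a where "0 < s" "s < 1" "a \<in> G" "y = s *\<^sub>R x + (1 - s) *\<^sub>R a"
          using ex[OF y] by blast
        then have "P y s a" by (simp add: P_def)
        then show ?thesis by blast
      qed
    qed
    have P1: "s = 1" if "P x s d" for s d
    proof (rule ccontr)
      assume "s \<noteq> 1"
      have "(1 - s) *\<^sub>R d = x - s *\<^sub>R x"
        using that unfolding P_def by (metis add_diff_cancel_left')
      then have "(1 - s) *\<^sub>R d = (1 - s) *\<^sub>R x"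
        by (simp add: scaleR_diff_left)
      then have "d = x" using \<open>s \<noteq> 1\<close> by simp
      then show False using that xG by (simp add: P_def)
    qed
    have P0: "s = 0" if "P y s d" "y \<in> G" for y s d
    proof (rule ccontr)
      assume "s \<noteq> 0"
      moreover have "s \<noteq> 1"
        using that xG by (auto simp: P_def)
      ultimately show False
        using face[of s d] that xG by (auto simp: P_def)
    qed
    have P_un: "s = s'" if P: "P y s d" "P y s' d'" for y s d s' d'
    proof (cases "y = x \<or> y \<in> G")
      case True
      then show ?thesis using P P1 P0 by metis
    next
      case False
      then have ne: "s \<noteq> 0" "s \<noteq> 1" "s' \<noteq> 0" "s' \<noteq> 1"
        using P by (auto simp: P_def)
      have p: "0 \<le> s" "s \<le> 1" "d \<in> G" "y = s *\<^sub>R x + (1 - s) *\<^sub>R d"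
        and p': "0 \<le> s'" "s' \<le> 1" "d' \<in> G" "y = s' *\<^sub>R x + (1 - s') *\<^sub>R d'"
        using P unfolding P_def by blast+
      have s: "0 < s" "s < 1" "0 < s'" "s' < 1"
        using ne p(1,2) p'(1,2) by linarith+
      have "s *\<^sub>R x + (1 - s) *\<^sub>R d \<in> X"
        using p(1-3) GX by (intro convexD[OF X xX]) auto
      then have "y \<in> X"
        using p(4) by simp
      then show ?thesis
        using un[OF _ _ _ s(1,2) p(3,4) s(3,4) p'(3,4)] False by blast
    qed
    obtain l e where le: "\<And>y. y \<in> X \<Longrightarrow> P y (l y) (e y)"
      using P_ex by metis
    show ?thesis
    proof (rule that[of l])
      show "0 \<le> l y \<and> l y \<le> 1" if "y \<in> X" for y
        using le[OF that] by (simp add: P_def)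
      show "l x = 1"
        using le[OF xX] P1 by blast
      show "\<exists>d\<in>X. y = l y *\<^sub>R x + (1 - l y) *\<^sub>R d" if "y \<in> X" for y
        using le[OF that] GX unfolding P_def by blast
      show "affine_on X l"
        unfolding affine_on_def
      proof (intro ballI)
        fix y z and t :: real assume yz: "y \<in> X" "z \<in> X" and t: "t \<in> {0..1}"
        let ?w = "(1 - t) *\<^sub>R y + t *\<^sub>R z"
        define L where "L = (1 - t) * l y + t * l z"
        have w: "?w \<in> X"
          using X yz t by (simp add: convex_alt)
        have y: "0 \<le> l y" "l y \<le> 1" "e y \<in> G" "y = l y *\<^sub>R x + (1 - l y) *\<^sub>R e y"
          and z: "0 \<le> l z" "l z \<le> 1" "e z \<in> G" "z = l z *\<^sub>R x + (1 - l z) *\<^sub>R e z"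
          using le[OF yz(1)] le[OF yz(2)] by (simp_all add: P_def)
        \<comment> \<open>\<open>A\<close> and \<open>B\<close> are the weights of the two
          components in \<open>G\<close>; divided by their sum \<open>1 - L\<close> they become
          convex weights, which needs \<open>L \<noteq> 1\<close>.\<close>
        define A where "A = (1 - t) * (1 - l y)"
        define B where "B = t * (1 - l z)"
        have AB: "0 \<le> A" "0 \<le> B" "A + B = 1 - L"
          using y(1,2) z(1,2) t by (simp_all add: A_def B_def L_def) (simp add: algebra_simps)
        have "0 \<le> L"
          using y(1) z(1) t by (simp add: L_def)
        have "?w = (1 - t) *\<^sub>R (l y *\<^sub>R x + (1 - l y) *\<^sub>R e y) + t *\<^sub>R (l z *\<^sub>R x + (1 - l z) *\<^sub>R e z)"
          using y(4) z(4) by simp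
        then have w_eq: "?w = L *\<^sub>R x + (A *\<^sub>R e y + B *\<^sub>R e z)"
          by (simp add: L_def A_def B_def scaleR_add_right scaleR_add_left)
        have "\<exists>c\<in>G. A *\<^sub>R e y + B *\<^sub>R e z = (1 - L) *\<^sub>R c"
        proof (cases "L = 1")
          case True
          then have "A = 0" "B = 0" using AB by linarith+
          then show ?thesis using True g by auto
        next
          case False
          then have "0 < 1 - L" using AB by linarith
          then have "(A / (1 - L)) *\<^sub>R e y + (B / (1 - L)) *\<^sub>R e z \<in> G"
            using AB y(3) z(3) by (intro convexD[OF G_convex]) (auto simp flip: add_divide_distrib)
          moreover have "A *\<^sub>R e y + B *\<^sub>R e z = (1 - L) *\<^sub>R ((A / (1 - L)) *\<^sub>R e y + (B / (1 - L)) *\<^sub>R e z)"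
            using \<open>0 < 1 - L\<close> by (simp add: scaleR_add_right)
          ultimately show ?thesis by blast
        qed
        then obtain c where "c \<in> G" "A *\<^sub>R e y + B *\<^sub>R e z = (1 - L) *\<^sub>R c" by blast
        then have "P ?w L c"
          using \<open>0 \<le> L\<close> AB w_eq by (simp add: P_def)
        then show "l ?w = (1 - t) * l y + t * l z"
          using P_un[OF le[OF w]] by (simp add: L_def)
      qed
    qed
  qed
qed

lemma A_s_split_extreme_point:
  fixes X :: "'a::locally_convex_space set"
  assumes X: "compact X" "convex X" and x: "x \<in> ext X" and split: "split_face X {x}"
  obtains l where "l \<in> A_s X" "\<And>y. y \<in> X \<Longrightarrow> 0 \<le> l y \<and> l y \<le> 1" "l x = 1"
    "\<And>y. y \<in> X \<Longrightarrow> \<exists>d\<in>X. y = l y *\<^sub>R x + (1 - l y) *\<^sub>R d"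
proof -
  obtain k where k: "affine_on X k" "\<And>y. y \<in> X \<Longrightarrow> 0 \<le> k y \<and> k y \<le> 1" "k x = 1"
    "\<And>y. y \<in> X \<Longrightarrow> \<exists>d\<in>X. y = k y *\<^sub>R x + (1 - k y) *\<^sub>R d"
    using split_face_affine_function[OF X(2) x split] by blast
  have xX: "x \<in> X"
    using x by (auto simp: ext_def extreme_point_of_def)
  have closed: "closed {y \<in> X. r \<le> k y}" for r
  proof -
    consider "r \<le> 0" | "1 < r" | "0 < r" "r \<le> 1" by linarith
    then show ?thesis
    proof cases
      case 1
      then have "{y \<in> X. r \<le> k y} = X"
        using k(2) by force
      then show ?thesis
        using X(1) by (simp add: compact_imp_closed)
    next
      case 2
      then have "{y \<in> X. r \<le> k y} = {}"
        using k(2) by force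
      then show ?thesis by (simp only: closed_empty)
    next
      case 3
      have "{y \<in> X. r \<le> k y} = (\<lambda>z. r *\<^sub>R x + (1 - r) *\<^sub>R z) ` X"
      proof
        show "(\<lambda>z. r *\<^sub>R x + (1 - r) *\<^sub>R z) ` X \<subseteq> {y \<in> X. r \<le> k y}"
        proof
          fix y assume "y \<in> (\<lambda>z. r *\<^sub>R x + (1 - r) *\<^sub>R z) ` X"
          then obtain z where z: "z \<in> X" "y = r *\<^sub>R x + (1 - r) *\<^sub>R z" by blast
          have "y \<in> X"
            using convexD[OF X(2) xX z(1), of r "1 - r"] 3 z(2) by simp
          moreover have "k y = r + (1 - r) * k z"
            using affine_onD[OF k(1) xX z(1), of r] 3 z(2) k(3) by simp
          ultimately show "y \<in> {y \<in> X. r \<le> k y}"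
            using 3 k(2)[OF z(1)] by simp
        qed
        show "{y \<in> X. r \<le> k y} \<subseteq> (\<lambda>z. r *\<^sub>R x + (1 - r) *\<^sub>R z) ` X"
        proof
          fix y assume "y \<in> {y \<in> X. r \<le> k y}"
          then have y: "y \<in> X" "r \<le> k y" by auto
          obtain d where d: "d \<in> X" "y = k y *\<^sub>R x + (1 - k y) *\<^sub>R d"
            using k(4)[OF y(1)] by blast
          show "y \<in> (\<lambda>z. r *\<^sub>R x + (1 - r) *\<^sub>R z) ` X"
          proof (cases "r = 1")
            case True
            then have "k y = 1" using k(2)[OF y(1)] y(2) by simp
            then have "y = r *\<^sub>R x + (1 - r) *\<^sub>R x"
              using d(2) True by simp
            then show ?thesis using xX by blast
          next
            case False
            then have r: "0 < 1 - r" using 3 by simp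
            \<comment> \<open>The share \<open>r\<close> of \<open>x\<close> is split off from its
              total share \<open>k y\<close>; what remains, rescaled by \<open>1 - r\<close>, is a
              convex combination of \<open>x\<close> and \<open>d\<close>.\<close>
            define a where "a = (k y - r) / (1 - r)"
            define b where "b = (1 - k y) / (1 - r)"
            have "0 \<le> a" "0 \<le> b"
              using y(2) k(2)[OF y(1)] r by (simp_all add: a_def b_def)
            moreover have "a + b = 1"
              using r by (simp add: a_def b_def flip: add_divide_distrib)
            ultimately have "a *\<^sub>R x + b *\<^sub>R d \<in> X"
              using convexD[OF X(2) xX d(1)] by simp
            moreover have "y = r *\<^sub>R x + (1 - r) *\<^sub>R (a *\<^sub>R x + b *\<^sub>R d)"
            proof -
              have "(1 - r) * a = k y - r" "(1 - r) * b = 1 - k y"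
                using r by (simp_all add: a_def b_def)
              then have "r *\<^sub>R x + (1 - r) *\<^sub>R (a *\<^sub>R x + b *\<^sub>R d) = k y *\<^sub>R x + (1 - k y) *\<^sub>R d"
                by (simp add: scaleR_add_right flip: scaleR_add_left)
              then show ?thesis using d(2) by simp
            qed
            ultimately show ?thesis by blast
          qed
        qed
      qed
      moreover have "compact ((\<lambda>z. r *\<^sub>R x + (1 - r) *\<^sub>R z) ` X)"
        by (intro compact_continuous_image continuous_intros X)
      ultimately show ?thesis
        by (simp add: compact_imp_closed)
    qed
  qed
  \<comment> \<open>The cut-off makes the coefficient a member of \<open>functions_on X\<close>.
    Being upper semicontinuous, it enters \<open>A_s X\<close> as \<open>0 - (- l)\<close>.\<close>
  define l where "l = (\<lambda>y. if y \<in> X then k y else 0)"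
  have l: "l y = k y" if "y \<in> X" for y
    using that by (simp add: l_def)
  have "affine_on X l"
    using k(1) affine_on_cong[OF X(2), of l k] l by simp
  then have "affine_on X (- l)"
    using affine_on_scale[of X l "-1"] by simp
  moreover have "lower_semicontinuous_on X (- l)"
    unfolding lower_semicontinuous_on_def
  proof
    fix r
    have "{y \<in> X. r < (- l) y} = X - {y \<in> X. - r \<le> k y}"
      using l by auto
    moreover have "closedin (top_of_set X) {y \<in> X. - r \<le> k y}"
      using closed by (intro closed_subset) auto
    ultimately show "openin (top_of_set X) {y \<in> X. r < (- l) y}"
      using openin_diff[OF openin_topspace, of "top_of_set X"] by fastforce
  qed
  ultimately have "- l \<in> A_l X"
    by (simp add: A_l_def functions_on_def l_def)
  moreover have "0 \<in> A_l X"
  proof -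
    have "{x \<in> X. r < 0} = (if r < 0 then X else {})" for r :: real
      by auto
    then show ?thesis
      by (simp add: A_l_def functions_on_def affine_on_def lower_semicontinuous_on_def)
  qed
  moreover have "l = 0 - (- l)" by simp
  ultimately have "l \<in> A_s X"
    unfolding A_s_def by blast
  then show thesis
    using that[of l] k l xX by simp
qed

section \<open>Intermediate function spaces\<close>

lemma intermediate_function_spaceD:
  assumes "intermediate_function_space X H" and "convex X"
  shows "subspace H" "indicat_real X \<in> H" "\<And>a y. \<lbrakk>a \<in> H; y \<notin> X\<rbrakk> \<Longrightarrow> a y = 0"
    "\<And>a. a \<in> H \<Longrightarrow> affine_on X a" "\<And>a. a \<in> H \<Longrightarrow> bounded (a ` X)"
    "\<And>a. a \<in> H \<Longrightarrow> bdd_above ((\<lambda>x. \<bar>a x\<bar>) ` X)"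
    "\<And>a x. \<lbrakk>a \<in> H; x \<in> X\<rbrakk> \<Longrightarrow> \<bar>a x\<bar> \<le> sup_norm X a"
proof -
  have H: "subspace H" "A_c X \<subseteq> H" "H \<subseteq> A_b X"
    using assms(1) by (auto simp: intermediate_function_space_def)
  show "subspace H" by fact
  have "affine_on X (indicat_real X)"
    using affine_on_cong[OF assms(2), of "indicat_real X" "\<lambda>_. 1"] by (simp add: affine_on_def)
  moreover have "continuous_on X (indicat_real X)"
    using continuous_on_cong[of X X "indicat_real X" "\<lambda>_. 1"] by simp
  ultimately show "indicat_real X \<in> H"
    using H(2) by (auto simp: A_c_def functions_on_def)
  show "a y = 0" if "a \<in> H" "y \<notin> X" for a y
    using that H(3) by (auto simp: A_b_def functions_on_def)
  show "affine_on X a" if "a \<in> H" for a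
    using that H(3) by (auto simp: A_b_def)
  show bd: "bounded (a ` X)" if "a \<in> H" for a
    using that H(3) by (auto simp: A_b_def)
  show bdd: "bdd_above ((\<lambda>x. \<bar>a x\<bar>) ` X)" if aH: "a \<in> H" for a
  proof -
    obtain B where "\<And>x. x \<in> X \<Longrightarrow> \<bar>a x\<bar> \<le> B"
      using bd[OF aH] by (auto simp: bounded_iff)
    then show ?thesis by (intro bdd_aboveI2)
  qed
  show "\<bar>a x\<bar> \<le> sup_norm X a" if "a \<in> H" "x \<in> X" for a x
    unfolding sup_norm_def using bdd[OF that(1)] that(2) by (intro cSUP_upper)
qed

lemma sup_norm_le: "\<lbrakk>X \<noteq> {}; \<And>x. x \<in> X \<Longrightarrow> \<bar>a x\<bar> \<le> B\<rbrakk> \<Longrightarrow> sup_norm X a \<le> B"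
  unfolding sup_norm_def by (rule cSUP_least)

section \<open>States and evaluations\<close>

lemma evaluation_in_state_space:
  assumes H: "intermediate_function_space X H" and X: "convex X" and x: "x \<in> X"
  shows "evaluation H x \<in> state_space X H"
proof -
  note HD = intermediate_function_spaceD[OF H X]
  have "linear_on H (evaluation H x)"
    using HD(1) by (simp add: linear_on_def evaluation_def subspace_add subspace_scale)
  moreover have "\<exists>K. \<forall>a\<in>H. \<bar>evaluation H x a\<bar> \<le> K * sup_norm X a"
    using HD(7)[OF _ x] by (intro exI[of _ 1]) (simp add: evaluation_def)
  moreover have "\<forall>a. a \<notin> H \<longrightarrow> evaluation H x a = 0"
    by (simp add: evaluation_def)
  ultimately have "evaluation H x \<in> dual X H"
    unfolding dual_def by blast
  moreover have "dual_norm X H (evaluation H x) \<le> 1"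
    unfolding dual_norm_def
  proof (rule cSUP_least)
    have "sup_norm X 0 \<le> 1"
      by (rule sup_norm_le) (use x in auto)
    then show "{a \<in> H. sup_norm X a \<le> 1} \<noteq> {}"
      using subspace_0[OF HD(1)] by blast
    show "\<bar>evaluation H x a\<bar> \<le> 1" if "a \<in> {a \<in> H. sup_norm X a \<le> 1}" for a
      using that HD(7)[of a x] x by (simp add: evaluation_def)
  qed
  ultimately show ?thesis
    using HD(2) x by (simp add: state_space_def evaluation_def)
qed

text \<open>For \<open>0 \<le> a \<le> B\<close> on \<open>X\<close> with \<open>B > 0\<close> the
  function \<open>1 - a / B\<close> has norm at most 1, so
  \<open>1 - \<phi> a / B \<le> 1\<close>.\<close>

lemma state_positive:
  assumes H: "intermediate_function_space X H" and X: "convex X" "X \<noteq> {}"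
    and \<phi>: "\<phi> \<in> state_space X H" and a: "a \<in> H" "0 \<le> a"
  shows "0 \<le> \<phi> a"
proof -
  note HD = intermediate_function_spaceD[OF H X(1)]
  obtain K where lin: "linear_on H \<phi>" and K: "\<And>b. b \<in> H \<Longrightarrow> \<bar>\<phi> b\<bar> \<le> K * sup_norm X b"
    and norm: "dual_norm X H \<phi> \<le> 1" and one: "\<phi> (indicat_real X) = 1"
    using \<phi> by (auto simp: state_space_def dual_def)
  \<comment> \<open>The added 1 makes \<open>B\<close> positive also for
    \<open>a = 0\<close>.\<close>
  define B where "B = sup_norm X a + 1"
  have B: "\<bar>a x\<bar> < B" if "x \<in> X" for x
    using HD(7)[OF a(1) that] by (simp add: B_def)
  then have "0 < B"
    using X(2) by fastforce
  define b where "b = indicat_real X - inverse B *\<^sub>R a"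
  have bH: "b \<in> H"
    unfolding b_def by (intro subspace_diff subspace_scale HD(1,2) a)
  have "sup_norm X b \<le> 1"
  proof (rule sup_norm_le[OF X(2)])
    fix x assume x: "x \<in> X"
    have "0 \<le> inverse B * a x"
      using \<open>0 < B\<close> le_funD[OF a(2), of x] by simp
    moreover have "inverse B * a x \<le> 1"
      using \<open>0 < B\<close> B[OF x] by (simp add: field_simps)
    ultimately show "\<bar>b x\<bar> \<le> 1"
      using x by (simp add: b_def)
  qed
  \<comment> \<open>A supremum of reals is an upper bound only for a bounded set, so the bound
    \<open>K\<close> is needed before \<open>dual_norm\<close> says anything; \<open>K\<close> may
    be negative, hence its absolute value.\<close>
  have "bdd_above ((\<lambda>a. \<bar>\<phi> a\<bar>) ` {a \<in> H. sup_norm X a \<le> 1})"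
  proof (rule bdd_aboveI2)
    fix c assume c: "c \<in> {a \<in> H. sup_norm X a \<le> 1}"
    obtain x where "x \<in> X" using X(2) by blast
    then have "0 \<le> sup_norm X c"
      using HD(7)[of c x] c by simp
    then have "K * sup_norm X c \<le> \<bar>K\<bar> * 1"
      using c by (intro mult_mono) auto
    then show "\<bar>\<phi> c\<bar> \<le> \<bar>K\<bar>"
      using K[of c] c by simp
  qed
  then have "\<bar>\<phi> b\<bar> \<le> dual_norm X H \<phi>"
    unfolding dual_norm_def using bH \<open>sup_norm X b \<le> 1\<close> by (intro cSUP_upper) auto
  moreover have "\<phi> b = 1 - inverse B * \<phi> a"
    unfolding b_def using linear_on_diff[OF lin HD(1) HD(2) subspace_scale[OF HD(1) a(1)]]
      linear_on_scale[OF lin HD(1) a(1)] one by simp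
  ultimately have "0 \<le> inverse B * \<phi> a"
    using norm by linarith
  then show ?thesis
    using \<open>0 < B\<close> by (simp add: zero_le_mult_iff)
qed

lemma indicator_minus_nonneg:
  assumes "\<And>y. y \<in> X \<Longrightarrow> l y \<le> 1" "\<And>y. y \<notin> X \<Longrightarrow> l y = 0"
  shows "0 \<le> indicat_real X - l"
  unfolding le_fun_def using assms by (auto simp: indicator_def)

text \<open>
  Since \<open>b y = l y b x + (1 - l y) b d\<close>, the function \<open>b - b x l\<close> is bounded by a multiple
  of \<open>1 - l\<close>. Both extremality of evaluations and locality of order bounded operators follow.
\<close>

lemma positive_functional_at_split_point:
  assumes H: "intermediate_function_space X H" and X: "convex X" and x: "x \<in> X"
    and l: "l \<in> H" "\<And>y. y \<in> X \<Longrightarrow> 0 \<le> l y \<and> l y \<le> 1"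
      "\<And>y. y \<in> X \<Longrightarrow> \<exists>d\<in>X. y = l y *\<^sub>R x + (1 - l y) *\<^sub>R d"
    and \<psi>: "linear_on H \<psi>" "\<And>a. \<lbrakk>a \<in> H; 0 \<le> a\<rbrakk> \<Longrightarrow> 0 \<le> \<psi> a" "\<psi> (indicat_real X - l) \<le> 0"
    and b: "b \<in> H"
  shows "\<psi> b = b x * \<psi> (indicat_real X)"
proof -
  note HD = intermediate_function_spaceD[OF H X]
  define B where "B = sup_norm X b"
  let ?u = "indicat_real X - l"
  let ?v = "b - b x *\<^sub>R l"
  have uH: "?u \<in> H" and vH: "?v \<in> H"
    by (intro subspace_diff subspace_scale HD(1,2) l b)+
  have le: "\<bar>?v y\<bar> \<le> B * ?u y" for y
  proof (cases "y \<in> X")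
    case True
    then obtain d where d: "d \<in> X" "y = l y *\<^sub>R x + (1 - l y) *\<^sub>R d"
      using l(3) by blast
    have "b y = l y * b x + (1 - l y) * b d"
      using affine_onD[OF HD(4)[OF b] x d(1), of "l y"] l(2)[OF True] d(2) by simp
    then have "\<bar>?v y\<bar> = (1 - l y) * \<bar>b d\<bar>"
      using l(2)[OF True] by (simp add: abs_mult)
    also have "\<dots> \<le> (1 - l y) * B"
      using l(2)[OF True] HD(7)[OF b d(1)] by (intro mult_left_mono) (auto simp: B_def)
    finally show ?thesis
      using True by (simp add: mult.commute)
  next
    case False
    then show ?thesis
      using HD(3)[OF l(1) False] HD(3)[OF b False] by simp
  qed
  have lin_B: "\<psi> (B *\<^sub>R ?u) = B * \<psi> ?u"
    using linear_on_scale[OF \<psi>(1) HD(1) uH, of B] by simp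
  have "0 \<le> ?u"
    using l(2) HD(3)[OF l(1)] by (intro indicator_minus_nonneg) auto
  then have \<psi>u: "\<psi> ?u = 0"
    using \<psi>(2)[OF uH] \<psi>(3) by simp
  have minus: "0 \<le> B *\<^sub>R ?u - ?v"
  proof (rule le_funI)
    show "0 y \<le> (B *\<^sub>R ?u - ?v) y" for y
      using le[of y] by (simp only: zero_fun_apply minus_apply[of "B *\<^sub>R ?u" ?v] scaleR_fun_apply
          real_scaleR_def abs_le_iff) linarith
  qed
  have plus: "0 \<le> B *\<^sub>R ?u + ?v"
  proof (rule le_funI)
    show "0 y \<le> (B *\<^sub>R ?u + ?v) y" for y
      using le[of y] by (simp only: zero_fun_apply plus_fun_apply scaleR_fun_apply
          real_scaleR_def abs_le_iff) linarith
  qed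
  have "0 \<le> \<psi> (B *\<^sub>R ?u - ?v)"
    by (intro \<psi>(2) subspace_diff subspace_scale HD(1) uH vH minus)
  moreover have "0 \<le> \<psi> (B *\<^sub>R ?u + ?v)"
    by (intro \<psi>(2) subspace_add subspace_scale HD(1) uH vH plus)
  ultimately have "\<psi> ?v = 0"
    using linear_on_diff[OF \<psi>(1) HD(1) subspace_scale[OF HD(1) uH, of B] vH]
      linear_on_add[OF \<psi>(1) HD(1) subspace_scale[OF HD(1) uH, of B] vH] lin_B \<psi>u by simp
  then have "\<psi> b = b x * \<psi> l"
    using linear_on_diff[OF \<psi>(1) HD(1) b subspace_scale[OF HD(1) l(1)]]
      linear_on_scale[OF \<psi>(1) HD(1) l(1)] by simp
  moreover have "\<psi> l = \<psi> (indicat_real X)"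
    using \<psi>u linear_on_diff[OF \<psi>(1) HD(1) HD(2) l(1)] by simp
  ultimately show ?thesis by simp
qed

lemma evaluation_extreme:
  assumes H: "intermediate_function_space X H" and X: "convex X" and x: "x \<in> X"
    and l: "l \<in> H" "\<And>y. y \<in> X \<Longrightarrow> 0 \<le> l y \<and> l y \<le> 1" "l x = 1"
      "\<And>y. y \<in> X \<Longrightarrow> \<exists>d\<in>X. y = l y *\<^sub>R x + (1 - l y) *\<^sub>R d"
  shows "evaluation H x \<in> ext (state_space X H)"
proof -
  note HD = intermediate_function_spaceD[OF H X]
  let ?u = "indicat_real X - l"
  have uH: "?u \<in> H"
    by (intro subspace_diff HD(1,2) l)
  have u0: "0 \<le> ?u"
    using l(2) HD(3)[OF l(1)] by (intro indicator_minus_nonneg) auto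
  have state_eq: "\<phi> = evaluation H x" if \<phi>: "\<phi> \<in> state_space X H" "\<phi> ?u \<le> 0" for \<phi>
  proof
    fix b
    have lin: "linear_on H \<phi>" and off: "b \<notin> H \<Longrightarrow> \<phi> b = 0" and one: "\<phi> (indicat_real X) = 1"
      using \<phi>(1) by (auto simp: state_space_def dual_def)
    have "X \<noteq> {}" using x by blast
    have "\<phi> b = b x * \<phi> (indicat_real X)" if bH: "b \<in> H"
    proof (rule positive_functional_at_split_point[OF H X x l(1,2,4) lin _ \<phi>(2) bH])
      show "0 \<le> \<phi> a" if "a \<in> H" "0 \<le> a" for a
        by (rule state_positive[OF H X \<open>X \<noteq> {}\<close> \<phi>(1) that])
    qed
    then have "\<phi> b = b x" if "b \<in> H"
      using one that by simp
    then show "\<phi> b = evaluation H x b"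
      using off by (auto simp: evaluation_def)
  qed
  have "evaluation H x \<notin> open_segment \<phi> \<psi>"
    if \<phi>\<psi>: "\<phi> \<in> state_space X H" "\<psi> \<in> state_space X H" for \<phi> \<psi>
  proof
    assume "evaluation H x \<in> open_segment \<phi> \<psi>"
    then obtain t where t: "\<phi> \<noteq> \<psi>" "0 < t" "t < 1" "evaluation H x = (1 - t) *\<^sub>R \<phi> + t *\<^sub>R \<psi>"
      unfolding in_segment by blast
    have "X \<noteq> {}" using x by blast
    \<comment> \<open>\<open>?u\<close> vanishes at \<open>x\<close> since \<open>l x = 1\<close>,
      and both states are nonnegative on it, so both vanish on it.\<close>
    have "0 = (1 - t) * \<phi> ?u + t * \<psi> ?u"
      using fun_cong[OF t(4), of ?u] uH x l(3) by (simp add: evaluation_def)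
    moreover have "0 \<le> (1 - t) * \<phi> ?u" "0 \<le> t * \<psi> ?u"
      using t(2,3) state_positive[OF H X \<open>X \<noteq> {}\<close> \<phi>\<psi>(1) uH u0]
        state_positive[OF H X \<open>X \<noteq> {}\<close> \<phi>\<psi>(2) uH u0] by simp_all
    ultimately have "(1 - t) * \<phi> ?u = 0" "t * \<psi> ?u = 0"
      by linarith+
    then have "\<phi> ?u = 0" "\<psi> ?u = 0"
      using t(2,3) by simp_all
    then have "\<phi> = evaluation H x" "\<psi> = evaluation H x"
      by (intro state_eq \<phi>\<psi>; simp)+
    then show False using t(1) by simp
  qed
  then show ?thesis
    using evaluation_in_state_space[OF H X x] by (simp add: ext_def extreme_point_of_def)
qed

section \<open>Order bounded operators, center and multipliers\<close>

lemma order_bounded_operator_local: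
  assumes H: "intermediate_function_space X H" and X: "convex X" and x: "x \<in> X"
    and l: "l \<in> H" "\<And>y. y \<in> X \<Longrightarrow> 0 \<le> l y \<and> l y \<le> 1" "l x = 1"
      "\<And>y. y \<in> X \<Longrightarrow> \<exists>d\<in>X. y = l y *\<^sub>R x + (1 - l y) *\<^sub>R d"
    and T: "T \<in> order_bounded_operators X H" and a: "a \<in> H"
  shows "T a x = T (indicat_real X) x * a x"
proof -
  note HD = intermediate_function_spaceD[OF H X]
  obtain k where lin: "linear_on H T" and k: "positive_operator H (\<lambda>a. k *\<^sub>R a - T a)"
    "positive_operator H (\<lambda>a. T a - (- k) *\<^sub>R a)"
    using T by (auto simp: order_bounded_operators_def)
  have le: "T b y \<le> k * b y" "- (k * b y) \<le> T b y" if "b \<in> H" "0 \<le> b" for b y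
  proof -
    have "0 \<le> k *\<^sub>R b - T b" "0 \<le> T b - (- k) *\<^sub>R b"
      using k that unfolding positive_operator_def by blast+
    from this[THEN le_funD, of y] show "T b y \<le> k * b y" "- (k * b y) \<le> T b y"
      by simp_all
  qed
  define \<psi> where "\<psi> = (\<lambda>b. k * b x - T b x)"
  let ?u = "indicat_real X - l"
  have uH: "?u \<in> H"
    by (intro subspace_diff HD(1,2) l)
  have u0: "0 \<le> ?u"
    using l(2) HD(3)[OF l(1)] by (intro indicator_minus_nonneg) auto
  have "\<psi> a = a x * \<psi> (indicat_real X)"
  proof (rule positive_functional_at_split_point[OF H X x l(1,2,4) _ _ _ a])
    show "linear_on H \<psi>"
      using lin by (simp add: linear_on_def \<psi>_def algebra_simps)
    show "0 \<le> \<psi> b" if "b \<in> H" "0 \<le> b" for b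
      using le(1)[OF that] by (simp add: \<psi>_def)
    \<comment> \<open>As \<open>?u\<close> vanishes at \<open>x\<close>, the lower order bound on
      \<open>T\<close> reads \<open>0 \<le> T ?u x\<close>.\<close>
    show "\<psi> ?u \<le> 0"
      using le(2)[OF uH u0, of x] x l(3) by (simp add: \<psi>_def)
  qed
  then show ?thesis
    using x by (simp add: \<psi>_def algebra_simps)
qed

text \<open>A member of \<open>H\<close> is determined by its values on \<open>ext X\<close>, and
  inequalities valid there hold on \<open>X\<close>. Hence the products of \<open>u\<close> with
  members of \<open>H\<close> define a map \<open>T\<close>, and linearity, norm bound and order
  bounds of multiplication by \<open>u\<close> on \<open>ext X\<close> pass to
  \<open>T\<close>.\<close>

lemma multipliers_subset_center:
  assumes H: "intermediate_function_space X H" and X: "convex X"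
    and det: "determined_by_extreme_points X H"
  shows "multipliers X H \<subseteq> center X H"
proof
  note HD = intermediate_function_spaceD[OF H X]
  let ?I = "indicat_real X"
  fix u assume u: "u \<in> multipliers X H"
  then have uH: "u \<in> H" by (simp add: multipliers_def)
  obtain T where T: "\<And>a. a \<in> H \<Longrightarrow> T a \<in> H" "\<And>a x. \<lbrakk>a \<in> H; x \<in> ext X\<rbrakk> \<Longrightarrow> T a x = u x * a x"
    using u unfolding multipliers_def by (auto; metis)
  have ext_X: "x \<in> X" if "x \<in> ext X" for x
    using that by (auto simp: ext_def extreme_point_of_def)
  \<comment> \<open>The constants rule out that \<open>ext X\<close> is empty, where \<open>INF\<close> and \<open>SUP\<close> are meaningless.\<close>
  have ext_ne: "ext X \<noteq> {}" if x: "x \<in> X" for x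
  proof
    assume "ext X = {}"
    then have *: "c \<le> Sup ({} :: real set)" for c
      using det[unfolded determined_by_extreme_points_def, rule_format, OF subspace_scale[OF HD(1) HD(2), of c] x] x
      by simp
    have "Sup ({} :: real set) + 1 \<le> Sup {}" by (rule *)
    then show False by simp
  qed
  have nonneg: "0 \<le> v" if v: "v \<in> H" "\<And>x. x \<in> ext X \<Longrightarrow> 0 \<le> v x" for v
  proof (rule le_funI)
    fix x
    show "0 x \<le> v x"
    proof (cases "x \<in> X")
      case True
      have "0 \<le> (INF e\<in>ext X. v e)"
        using ext_ne[OF True] v(2) by (rule cINF_greatest)
      also have "\<dots> \<le> v x"
        using det v(1) True unfolding determined_by_extreme_points_def by blast
      finally show ?thesis by simp
    qed (use HD(3)[OF v(1)] in simp)
  qed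
  have le: "v \<le> w" if "v \<in> H" "w \<in> H" "\<And>x. x \<in> ext X \<Longrightarrow> v x \<le> w x" for v w
    using nonneg[of "w - v"] that subspace_diff[OF HD(1) that(2,1)] by (simp add: le_fun_def)
  have eq: "v = w" if "v \<in> H" "w \<in> H" "\<And>x. x \<in> ext X \<Longrightarrow> v x = w x" for v w
    using le[of v w] le[of w v] that by simp
  have "linear_on H T"
    unfolding linear_on_def
  proof (intro conjI ballI allI)
    show "T (a + b) = T a + T b" if "a \<in> H" "b \<in> H" for a b
      using that by (intro eq T(1) subspace_add HD(1)) (simp_all add: T subspace_add[OF HD(1)] distrib_left)
    show "T (c *\<^sub>R a) = c *\<^sub>R T a" if "a \<in> H" for a c
      using that by (intro eq T(1) subspace_scale HD(1)) (simp_all add: T subspace_scale[OF HD(1)])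
  qed
  moreover have "T ?I = u"
    using ext_X by (intro eq T(1) HD(2) uH) (simp add: T(2) HD(2))
  moreover have "\<exists>K. \<forall>a\<in>H. sup_norm X (T a) \<le> K * sup_norm X a"
  \<comment> \<open>For empty \<open>X\<close> every \<open>sup_norm\<close> is the default value
    \<open>Sup {}\<close>, about which only equality is known; this suffices with the constant
    1.\<close>
  proof (cases "X = {}")
    case True
    then show ?thesis
      by (intro exI[of _ 1]) (simp add: sup_norm_def)
  next
    case False
    have "sup_norm X (T a) \<le> sup_norm X u * sup_norm X a" if a: "a \<in> H" for a
    proof (rule sup_norm_le[OF False])
      fix x assume x: "x \<in> X"
      let ?c = "sup_norm X u * sup_norm X a"
      have cI: "?c *\<^sub>R ?I \<in> H"
        by (intro subspace_scale HD)
      have "\<bar>T a e\<bar> \<le> ?c" if e: "e \<in> ext X" for e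
        using HD(7)[OF uH ext_X[OF e]] HD(7)[OF a ext_X[OF e]] T(2)[OF a e]
        by (simp add: abs_mult mult_mono')
      then have "T a \<le> ?c *\<^sub>R ?I" "- (T a) \<le> ?c *\<^sub>R ?I"
        using ext_X by (auto intro!: le cI T(1) a subspace_neg[OF HD(1)] simp: abs_le_iff)
      then show "\<bar>T a x\<bar> \<le> ?c"
        using x by (auto simp: abs_le_iff le_fun_def dest!: spec[of _ x])
    qed
    then show ?thesis by blast
  qed
  moreover have "\<exists>k\<ge>0. positive_operator H (\<lambda>a. k *\<^sub>R a - T a) \<and> positive_operator H (\<lambda>a. T a - (- k) *\<^sub>R a)"
  \<comment> \<open>The absolute value secures a nonnegative constant also for empty
    \<open>X\<close>, where the sign of \<open>sup_norm\<close> is unknown.\<close>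
  proof (intro exI[of _ "\<bar>sup_norm X u\<bar>"] conjI)
    let ?k = "\<bar>sup_norm X u\<bar>"
    have *: "u e * a e \<le> ?k * a e" "- (?k * a e) \<le> u e * a e" if "a \<in> H" "0 \<le> a" "e \<in> ext X" for a e
    proof -
      have "\<bar>u e\<bar> \<le> ?k"
        using HD(7)[OF uH ext_X[OF that(3)]] by linarith
      moreover have "0 \<le> a e"
        using le_funD[OF that(2), of e] by simp
      ultimately have "\<bar>u e * a e\<bar> \<le> ?k * a e"
        by (simp add: abs_mult mult_right_mono)
      then show "u e * a e \<le> ?k * a e" "- (?k * a e) \<le> u e * a e"
        by linarith+
    qed
    show "positive_operator H (\<lambda>a. ?k *\<^sub>R a - T a)"
      unfolding positive_operator_def
      using * by (intro ballI impI nonneg subspace_diff subspace_scale HD(1) T(1)) (simp_all add: T(2))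
    show "positive_operator H (\<lambda>a. T a - (- ?k) *\<^sub>R a)"
      unfolding positive_operator_def
    proof (intro ballI impI nonneg subspace_diff subspace_scale HD(1) T(1))
      fix a e assume "a \<in> H" "0 \<le> a" "e \<in> ext X"
      from *(2)[OF this] T(2)[OF this(1,3)] show "0 \<le> (T a - (- ?k) *\<^sub>R a) e"
        by simp
    qed
  qed simp
  ultimately show "u \<in> center X H"
    unfolding center_def order_bounded_operators_def using T(1) by blast
qed

theorem corollary6p8:
  fixes X :: "'a::locally_convex_space set" and H :: "('a \<Rightarrow> real) set"
  assumes "compact X" and "convex X" and "intermediate_function_space X H"
  shows "((\<forall>x\<in>ext X. split_face X {x}) \<and> A_s X \<subseteq> H \<longrightarrow>
            (\<forall>x\<in>ext X. evaluation H x \<in> ext (state_space X H)) \<and>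
            (determined_by_extreme_points X H \<longrightarrow> center X H = multipliers X H)) \<and>
         (choquet_simplex X \<longrightarrow> (\<forall>x\<in>ext X. split_face X {x})) \<and>
         (A_b X \<inter> Bo_1 X \<subseteq> H \<longrightarrow> A_s X \<subseteq> H) \<and>
         (metrizable_space (top_of_set X) \<and> A_1 X \<subseteq> H \<longrightarrow> A_s X \<subseteq> H)"
proof (intro conjI impI ballI)
  note X = assms(1,2) and H = assms(3)
  assume split: "(\<forall>x\<in>ext X. split_face X {x}) \<and> A_s X \<subseteq> H"
  have ext_X: "x \<in> X" if "x \<in> ext X" for x
    using that by (auto simp: ext_def extreme_point_of_def)
  have *: "\<exists>l. l \<in> H \<and> (\<forall>y\<in>X. 0 \<le> l y \<and> l y \<le> 1) \<and> l x = 1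
      \<and> (\<forall>y\<in>X. \<exists>d\<in>X. y = l y *\<^sub>R x + (1 - l y) *\<^sub>R d)" if x: "x \<in> ext X" for x
    using A_s_split_extreme_point[OF X x] split x by (metis subsetD)
  show "evaluation H x \<in> ext (state_space X H)" if x: "x \<in> ext X" for x
    using *[OF x] evaluation_extreme[OF H X(2) ext_X[OF x]] by blast
  assume det: "determined_by_extreme_points X H"
  show "center X H = multipliers X H"
  proof
    show "multipliers X H \<subseteq> center X H"
      by (rule multipliers_subset_center[OF H X(2) det])
    show "center X H \<subseteq> multipliers X H"
    proof
      fix u assume "u \<in> center X H"
      then obtain T where T: "T \<in> order_bounded_operators X H" "u = T (indicat_real X)"
        by (auto simp: center_def)
      have TH: "T a \<in> H" if "a \<in> H" for a
        using T(1) that by (auto simp: order_bounded_operators_def)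
      \<comment> \<open>On \<open>ext X\<close> the operator is multiplication by \<open>u\<close>,
        so \<open>T a\<close> itself is the function that the definition of a multiplier asks
        for.\<close>
      have "T a x = u x * a x" if a: "a \<in> H" and x: "x \<in> ext X" for a x
        using *[OF x] order_bounded_operator_local[OF H X(2) ext_X[OF x] _ _ _ _ T(1) a] T(2) by blast
      then show "u \<in> multipliers X H"
        using TH intermediate_function_spaceD(2)[OF H X(2)] T(2) unfolding multipliers_def by blast
    qed
  qed
next
  show "split_face X {x}" if "choquet_simplex X" "x \<in> ext X" for x
    using split_face_simplex assms(1,2) that by blast
  show "A_s X \<subseteq> H" if "A_b X \<inter> Bo_1 X \<subseteq> H"
    using A_s_subset_A_b[OF assms(1,2)] A_s_subset_Bo_1[of X] that by blast
  show "A_s X \<subseteq> H" if "metrizable_space (top_of_set X) \<and> A_1 X \<subseteq> H"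
    using A_s_subset_A_1[OF assms(1)] that by blast
qed

end
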